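(* Let $n$ be an odd number, $h_n:=(n-1)/2$, $1\le\ell\le h_n$, and let $U\subset\mathbb R^{n+1}$ be a bounded slice Cauchy domain. For $I\in\mathbb S$ set $ds_I=ds(-I)$. 1) If $f$ is a left slice hyperholomorphic function on a set that contains $\overline U$, then $\tilde f(x)=D\Delta_{n+1}^{\ell-1}f(x)$ is axially polyharmonic of degree $h_n-\ell+1$ and $$\tilde f(x)=\frac1{2\pi}\int_{\partial(U\cap\mathbb C_I)}\mathbf H_\ell(s,x)\,ds_I\,f(s),\qquad x\in U.$$ 2) If $f$ is a right slice hyperholomorphic function on a set that contains $\overline U$, then $\tilde f(x)=f(x)D\Delta_{n+1}^{\ell-1}$ is axially polyharmonic of degree $h_n-\ell+1$ and $$\tilde f(x)=\frac1{2\pi}\int_{\partial(U\cap\mathbb C_I)}f(s)\,ds_I\,\mathbf H_\ell(s,x),\qquad x\in U.$$ Moreover, these integrals depend neither on $U$ nor on the imaginary unit $I\in\mathbb S$, and they are independent of the kernel of $D\Delta_{n+1}^{\ell-1}$ (i.e. replacing $f$ by another left, resp. right, slice hyperholomorphic function with the same image under $D\Delta_{n+1}^{\ell-1}$ does not change them).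
   Context: $\mathbb R_n$ is the real Clifford algebra generated by $e_1,\dots,e_n$ with $e_ie_j+e_je_i=-2\delta_{ij}$. A point $(x_0,\dots,x_n)\in\mathbb R^{n+1}$ is identified with the paravector $x=x_0+\underline x$, $\underline x=\sum_{j=1}^n x_je_j$; $|x|^2=\sum_{j=0}^nx_j^2$. $\mathbb S$ is the set of $\underline x$ with $|\underline x|=1$; for $I\in\mathbb S$, $\mathbb C_I=\mathbb R+I\mathbb R$. $[x]=\{x_0+I|\underline x|: I\in\mathbb S\}$. An open $U\subset\mathbb R^{n+1}$ is axially symmetric if $[x]\subset U$ for all $x\in U$; it is a slice Cauchy domain if it is axially symmetric and, for every $I\in\mathbb S$, $\partial(U\cap\mathbb C_I)$ is a finite union of non-intersecting piecewise continuously differentiable Jordan curves in $\mathbb C_I$ (positively oriented). For $U$ axially symmetric open let $\mathcal U=\{(u,v)\in\mathbb R^2: u+\mathbb S v\subset U\}$. $f:U\to\mathbb R_n$ is left (resp. right) slice hyperholomorphic if $f(u+Iv)=\alpha(u,v)+I\beta(u,v)$ (resp. $\alpha(u,v)+\beta(u,v)I$) for all $I\in\mathbb S$, $(u,v)\in\mathcal U$, with differentiable $\alpha,\beta:\mathcal U\to\mathbb R_n$ satisfying $\alpha(u,-v)=\alpha(u,v)$, $\beta(u,-v)=-\beta(u,v)$ and $\partial_u\alpha=\partial_v\beta$, $\partial_v\alpha=-\partial_u\beta$. $Df=\partial_{x_0}f+\sum_{i=1}^ne_i\partial_{x_i}f$, $fD=\partial_{x_0}f+\sum_{i=1}^n\partial_{x_i}f\,e_i$,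 $\Delta_{n+1}=\sum_{j=0}^n\partial_{x_j}^2$. A function $g$ of class $\mathcal C^{2k}$, $k\ge1$, is left (resp. right) axially polyharmonic of degree $k$ if $\Delta_{n+1}^kg=0$ and $g(x)=A(x_0,|\underline x|)+\frac{\underline x}{|\underline x|}B(x_0,|\underline x|)$ (resp. $A+B\frac{\underline x}{|\underline x|}$) with $\mathbb R_n$-valued $A$ even and $B$ odd in the second variable; in 1) "left", in 2) "right" is meant. Kernel: for $s\notin[x]$, $\mathcal Q_{c,s}(x)=s^2-2x_0s+|x|^2$ and $\mathbf H_\ell(s,x)=\sigma_{n,\ell}\,\mathcal Q_{c,s}(x)^{-\ell}$, where $\sigma_{n,\ell}=2^{2\ell-1}(\ell-1)!\,(-h_n)_\ell$ and $(-h_n)_\ell=(-1)^\ell\frac{h_n!}{(h_n-\ell)!}$. *)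

theory Defs
  imports "HOL-Complex_Analysis.Complex_Analysis"
begin

section \<open>The real Clifford algebra\<close>

text \<open>
  The index type \<open>'n\<close> has \<open>n = CARD('n)\<close> elements, and its linear order fixes the order of the
  generators. An element of the algebra is given by its real coefficients with respect to the
  \<open>2^n\<close> blades \<open>e_A = e_(a_1) \<cdots> e_(a_k)\<close>, where \<open>A = {a_1 < \<cdots> < a_k}\<close>.
\<close>

typedef 'n clifford = "UNIV :: (real ^ ('n::{finite,linorder} set)) set"
  morphisms coeffs Clifford
  by simp

setup_lifting type_definition_clifford

text \<open>
  \<open>e_A e_B = blade_sign A B e_C\<close> where \<open>C\<close> is the symmetric difference of \<open>A\<close> and \<open>B\<close>: a factor
  \<open>-1\<close> for every pair with \<open>b < a\<close>, because \<open>e_b\<close> has to be moved past \<open>e_a\<close>, and a factor \<open>-1\<close>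
  for every common index, because \<open>e_a^2 = -1\<close>.
\<close>

definition blade_sign :: "'n::linorder set \<Rightarrow> 'n set \<Rightarrow> real" where
  "blade_sign A B = (\<Prod>a\<in>A. \<Prod>b\<in>B. if b \<le> a then -1 else 1)"

lemma blade_sign_empty [simp]: "blade_sign {} B = 1" "blade_sign A {} = 1"
  by (simp_all add: blade_sign_def)

lemma prod_sym_diff:
  fixes f :: "'a \<Rightarrow> real"
  assumes "finite A" "finite B" "\<And>x. f x * f x = 1"
  shows "prod f (sym_diff A B) = prod f A * prod f B"
proof -
  have sq: "prod f (A \<inter> B) * prod f (A \<inter> B) = 1"
    by (simp add: prod.distrib[symmetric] assms(3))
  have A: "prod f A = prod f (A - B) * prod f (A \<inter> B)"
    using prod.Int_Diff[OF assms(1), of f B] by (simp add: mult.commute)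
  have B: "prod f B = prod f (B - A) * prod f (A \<inter> B)"
    using prod.Int_Diff[OF assms(2), of f A] by (simp add: mult.commute Int_commute)
  have "prod f (sym_diff A B) = prod f (A - B) * prod f (B - A)"
    using assms by (intro prod.union_disjoint) auto
  also have "\<dots> = prod f (A - B) * prod f (B - A) * (prod f (A \<inter> B) * prod f (A \<inter> B))"
    by (simp add: sq)
  finally show ?thesis by (simp add: A B algebra_simps)
qed

lemma blade_sign_sym_diff_left:
  fixes A B C :: "'n::{finite,linorder} set"
  shows "blade_sign (sym_diff A B) C = blade_sign A C * blade_sign B C"
  unfolding blade_sign_def
  by (rule prod_sym_diff) (auto simp: prod.distrib[symmetric] intro!: prod.neutral)

lemma blade_sign_sym_diff_right:
  fixes A B C :: "'n::{finite,linorder} set"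
  shows "blade_sign A (sym_diff B C) = blade_sign A B * blade_sign A C"
  unfolding blade_sign_def prod.distrib[symmetric]
  by (intro prod.cong refl prod_sym_diff) auto

instantiation clifford :: ("{finite,linorder}") real_vector
begin
lift_definition zero_clifford :: "'a clifford" is 0 .
lift_definition plus_clifford :: "'a clifford \<Rightarrow> 'a clifford \<Rightarrow> 'a clifford" is "(+)" .
lift_definition minus_clifford :: "'a clifford \<Rightarrow> 'a clifford \<Rightarrow> 'a clifford" is "(-)" .
lift_definition uminus_clifford :: "'a clifford \<Rightarrow> 'a clifford" is uminus .
lift_definition scaleR_clifford :: "real \<Rightarrow> 'a clifford \<Rightarrow> 'a clifford" is scaleR .
instance by standard (transfer; simp add: algebra_simps)+
end

lift_definition blade :: "'n::{finite,linorder} set \<Rightarrow> 'n clifford" is "\<lambda>A. axis A 1" .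

lemma sum_sym_diff_shift:
  fixes g :: "'n::finite set \<Rightarrow> real"
  shows "(\<Sum>B\<in>UNIV. g (sym_diff A B)) = (\<Sum>B\<in>UNIV. g B)"
  by (rule sum.reindex_bij_witness[of _ "sym_diff A" "sym_diff A"]) (auto simp: sum.neutral)

instantiation clifford :: ("{finite,linorder}") real_algebra_1
begin
definition one_clifford :: "'a clifford" where "1 = blade {}"
lift_definition times_clifford :: "'a clifford \<Rightarrow> 'a clifford \<Rightarrow> 'a clifford" is
  "\<lambda>x y. \<chi> C. \<Sum>A\<in>UNIV. blade_sign A (sym_diff A C) * (x $ A * y $ sym_diff A C)" .
instance
proof
  fix x y z :: "'a clifford" and r :: real
  show "x * y * z = x * (y * z)"
  proof (transfer, rule vec_eq_iff[THEN iffD2], rule allI)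
    fix x y z :: "real ^ 'a set" and D
    let ?s = "blade_sign :: 'a set \<Rightarrow> 'a set \<Rightarrow> real"
    have "(\<Sum>E\<in>UNIV. ?s E (sym_diff E D) *
        ((\<Sum>A\<in>UNIV. ?s A (sym_diff A E) * (x $ A * y $ sym_diff A E)) * z $ sym_diff E D))
      = (\<Sum>E\<in>UNIV. \<Sum>A\<in>UNIV. ?s E (sym_diff E D) * ?s A (sym_diff A E) *
          (x $ A * y $ sym_diff A E * z $ sym_diff E D))"
      by (simp add: sum_distrib_left sum_distrib_right mult_ac)
    also have "\<dots> = (\<Sum>A\<in>UNIV. \<Sum>E\<in>UNIV. ?s E (sym_diff E D) * ?s A (sym_diff A E) *
          (x $ A * y $ sym_diff A E * z $ sym_diff E D))"
      by (rule sum.swap)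
    also have "\<dots> = (\<Sum>A\<in>UNIV. \<Sum>B\<in>UNIV. ?s A (sym_diff A D) * ?s B (sym_diff B (sym_diff A D)) *
          (x $ A * y $ B * z $ sym_diff B (sym_diff A D)))"
    proof (rule sum.cong[OF refl])
      fix A :: "'a set"
      let ?g = "\<lambda>E. ?s E (sym_diff E D) * ?s A (sym_diff A E) *
          (x $ A * y $ sym_diff A E * z $ sym_diff E D)"
      have "(\<Sum>E\<in>UNIV. ?g E) = (\<Sum>B\<in>UNIV. ?g (sym_diff A B))"
        by (rule sum_sym_diff_shift[symmetric])
      also have "\<dots> = (\<Sum>B\<in>UNIV. ?s A (sym_diff A D) * ?s B (sym_diff B (sym_diff A D)) *
          (x $ A * y $ B * z $ sym_diff B (sym_diff A D)))"
      proof (rule sum.cong[OF refl])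
        fix B :: "'a set"
        let ?F = "sym_diff (sym_diff A B) D"
        have 1: "sym_diff B (sym_diff A D) = ?F" and 2: "sym_diff A (sym_diff A B) = B"
          and 3: "sym_diff A D = sym_diff B ?F" by blast+
        have "?s (sym_diff A B) ?F * ?s A B = ?s A (sym_diff A D) * ?s B ?F"
          unfolding 3 blade_sign_sym_diff_left[of A B] blade_sign_sym_diff_right[of A B ?F] by simp
        then show "?g (sym_diff A B) = ?s A (sym_diff A D) * ?s B (sym_diff B (sym_diff A D)) *
          (x $ A * y $ B * z $ sym_diff B (sym_diff A D))"
          unfolding 1 2 by simp
      qed
      finally show "(\<Sum>E\<in>UNIV. ?g E) = \<dots>" .
    qed
    also have "\<dots> = (\<Sum>A\<in>UNIV. ?s A (sym_diff A D) * (x $ A *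
        (\<Sum>B\<in>UNIV. ?s B (sym_diff B (sym_diff A D)) * (y $ B * z $ sym_diff B (sym_diff A D)))))"
      by (simp add: sum_distrib_left mult_ac)
    finally show "(\<chi> C. \<Sum>A\<in>UNIV. ?s A (sym_diff A C) *
        ((\<chi> C. \<Sum>A\<in>UNIV. ?s A (sym_diff A C) * (x $ A * y $ sym_diff A C)) $ A * z $ sym_diff A C)) $ D
      = (\<chi> C. \<Sum>A\<in>UNIV. ?s A (sym_diff A C) *
        (x $ A * (\<chi> C. \<Sum>A\<in>UNIV. ?s A (sym_diff A C) * (y $ A * z $ sym_diff A C)) $ sym_diff A C)) $ D"
      by simp
  qed
  show "(x + y) * z = x * z + y * z"
    by transfer (simp add: vec_eq_iff algebra_simps sum.distrib)
  show "x * (y + z) = x * y + x * z"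
    by transfer (simp add: vec_eq_iff algebra_simps sum.distrib)
  show "1 * x = x"
    unfolding one_clifford_def
  proof (transfer, rule vec_eq_iff[THEN iffD2], rule allI)
    fix x :: "real ^ 'a set" and C
    have "(\<Sum>A\<in>UNIV. blade_sign A (sym_diff A C) * (axis {} 1 $ A * x $ sym_diff A C)) =
      (\<Sum>A\<in>(UNIV :: 'a set set). if A = {} then x $ C else 0)"
      by (rule sum.cong[OF refl]) (auto simp: axis_def)
    then show "(\<chi> C. \<Sum>A\<in>UNIV. blade_sign A (sym_diff A C) * (axis {} 1 $ A * x $ sym_diff A C)) $ C
      = x $ C" by simp
  qed
  show "x * 1 = x"
    unfolding one_clifford_def
  proof (transfer, rule vec_eq_iff[THEN iffD2], rule allI)
    fix x :: "real ^ 'a set" and C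
    have "(\<Sum>A\<in>UNIV. blade_sign A (sym_diff A C) * (x $ A * axis {} 1 $ sym_diff A C)) =
      (\<Sum>A\<in>UNIV. if A = C then x $ C else 0)"
      by (rule sum.cong[OF refl]) (auto simp: axis_def)
    then show "(\<chi> C. \<Sum>A\<in>UNIV. blade_sign A (sym_diff A C) * (x $ A * axis {} 1 $ sym_diff A C)) $ C
      = x $ C" by simp
  qed
  show "(0::'a clifford) \<noteq> 1"
    unfolding one_clifford_def by transfer (simp add: vec_eq_iff axis_def)
  show "r *\<^sub>R x * y = r *\<^sub>R (x * y)"
    by transfer (simp add: vec_eq_iff sum_distrib_left mult_ac)
  show "x * r *\<^sub>R y = r *\<^sub>R (x * y)"
    by transfer (simp add: vec_eq_iff sum_distrib_left mult_ac)
qed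
end

text \<open>The Euclidean structure of \<open>\<real>\<^bsup>2^n\<^esup>\<close>, in which the blades are orthonormal.\<close>

instantiation clifford :: ("{finite,linorder}") euclidean_space
begin
lift_definition inner_clifford :: "'a clifford \<Rightarrow> 'a clifford \<Rightarrow> real" is inner .
lift_definition norm_clifford :: "'a clifford \<Rightarrow> real" is norm .
lift_definition sgn_clifford :: "'a clifford \<Rightarrow> 'a clifford" is sgn .
lift_definition dist_clifford :: "'a clifford \<Rightarrow> 'a clifford \<Rightarrow> real" is dist .
definition uniformity_clifford :: "('a clifford \<times> 'a clifford) filter" where
  "uniformity_clifford = (INF e\<in>{0<..}. principal {(x, y). dist x y < e})"
definition open_clifford :: "'a clifford set \<Rightarrow> bool" where
  "open_clifford U \<longleftrightarrow> (\<forall>x\<in>U. \<forall>\<^sub>F (x', y) in uniformity. x' = x \<longrightarrow> y \<in> U)"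
definition Basis_clifford :: "'a clifford set" where
  "Basis_clifford = range blade"
instance
proof
  fix x y z :: "'a clifford" and r :: real and U :: "'a clifford set"
  show "sgn x = x /\<^sub>R norm x" by transfer (simp add: sgn_div_norm)
  show "dist x y = norm (x - y)" by transfer (simp add: dist_norm)
  show "(uniformity :: ('a clifford \<times> 'a clifford) filter)
      = (INF e\<in>{0<..}. principal {(x, y). dist x y < e})"
    by (rule uniformity_clifford_def)
  show "open U \<longleftrightarrow> (\<forall>x\<in>U. \<forall>\<^sub>F (x', y) in uniformity. x' = x \<longrightarrow> y \<in> U)"
    by (rule open_clifford_def)
  show "inner x y = inner y x" by transfer (rule inner_commute)
  show "inner (x + y) z = inner x z + inner y z" by transfer (rule inner_add_left)
  show "inner (r *\<^sub>R x) y = r * inner x y" by transfer simp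
  show "0 \<le> inner x x" by transfer simp
  show "inner x x = 0 \<longleftrightarrow> x = 0" by transfer simp
  show "norm x = sqrt (inner x x)" by transfer (rule norm_eq_sqrt_inner)
  show "(Basis :: 'a clifford set) \<noteq> {}" by (simp add: Basis_clifford_def)
  show "finite (Basis :: 'a clifford set)" by (simp add: Basis_clifford_def)
  show "(\<forall>u\<in>Basis. inner x u = 0) \<longleftrightarrow> x = 0"
    unfolding Basis_clifford_def ball_simps
    by transfer (auto simp: vec_eq_iff inner_axis)
next
  fix u v :: "'a clifford"
  assume "u \<in> Basis" "v \<in> Basis"
  then show "inner u v = (if u = v then 1 else 0)"
    unfolding Basis_clifford_def
    by (elim rangeE; hypsubst; transfer) (auto simp: inner_axis_axis axis_eq_axis)
qed
end

definition gen :: "'n::{finite,linorder} \<Rightarrow> 'n clifford" where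
  "gen i = blade {i}"

lemma blade_mult: "blade A * blade B = blade_sign A B *\<^sub>R blade (sym_diff A B)"
proof (transfer, rule vec_eq_iff[THEN iffD2], rule allI)
  fix A B C :: "'a set"
  have "(\<Sum>D\<in>UNIV. blade_sign D (sym_diff D C) * (axis A 1 $ D * axis B 1 $ sym_diff D C)) =
    (\<Sum>D\<in>UNIV. if D = A then blade_sign A (sym_diff A C) * axis B 1 $ sym_diff A C else 0)"
    by (rule sum.cong[OF refl]) (auto simp: axis_def)
  also have "\<dots> = blade_sign A (sym_diff A C) * axis B 1 $ sym_diff A C" by simp
  also have "\<dots> = (blade_sign A B *\<^sub>R axis (sym_diff A B) 1) $ C"
  proof (cases "C = sym_diff A B")
    case True
    then have "sym_diff A C = B" by blast
    with True show ?thesis by simp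
  next
    case False
    then have "sym_diff A C \<noteq> B" by blast
    with False show ?thesis by (simp add: axis_def)
  qed
  finally show "(\<chi> C. \<Sum>D\<in>UNIV. blade_sign D (sym_diff D C) *
      (axis A 1 $ D * axis B 1 $ sym_diff D C)) $ C
    = (blade_sign A B *\<^sub>R axis (sym_diff A B) 1) $ C" by simp
qed

lemma gen_anticommute:
  fixes i j :: "'n::{finite,linorder}"
  shows "gen i * gen j + gen j * gen i = (if i = j then -2 else 0)"
proof (cases "i = j")
  case True
  have "gen i * gen i = (-1 :: 'n clifford)"
    by (simp add: gen_def blade_mult blade_sign_def one_clifford_def)
  with True show ?thesis by simp
next
  case False
  then have "sym_diff {i} {j} = {i, j}" "sym_diff {j} {i} = {i, j}" by auto
  with False show ?thesis by (auto simp: gen_def blade_mult blade_sign_def)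
qed

text \<open>The inverse in the (in general noncommutative) algebra; only used for invertible elements.\<close>

definition clifford_inverse :: "'n::{finite,linorder} clifford \<Rightarrow> 'n clifford" where
  "clifford_inverse a = (THE b. a * b = 1 \<and> b * a = 1)"


section \<open>Paravectors and axially symmetric sets\<close>

text \<open>A point \<open>(x\<^sub>0, x\<^sub>1, \<dots>, x\<^sub>n)\<close> of \<open>\<real>\<^bsup>n+1\<^esup>\<close>, with the Euclidean norm of the product type.\<close>

type_synonym 'n point = "real \<times> (real ^ 'n)"

definition clifford_vector :: "real ^ 'n::{finite,linorder} \<Rightarrow> 'n clifford" where
  "clifford_vector w = (\<Sum>i\<in>UNIV. (w $ i) *\<^sub>R gen i)"

definition paravector :: "'n::{finite,linorder} point \<Rightarrow> 'n clifford" where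
  "paravector x = of_real (fst x) + clifford_vector (snd x)"

definition imag_units :: "(real ^ 'n::finite) set" where
  "imag_units = {I. norm I = 1}"

definition orbit :: "'n::finite point \<Rightarrow> 'n point set" where
  "orbit x = {(fst x, norm (snd x) *\<^sub>R I) | I. I \<in> imag_units}"

definition axially_symmetric :: "'n::finite point set \<Rightarrow> bool" where
  "axially_symmetric U \<longleftrightarrow> (\<forall>x\<in>U. orbit x \<subseteq> U)"

text \<open>The plane \<open>\<complex>\<^sub>I\<close>, with the complex number \<open>u + \<i> v\<close> standing for \<open>u + I v\<close>.\<close>

definition slice_point :: "real ^ 'n::finite \<Rightarrow> complex \<Rightarrow> 'n point" where
  "slice_point I z = (Re z, Im z *\<^sub>R I)"

definition slice :: "real ^ 'n::finite \<Rightarrow> 'n point set \<Rightarrow> complex set" where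
  "slice I U = {z. slice_point I z \<in> U}"

text \<open>
  \<open>\<Gamma>\<close> consists of parametrisations of pairwise disjoint piecewise \<open>C\<^sup>1\<close> Jordan curves whose union
  is the boundary of the bounded open set \<open>S\<close>. Positive orientation, i.e. \<open>S\<close> lies to the left
  of each curve, is expressed by the winding numbers of the cycle \<open>\<Gamma>\<close>.
\<close>

definition positively_oriented_boundary :: "complex set \<Rightarrow> (real \<Rightarrow> complex) set \<Rightarrow> bool" where
  "positively_oriented_boundary S \<Gamma> \<longleftrightarrow>
     finite \<Gamma> \<and>
     (\<forall>\<gamma>\<in>\<Gamma>. valid_path \<gamma> \<and> simple_path \<gamma> \<and> pathfinish \<gamma> = pathstart \<gamma>) \<and>
     pairwise (\<lambda>\<gamma> \<delta>. disjnt (path_image \<gamma>) (path_image \<delta>)) \<Gamma> \<and>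
     frontier S = (\<Union>\<gamma>\<in>\<Gamma>. path_image \<gamma>) \<and>
     (\<forall>z\<in>S. (\<Sum>\<gamma>\<in>\<Gamma>. winding_number \<gamma> z) = 1) \<and>
     (\<forall>z. z \<notin> closure S \<longrightarrow> (\<Sum>\<gamma>\<in>\<Gamma>. winding_number \<gamma> z) = 0)"

definition bounded_slice_cauchy_domain :: "'n::finite point set \<Rightarrow> bool" where
  "bounded_slice_cauchy_domain U \<longleftrightarrow>
     bounded U \<and> open U \<and> axially_symmetric U \<and>
     (\<forall>I\<in>imag_units. \<exists>\<Gamma>. positively_oriented_boundary (slice I U) \<Gamma>)"


section \<open>Differential operators\<close>

text \<open>The partial derivative of \<open>f\<close> in the direction of the coordinate vector \<open>b\<close>.\<close>

definition partial ::
    "'a::real_vector \<Rightarrow> ('a \<Rightarrow> 'b::real_normed_vector) \<Rightarrow> 'a \<Rightarrow> 'b" where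
  "partial b f x = vector_derivative (\<lambda>t. f (x + t *\<^sub>R b)) (at 0)"

definition laplacian :: "('a::euclidean_space \<Rightarrow> 'b::real_normed_vector) \<Rightarrow> 'a \<Rightarrow> 'b" where
  "laplacian f x = (\<Sum>b\<in>Basis. partial b (partial b f) x)"

definition dirac_left ::
    "('n point \<Rightarrow> 'n clifford) \<Rightarrow> 'n::{finite,linorder} point \<Rightarrow> 'n clifford" where
  "dirac_left f x = partial (1, 0) f x + (\<Sum>i\<in>UNIV. gen i * partial (0, axis i 1) f x)"

definition dirac_right ::
    "('n point \<Rightarrow> 'n clifford) \<Rightarrow> 'n::{finite,linorder} point \<Rightarrow> 'n clifford" where
  "dirac_right f x = partial (1, 0) f x + (\<Sum>i\<in>UNIV. partial (0, axis i 1) f x * gen i)"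

text \<open>Functions of class \<open>C\<^sup>k\<close> on an open set.\<close>

fun C_k_on ::
    "nat \<Rightarrow> ('a::euclidean_space \<Rightarrow> 'b::real_normed_vector) \<Rightarrow> 'a set \<Rightarrow> bool" where
  "C_k_on 0 f S \<longleftrightarrow> continuous_on S f"
| "C_k_on (Suc k) f S \<longleftrightarrow>
     (\<forall>x\<in>S. f differentiable (at x)) \<and> (\<forall>b\<in>Basis. C_k_on k (partial b f) S)"


section \<open>Slice hyperholomorphic and axially polyharmonic functions\<close>

text \<open>The set \<open>{(u, v). u + \<S> v \<subseteq> U}\<close>.\<close>

definition axial_domain :: "'n::finite point set \<Rightarrow> (real \<times> real) set" where
  "axial_domain U = {(u, v). \<forall>I\<in>imag_units. (u, v *\<^sub>R I) \<in> U}"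

definition even_odd_pair ::
    "(real \<times> real) set \<Rightarrow> (real \<times> real \<Rightarrow> 'b::real_vector) \<Rightarrow> (real \<times> real \<Rightarrow> 'b) \<Rightarrow> bool" where
  "even_odd_pair P \<alpha> \<beta> \<longleftrightarrow>
     (\<forall>(u, v)\<in>P. \<alpha> (u, - v) = \<alpha> (u, v) \<and> \<beta> (u, - v) = - \<beta> (u, v))"

definition cauchy_riemann_pair ::
    "(real \<times> real) set \<Rightarrow> (real \<times> real \<Rightarrow> 'b::real_normed_vector) \<Rightarrow> (real \<times> real \<Rightarrow> 'b) \<Rightarrow> bool"
where
  "cauchy_riemann_pair P \<alpha> \<beta> \<longleftrightarrow>
     (\<forall>p\<in>P. \<alpha> differentiable (at p) \<and> \<beta> differentiable (at p) \<and>
        partial (1, 0) \<alpha> p = partial (0, 1) \<beta> p \<and>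
        partial (0, 1) \<alpha> p = - partial (1, 0) \<beta> p)"

definition left_slice_hyperholomorphic ::
    "('n point \<Rightarrow> 'n clifford) \<Rightarrow> 'n::{finite,linorder} point set \<Rightarrow> bool" where
  "left_slice_hyperholomorphic f U \<longleftrightarrow>
     open U \<and> axially_symmetric U \<and>
     (\<exists>\<alpha> \<beta>. even_odd_pair (axial_domain U) \<alpha> \<beta> \<and> cauchy_riemann_pair (axial_domain U) \<alpha> \<beta> \<and>
        (\<forall>(u, v)\<in>axial_domain U. \<forall>I\<in>imag_units.
           f (u, v *\<^sub>R I) = \<alpha> (u, v) + clifford_vector I * \<beta> (u, v)))"

definition right_slice_hyperholomorphic ::
    "('n point \<Rightarrow> 'n clifford) \<Rightarrow> 'n::{finite,linorder} point set \<Rightarrow> bool" where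
  "right_slice_hyperholomorphic f U \<longleftrightarrow>
     open U \<and> axially_symmetric U \<and>
     (\<exists>\<alpha> \<beta>. even_odd_pair (axial_domain U) \<alpha> \<beta> \<and> cauchy_riemann_pair (axial_domain U) \<alpha> \<beta> \<and>
        (\<forall>(u, v)\<in>axial_domain U. \<forall>I\<in>imag_units.
           f (u, v *\<^sub>R I) = \<alpha> (u, v) + \<beta> (u, v) * clifford_vector I))"

text \<open>
  On the real axis \<open>sgn (snd x) = 0\<close>, which is harmless: oddness forces \<open>B (u, 0) = 0\<close>.
\<close>

definition left_axially_polyharmonic ::
    "nat \<Rightarrow> ('n point \<Rightarrow> 'n clifford) \<Rightarrow> 'n::{finite,linorder} point set \<Rightarrow> bool" where
  "left_axially_polyharmonic k g U \<longleftrightarrow>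
     1 \<le> k \<and> open U \<and> axially_symmetric U \<and>
     C_k_on (2 * k) g U \<and> (\<forall>x\<in>U. (laplacian ^^ k) g x = 0) \<and>
     (\<exists>A B. even_odd_pair (axial_domain U) A B \<and>
        (\<forall>x\<in>U. g x = A (fst x, norm (snd x)) + clifford_vector (sgn (snd x)) * B (fst x, norm (snd x))))"

definition right_axially_polyharmonic ::
    "nat \<Rightarrow> ('n point \<Rightarrow> 'n clifford) \<Rightarrow> 'n::{finite,linorder} point set \<Rightarrow> bool" where
  "right_axially_polyharmonic k g U \<longleftrightarrow>
     1 \<le> k \<and> open U \<and> axially_symmetric U \<and>
     C_k_on (2 * k) g U \<and> (\<forall>x\<in>U. (laplacian ^^ k) g x = 0) \<and>
     (\<exists>A B. even_odd_pair (axial_domain U) A B \<and>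
        (\<forall>x\<in>U. g x = A (fst x, norm (snd x)) + B (fst x, norm (snd x)) * clifford_vector (sgn (snd x))))"


section \<open>The kernels and the boundary integrals\<close>

definition Q_c :: "'n point \<Rightarrow> 'n point \<Rightarrow> 'n::{finite,linorder} clifford" where
  "Q_c s x = (paravector s)^2 - (2 * fst x) *\<^sub>R paravector s + of_real ((norm x)^2)"

text \<open>
  \<open>\<sigma>\<^bsub>n,\<ell>\<^esub>\<close> with \<open>h\<^sub>n = h\<close>. The factor \<open>(-1)^l h! / (h - l)!\<close> is the Pochhammer symbol \<open>(-h)\<^sub>l\<close>.
\<close>

definition sigma :: "nat \<Rightarrow> nat \<Rightarrow> real" where
  "sigma h l = 2 ^ (2 * l - 1) * fact (l - 1) * ((- 1) ^ l * fact h / fact (h - l))"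

definition kernel_H :: "nat \<Rightarrow> 'n point \<Rightarrow> 'n point \<Rightarrow> 'n::{finite,linorder} clifford" where
  "kernel_H l s x = sigma ((CARD('n) - 1) div 2) l *\<^sub>R clifford_inverse (Q_c s x) ^ l"

text \<open>The density of \<open>ds\<^sub>I = ds (-I)\<close> along a parametrised curve in \<open>\<complex>\<^sub>I\<close>.\<close>

definition ds ::
    "real ^ 'n::{finite,linorder} \<Rightarrow> (real \<Rightarrow> complex) \<Rightarrow> real \<Rightarrow> 'n clifford" where
  "ds I \<gamma> t =
     paravector (slice_point I (vector_derivative \<gamma> (at t within {0..1}))) * (- clifford_vector I)"

definition left_integrand ::
    "nat \<Rightarrow> real ^ 'n::{finite,linorder} \<Rightarrow> ('n point \<Rightarrow> 'n clifford) \<Rightarrow> 'n point \<Rightarrow> (real \<Rightarrow> complex) \<Rightarrow> real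
      \<Rightarrow> 'n clifford" where
  "left_integrand l I f x \<gamma> t =
     kernel_H l (slice_point I (\<gamma> t)) x * ds I \<gamma> t * f (slice_point I (\<gamma> t))"

definition right_integrand ::
    "nat \<Rightarrow> real ^ 'n::{finite,linorder} \<Rightarrow> ('n point \<Rightarrow> 'n clifford) \<Rightarrow> 'n point \<Rightarrow> (real \<Rightarrow> complex) \<Rightarrow> real
      \<Rightarrow> 'n clifford" where
  "right_integrand l I f x \<gamma> t =
     f (slice_point I (\<gamma> t)) * ds I \<gamma> t * kernel_H l (slice_point I (\<gamma> t)) x"

definition left_integral ::
    "nat \<Rightarrow> real ^ 'n::{finite,linorder} \<Rightarrow> (real \<Rightarrow> complex) set \<Rightarrow> ('n point \<Rightarrow> 'n clifford)
      \<Rightarrow> 'n point \<Rightarrow> 'n clifford" where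
  "left_integral l I \<Gamma> f x = (\<Sum>\<gamma>\<in>\<Gamma>. integral {0..1} (left_integrand l I f x \<gamma>))"

definition right_integral ::
    "nat \<Rightarrow> real ^ 'n::{finite,linorder} \<Rightarrow> (real \<Rightarrow> complex) set \<Rightarrow> ('n point \<Rightarrow> 'n clifford)
      \<Rightarrow> 'n point \<Rightarrow> 'n clifford" where
  "right_integral l I \<Gamma> f x = (\<Sum>\<gamma>\<in>\<Gamma>. integral {0..1} (right_integrand l I f x \<gamma>))"

end

theory Submission
  imports Defs
begin

text \<open>
  With respect to the blades a slice hyperholomorphic function has stem functions \<open>\<phi> = \<alpha> + \<i> \<beta>\<close> that are
  holomorphic and commute with complex conjugation. Write \<open>Q = s\<^sup>2 - 2 x\<^sub>0 s + \<bar>x\<bar>\<^sup>2\<close> and let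
  \<open>R\<^sub>m \<phi>\<close> be the sum of the residues of \<open>\<phi> / Q^m\<close> at the two roots of \<open>Q\<close>. Differentiating under
  the integral sign gives \<open>\<Delta> R\<^sub>m = 4 m (m - h) R\<^sub>m\<^sub>+\<^sub>1\<close>. For
  \<open>F\<^sub>m = (R\<^sub>m(s \<phi>) - x\<^sub>0 R\<^sub>m \<phi>) + x' R\<^sub>m \<phi>\<close>, where \<open>x'\<close> is the vector part of \<open>x\<close>, one finds
  \<open>\<Delta> F\<^sub>m = 4 m (m - h - 1) F\<^sub>m\<^sub>+\<^sub>1\<close> and \<open>D F\<^sub>m = 2 (m - h - 1) R\<^sub>m\<close>. Since \<open>f\<close> is a sum of
  functions \<open>F\<^sub>1\<close>, the image \<open>D \<Delta>^(l-1) f\<close> is \<open>\<sigma>\<close> times a sum of functions \<open>R\<^sub>l\<close>. It has no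
  \<open>x'\<close>-part and is annihilated by \<open>\<Delta>^(h-l+1)\<close>, and the residue theorem for the boundary cycle of
  \<open>U \<inter> \<complex>\<^sub>I\<close> turns \<open>R\<^sub>l\<close> into the integral against \<open>Q^(-l)\<close>.
\<close>

section \<open>Cauchy's theorem for cycles\<close>

text \<open>The set \<open>U \<inter> \<complex>\<^sub>I\<close> need not be connected: a component
  that misses the real axis has a separate conjugate component, and one component may be bounded by
  several curves. No single loop carries the boundary integral, so Cauchy's theorem and the residue
  theorem are proved for finite families of loops in an arbitrary open set. The other obstacle is
  the real axis, where the roots x0 +- i |x'| of Q merge and |x'| is not differentiable. Residue
  sums avoid formulas in the roots: near a given x they are integrals over fixed circles, and Q
  itself is polynomial in x. Noncommutativity stays in the outermost layer: blade by blade only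
  complex contour integrals occur, and the slice enters through a final embedding. The sums R_l are
  real because the stem functions commute with conjugation. A real number looks the same in every
  slice, which is why neither the imaginary unit nor the curves matter. The dimension n+1 = 2h+2
  produces the factor 4m(m-h), which for m \<ge> 1 vanishes exactly at m = h. The chain R_l, ...,
  R_h, 0 thus ends after h-l+1 Laplacians, the asserted degree.\<close>

lemma winding_sum_continuous:
  assumes "finite A" "\<And>i. i \<in> A \<Longrightarrow> path (g i) \<and> path_image (g i) \<subseteq> S \<and> pathfinish (g i) = pathstart (g i)"
  shows "continuous_on (- S) (\<lambda>w. \<Sum>i\<in>A. winding_number (g i) w)"
proof (intro continuous_on_sum)
  fix i assume "i \<in> A"
  then show "continuous_on (- S) (winding_number (g i))"
    using assms(2)[of i] by (intro continuous_on_subset[OF continuous_on_winding_number]) auto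
qed

lemma winding_sum_zero_at_infinity:
  assumes "finite A" "\<And>i. i \<in> A \<Longrightarrow> path (g i) \<and> pathfinish (g i) = pathstart (g i)"
  shows "\<forall>\<^sub>F w in at_infinity. (\<Sum>i\<in>A. winding_number (g i) w) = 0"
proof -
  have "\<forall>\<^sub>F w in at_infinity. \<forall>i\<in>A. winding_number (g i) w = 0"
    using winding_number_zero_at_infinity assms
    by (intro eventually_ball_finite) (auto simp: eventually_at_infinity)
  then show ?thesis by eventually_elim simp
qed

text \<open>On \<open>-C\<close> and \<open>-D\<close> the two partial sums paste to a continuous integer-valued function on the
  whole plane, which vanishes near infinity.\<close>

lemma winding_sum_split:
  fixes g h :: "_ \<Rightarrow> real \<Rightarrow> complex"
  assumes CD: "open C" "open D" "C \<inter> D = {}" and fin: "finite A" "finite B"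
    and A: "\<And>i. i \<in> A \<Longrightarrow> path (g i) \<and> path_image (g i) \<subseteq> C \<and> pathfinish (g i) = pathstart (g i)"
    and B: "\<And>i. i \<in> B \<Longrightarrow> path (h i) \<and> path_image (h i) \<subseteq> D \<and> pathfinish (h i) = pathstart (h i)"
    and zero: "\<And>w. w \<notin> C \<union> D \<Longrightarrow>
      (\<Sum>i\<in>A. winding_number (g i) w) + (\<Sum>i\<in>B. winding_number (h i) w) = 0"
    and w: "w \<notin> C"
  shows "(\<Sum>i\<in>A. winding_number (g i) w) = 0"
proof -
  \<comment> \<open>Since \<open>C\<close> and \<open>D\<close> are disjoint, their complements
    cover the plane. On the overlap, the complement of \<open>C \<union> D\<close>, the hypothesis
    \<open>zero\<close> makes both formulas agree; this forces the minus sign.\<close>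
  let ?M = "\<lambda>w. if w \<notin> C then \<Sum>i\<in>A. winding_number (g i) w else - (\<Sum>i\<in>B. winding_number (h i) w)"
  have "continuous_on (- C \<union> - D) ?M"
  proof (rule continuous_on_cases)
    show "continuous_on (- C) (\<lambda>w. \<Sum>i\<in>A. winding_number (g i) w)"
      using fin A by (intro winding_sum_continuous) auto
    show "continuous_on (- D) (\<lambda>w. - (\<Sum>i\<in>B. winding_number (h i) w))"
      using fin B by (intro continuous_intros winding_sum_continuous) auto
    show "\<forall>x. x \<in> - C \<and> \<not> x \<notin> C \<or> x \<in> - D \<and> x \<notin> C \<longrightarrow>
        (\<Sum>i\<in>A. winding_number (g i) x) = - (\<Sum>i\<in>B. winding_number (h i) x)"
      using zero by (auto simp: eq_neg_iff_add_eq_0)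
  qed (use CD in auto)
  moreover have "- C \<union> - D = UNIV" using CD by auto
  ultimately have cont: "continuous_on UNIV ?M" by simp
  have int: "?M u \<in> \<int>" for u
  proof (cases "u \<in> C")
    case True
    then have "u \<notin> path_image (h i)" if "i \<in> B" for i using B[OF that] CD by blast
    with True B show ?thesis by (auto intro!: Ints_sum Ints_minus integer_winding_number)
  qed (use A in \<open>auto intro!: Ints_sum integer_winding_number\<close>)
  have "?M constant_on UNIV"
  proof (rule continuous_discrete_range_constant[OF _ cont])
    fix u
    have "1 \<le> norm (?M y - ?M u)" if "?M y \<noteq> ?M u" for y
    proof -
      have "?M y - ?M u \<in> \<int>" by (intro Ints_diff int)
      then obtain k where k: "?M y - ?M u = of_int k" by (elim Ints_cases)
      with that have "k \<noteq> 0" by auto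
      then show ?thesis unfolding k by simp
    qed
    then show "\<exists>e>0. \<forall>y. y \<in> UNIV \<and> ?M y \<noteq> ?M u \<longrightarrow> e \<le> norm (?M y - ?M u)"
      by (intro exI[of _ 1]) auto
  qed auto
  then obtain c where c: "?M u = c" for u by (auto simp: constant_on_def)
  have "\<forall>\<^sub>F w in at_infinity. ?M w = 0"
    using winding_sum_zero_at_infinity[of A g] winding_sum_zero_at_infinity[of B h] fin A B
    by (auto elim: eventually_elim2)
  then have "\<exists>u. ?M u = 0"
    by (intro eventually_happens'[of at_infinity]) (auto simp: trivial_limit_at_infinity)
  then have "c = 0" using c by metis
  with c[of w] w show ?thesis by simp
qed

text \<open>Each loop is attached to the base point by a path in \<open>V\<close> that is run
  through forwards and then backwards, so that the connecting pieces cancel in every integral. The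
  outcome is one loop, to which Cauchy's theorem for a single closed path applies.\<close>

lemma connected_loops_combine:
  assumes V: "open V" "connected V" "p \<in> V" and "finite A"
    and "\<And>i. i \<in> A \<Longrightarrow> valid_path (g i) \<and> path_image (g i) \<subseteq> V \<and> pathfinish (g i) = pathstart (g i)"
  shows "\<exists>h. valid_path h \<and> path_image h \<subseteq> V \<and> pathstart h = p \<and> pathfinish h = p \<and>
    (\<forall>f. f holomorphic_on V \<longrightarrow> contour_integral h f = (\<Sum>i\<in>A. contour_integral (g i) f))"
  using assms(4,5)
proof (induction A)
  case empty
  show ?case
  proof (intro exI[of _ "linepath p p"] conjI allI impI)
    show "path_image (linepath p p) \<subseteq> V" unfolding path_image_linepath using V by simp
  qed (simp_all only: valid_path_linepath pathstart_linepath pathfinish_linepath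
      contour_integral_trivial sum.empty)
next
  case (insert a A)
  then obtain h where h: "valid_path h" "path_image h \<subseteq> V" "pathstart h = p" "pathfinish h = p"
    and hint: "\<And>f. f holomorphic_on V \<Longrightarrow> contour_integral h f = (\<Sum>i\<in>A. contour_integral (g i) f)"
    by auto
  have ga: "valid_path (g a)" "path_image (g a) \<subseteq> V" "pathfinish (g a) = pathstart (g a)"
    using insert.prems by auto
  then have "pathstart (g a) \<in> V" by auto
  then obtain r where r: "valid_path r" "path_image r \<subseteq> V" "pathstart r = p" "pathfinish r = pathstart (g a)"
    using connected_open_polynomial_connected[OF V] valid_path_polynomial_function by metis
  let ?k = "h +++ (r +++ (g a +++ reversepath r))"
  have "contour_integral ?k f = (\<Sum>i\<in>insert a A. contour_integral (g i) f)" if f: "f holomorphic_on V" for f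
  proof -
    have ci: "f contour_integrable_on q" if "valid_path q" "path_image q \<subseteq> V" for q
      using contour_integrable_holomorphic_simple[OF f V(1)] that by blast
    have "contour_integral ?k f = contour_integral h f + (contour_integral r f +
        (contour_integral (g a) f - contour_integral r f))"
      using ci h r ga by (simp add: contour_integral_reversepath contour_integrable_reversepath)
    then show ?thesis using insert.hyps hint[OF f] by simp
  qed
  moreover have "path_image ?k \<subseteq> V"
    using h r ga by (intro subset_path_image_join) auto
  ultimately show ?case using h r ga by (intro exI[of _ ?k]) auto
qed

text \<open>Induction on the family of loops. Each loop stays in one component of \<open>V\<close>.
  Those in the component \<open>C\<close> of a chosen loop are merged into a single loop; the others
  lie in the union \<open>D\<close> of the remaining components and form a proper subfamily. The
  vanishing of the total winding number is passed on to \<open>C\<close> and to \<open>D\<close>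
  separately by \<open>winding_sum_split\<close>, which is where the global hypothesis
  enters.\<close>

theorem Cauchy_theorem_cycle:
  assumes "finite A" "open V" "f holomorphic_on V"
    and "\<And>i. i \<in> A \<Longrightarrow> valid_path (g i) \<and> path_image (g i) \<subseteq> V \<and> pathfinish (g i) = pathstart (g i)"
    and "\<And>w. w \<notin> V \<Longrightarrow> (\<Sum>i\<in>A. winding_number (g i) w) = 0"
  shows "(\<Sum>i\<in>A. contour_integral (g i) f) = 0"
  using assms
proof (induction A arbitrary: V rule: finite_psubset_induct)
  case (psubset A)
  note g = psubset.prems(3) and zero = psubset.prems(4)
  show ?case
  proof (cases "A = {}")
    case False
    then obtain a where a: "a \<in> A" by blast
    define p where "p = pathstart (g a)"
    have pV: "p \<in> V" using g[OF a] by (auto simp: p_def)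
    define C where "C = connected_component_set V p"
    define D where "D = \<Union> (components V - {C})"
    have C: "C \<in> components V" using pV by (auto simp: C_def components_def)
    have opC: "open C" "open D"
      using open_components[OF psubset.prems(1)] C by (auto simp: D_def)
    have V: "V = C \<union> D" unfolding D_def using C by (subst Union_components[symmetric]) blast
    have CD: "C \<inter> D = {}"
      using C components_nonoverlap[of C V] by (auto simp: D_def)
    have conn: "connected C" by (simp add: C_def)
    have pC: "p \<in> C" using pV by (simp add: C_def)
    let ?AC = "{i\<in>A. pathstart (g i) \<in> C}" and ?AD = "{i\<in>A. pathstart (g i) \<notin> C}"
    have dich: "path_image (g i) \<subseteq> C \<or> path_image (g i) \<subseteq> D" if "i \<in> A" for i
    proof -
      have "connected (path_image (g i))" "path_image (g i) \<subseteq> V"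
        using g[OF that] by (auto intro: connected_path_image valid_path_imp_path)
      then show ?thesis using opC CD unfolding V connected_def by blast
    qed
    have inC: "path_image (g i) \<subseteq> C" if "i \<in> ?AC" for i
      using dich[of i] that CD pathstart_in_path_image[of "g i"] by blast
    have inD: "path_image (g i) \<subseteq> D" if "i \<in> ?AD" for i
      using dich[of i] that CD pathstart_in_path_image[of "g i"] by blast
    have split: "(\<Sum>i\<in>A. F i) = (\<Sum>i\<in>?AC. F i) + (\<Sum>i\<in>?AD. F i)" for F :: "_ \<Rightarrow> complex"
      using psubset.hyps(1)
      by (subst sum.union_disjoint[symmetric]) (auto intro!: sum.cong)
    have zC: "(\<Sum>i\<in>?AC. winding_number (g i) w) = 0" if "w \<notin> C" for w
      by (rule winding_sum_split[OF opC(1,2) CD, of ?AC ?AD g g])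
        (use psubset.hyps(1) g inC inD zero that V split in \<open>auto simp: valid_path_imp_path\<close>)
    have zD: "(\<Sum>i\<in>?AD. winding_number (g i) w) = 0" if "w \<notin> D" for w
      by (rule winding_sum_split[OF opC(2,1), of ?AD ?AC g g])
        (use psubset.hyps(1) g inC inD zero that V CD split in \<open>auto simp: valid_path_imp_path add.commute\<close>)
    have holC: "f holomorphic_on C" and holD: "f holomorphic_on D"
      using psubset.prems(2) V by (auto intro: holomorphic_on_subset)
    \<comment> \<open>The chosen loop \<open>g a\<close> starts at \<open>p\<close> in
      \<open>C\<close>, so \<open>a\<close> is missing from \<open>?AD\<close> and the subfamily is
      proper.\<close>
    have "(\<Sum>i\<in>?AD. contour_integral (g i) f) = 0"
      by (rule psubset.IH[OF _ opC(2) holD]) (use a pC p_def g inD zD in auto)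
    moreover have "(\<Sum>i\<in>?AC. contour_integral (g i) f) = 0"
    proof -
      obtain h where h: "valid_path h" "path_image h \<subseteq> C" "pathstart h = p" "pathfinish h = p"
        and hint: "\<And>f. f holomorphic_on C \<Longrightarrow> contour_integral h f = (\<Sum>i\<in>?AC. contour_integral (g i) f)"
        using connected_loops_combine[OF opC(1) conn pC, of ?AC g] psubset.hyps(1) g inC by auto
      \<comment> \<open>The winding number is itself the contour integral of 1/(z - w), which is
        holomorphic on \<open>C\<close> for w outside \<open>C\<close>. The property of
        \<open>h\<close> for holomorphic integrands therefore carries winding numbers over as
        well.\<close>
      have "winding_number h w = 0" if "w \<notin> C" for w
      proof -
        have *: "contour_integral q (\<lambda>z. 1 / (z - w)) = 2 * of_real pi * \<i> * winding_number q w"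
          if "valid_path q" "path_image q \<subseteq> C" for q
          using has_contour_integral_winding_number[of q w] that \<open>w \<notin> C\<close>
          by (auto intro: contour_integral_unique)
        have "2 * of_real pi * \<i> * winding_number h w = (\<Sum>i\<in>?AC. contour_integral (g i) (\<lambda>z. 1 / (z - w)))"
          using that *[OF h(1,2)] by (subst hint[symmetric]) (auto intro!: holomorphic_intros)
        also have "\<dots> = 2 * of_real pi * \<i> * (\<Sum>i\<in>?AC. winding_number (g i) w)"
          unfolding sum_distrib_left using g inC by (intro sum.cong refl *) auto
        finally show ?thesis using zC[OF that] by simp
      qed
      then have "(f has_contour_integral 0) h"
        using Cauchy_theorem_global[OF opC(1) holC h(1) _ h(2)] h by simp
      then show ?thesis using hint[OF holC] contour_integral_unique by metis
    qed
    ultimately show ?thesis using split[of "\<lambda>i. contour_integral (g i) f"] by simp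
  qed simp
qed

text \<open>The residue at each pole is split off by a small circle, traversed backwards.\<close>

theorem Residue_theorem_cycle:
  assumes A: "finite A" and V: "open V" and P: "finite P" "P \<subseteq> V" and f: "f holomorphic_on V - P"
    and g: "\<And>i. i \<in> A \<Longrightarrow> valid_path (g i) \<and> path_image (g i) \<subseteq> V - P \<and> pathfinish (g i) = pathstart (g i)"
    and out: "\<And>w. w \<notin> V \<Longrightarrow> (\<Sum>i\<in>A. winding_number (g i) w) = 0"
    and one: "\<And>p. p \<in> P \<Longrightarrow> (\<Sum>i\<in>A. winding_number (g i) p) = 1"
  shows "(\<Sum>i\<in>A. contour_integral (g i) f) = 2 * pi * \<i> * (\<Sum>p\<in>P. residue f p)"
proof -
  have "\<exists>e>0. cball p e \<subseteq> V - (P - {p})" if "p \<in> P" for p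
  proof -
    have "open (V - (P - {p}))" using V P by (intro open_Diff finite_imp_closed) auto
    then show ?thesis using that P open_contains_cball by blast
  qed
  \<comment> \<open>The discs avoid the other poles but may overlap one another. This is harmless:
    only winding numbers about points of \<open>P\<close> and about points outside \<open>V\<close>
    enter the argument.\<close>
  then obtain e where e: "\<And>p. p \<in> P \<Longrightarrow> e p > 0 \<and> cball p (e p) \<subseteq> V - (P - {p})" by metis
  have ci: "contour_integral (circlepath p (e p)) f = 2 * pi * \<i> * residue f p" if "p \<in> P" for p
  proof (rule contour_integral_unique)
    show "(f has_contour_integral 2 * pi * \<i> * residue f p) (circlepath p (e p))"
    proof (rule base_residue[of "V - (P - {p})"])
      show "f holomorphic_on V - (P - {p}) - {p}" using f by (rule holomorphic_on_subset) auto
      show "open (V - (P - {p}))" using V P by (intro open_Diff finite_imp_closed) auto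
    qed (use that P e in auto)
  qed
  let ?g = "case_sum g (\<lambda>p. reversepath (circlepath p (e p)))"
  have img: "path_image (circlepath p (e p)) = sphere p (e p)" if "p \<in> P" for p
    using e[OF that] by simp
  have wn: "winding_number (reversepath (circlepath p (e p))) w =
      (if w = p then -1 else 0)" if "p \<in> P" "w \<notin> V \<or> w \<in> P" for p w
  proof -
    have "w \<notin> sphere p (e p)" using that e[OF that(1)] by (cases "w = p") (auto simp: subset_iff)
    then have "winding_number (reversepath (circlepath p (e p))) w = - winding_number (circlepath p (e p)) w"
      using e[OF that(1)] by (intro winding_number_reversepath) (auto simp: valid_path_imp_path)
    moreover have "winding_number (circlepath p (e p)) w = (if w = p then 1 else 0)"
    proof (cases "w = p")
      case False
      then have "w \<notin> cball p (e p)" using that e[OF that(1)] by (auto simp: subset_iff)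
      then have "winding_number (circlepath p (e p)) w = 0"
        using e[OF that(1)]
        by (intro winding_number_zero_outside[of _ "cball p (e p)"]) (auto simp: valid_path_imp_path)
      with False show ?thesis by simp
    qed (use e[OF that(1)] winding_number_circlepath_centre in auto)
    ultimately show ?thesis by simp
  qed
  \<comment> \<open>At a pole only its own reversed circle contributes, with -1, and cancels the
    winding number 1 of the given cycle; outside \<open>V\<close> all circles contribute 0.\<close>
  have wsum: "(\<Sum>p\<in>P. winding_number (reversepath (circlepath p (e p))) w) = (if w \<in> P then -1 else 0)"
    if "w \<notin> V \<or> w \<in> P" for w
  proof -
    have "(\<Sum>p\<in>P. winding_number (reversepath (circlepath p (e p))) w) = (\<Sum>p\<in>P. if w = p then -1 else 0)"
      using that by (intro sum.cong refl wn)
    then show ?thesis using P by simp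
  qed
  have "(\<Sum>i\<in>A <+> P. contour_integral (?g i) f) = 0"
  proof (rule Cauchy_theorem_cycle[where V = "V - P"])
    show "open (V - P)" using V P by (intro open_Diff finite_imp_closed) auto
    show "valid_path (?g i) \<and> path_image (?g i) \<subseteq> V - P \<and> pathfinish (?g i) = pathstart (?g i)"
      if i: "i \<in> A <+> P" for i
    proof (cases i)
      case (Inl a)
      then show ?thesis using g i by auto
    next
      case (Inr p)
      then have p: "p \<in> P" using i by auto
      have "sphere p (e p) \<subseteq> V - P" using e[OF p] by (force simp: subset_iff)
      then show ?thesis using Inr img[OF p] by simp
    qed
    show "(\<Sum>i\<in>A <+> P. winding_number (?g i) w) = 0" if "w \<notin> V - P" for w
      using that A P wsum[of w] out[of w] one[of w] by (auto simp: sum.Plus)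
  qed (use A P f in auto)
  moreover have "(\<Sum>p\<in>P. contour_integral (reversepath (circlepath p (e p))) f) =
      - (2 * pi * \<i> * (\<Sum>p\<in>P. residue f p))"
    unfolding sum_distrib_left sum_negf[symmetric]
    by (intro sum.cong refl) (simp add: contour_integral_reversepath ci)
  ultimately show ?thesis using A P by (simp add: sum.Plus)
qed

section \<open>Partial derivatives and functions of class \<open>C\<^sup>k\<close>\<close>

lemma partial_eq:
  assumes "(f has_derivative D) (at x)"
  shows "partial b f x = D b"
proof -
  have "((\<lambda>t. f (x + t *\<^sub>R b)) has_derivative (\<lambda>t. D (t *\<^sub>R b))) (at (0::real))"
    by (rule has_derivative_compose[where g = f, of "\<lambda>t. x + t *\<^sub>R b" "\<lambda>t. t *\<^sub>R b" 0 UNIV D])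
      (use assms in \<open>auto intro!: derivative_eq_intros\<close>)
  moreover have "D (t *\<^sub>R b) = t *\<^sub>R D b" for t
    using assms by (simp add: has_derivative_bounded_linear linear_simps)
  ultimately show ?thesis
    by (auto simp: partial_def has_vector_derivative_def intro!: vector_derivative_at)
qed

lemma has_derivative_partial:
  assumes "f differentiable (at x)"
  shows "(f has_derivative (\<lambda>h. partial h f x)) (at x)"
proof -
  obtain D where D: "(f has_derivative D) (at x)" using assms by (auto simp: differentiable_def)
  moreover have "(\<lambda>h. partial h f x) = D" by (rule ext) (rule partial_eq[OF D])
  ultimately show ?thesis by simp
qed

lemma partial_cong:
  fixes x :: "'a::real_normed_vector"
  assumes "open S" "x \<in> S" "\<And>y. y \<in> S \<Longrightarrow> f y = g y"
  shows "partial b f x = partial b g x"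
  unfolding partial_def
proof (rule vector_derivative_cong_eq)
  have "isCont (\<lambda>t::real. x + t *\<^sub>R b) 0" by (intro continuous_intros)
  then have "((\<lambda>t::real. x + t *\<^sub>R b) \<longlongrightarrow> x) (nhds 0)"
    using tendsto_at_iff_tendsto_nhds[of "\<lambda>t::real. x + t *\<^sub>R b" 0] by (simp add: isCont_def)
  then have "\<forall>\<^sub>F t in nhds (0::real). x + t *\<^sub>R b \<in> S"
    using assms(1,2) by (rule topological_tendstoD)
  then show "\<forall>\<^sub>F t in nhds (0::real). t \<in> UNIV \<longrightarrow> f (x + t *\<^sub>R b) = g (x + t *\<^sub>R b)"
    by eventually_elim (use assms(3) in auto)
qed auto

lemma laplacian_cong:
  assumes "open S" "x \<in> S" "\<And>y. y \<in> S \<Longrightarrow> f y = g y"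
  shows "laplacian f x = laplacian g x"
  unfolding laplacian_def using assms by (intro sum.cong refl partial_cong[of S]) auto

lemma laplacian_funpow_cong:
  assumes "open S" "x \<in> S" "\<And>y. y \<in> S \<Longrightarrow> f y = g y"
  shows "(laplacian ^^ k) f x = (laplacian ^^ k) g x"
  using assms(2)
proof (induction k arbitrary: x)
  case (Suc k)
  then show ?case using assms(1) by (auto intro: laplacian_cong[of S])
qed (use assms in simp)

text \<open>Partial derivatives of \<open>f\<close> and \<open>g\<close> agree on \<open>S\<close>
  because \<open>S\<close> is open. All closure properties below go through this transfer, since
  their derivative formulas are available only at points of \<open>S\<close>.\<close>

lemma C_k_on_cong:
  assumes "open S" "\<And>x. x \<in> S \<Longrightarrow> f x = g x" "C_k_on k f S"
  shows "C_k_on k g S"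
  using assms(2,3)
proof (induction k arbitrary: f g)
  case 0
  then show ?case by (auto intro: continuous_on_eq)
next
  case (Suc k)
  have diff: "g differentiable (at x)" if "x \<in> S" for x
  proof -
    have "f differentiable (at x)" using Suc.prems that by simp
    then have "(g has_derivative (\<lambda>h. partial h f x)) (at x)"
      using assms(1) that Suc.prems(1)
      by (rule has_derivative_transform_within_open[OF has_derivative_partial])
    then show ?thesis unfolding differentiable_def by (intro exI)
  qed
  have partials: "C_k_on k (partial b g) S" if "b \<in> Basis" for b
    by (rule Suc.IH[of "partial b f"]) (use Suc.prems that in \<open>auto intro: partial_cong[OF assms(1)]\<close>)
  show ?case unfolding C_k_on.simps by (intro conjI ballI partials diff)
qed

lemma C_k_on_SucD: "C_k_on (Suc k) f S \<Longrightarrow> C_k_on k f S"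
proof (induction k arbitrary: f)
  case 0
  then show ?case
    by (auto intro!: continuous_at_imp_continuous_on differentiable_imp_continuous_within)
next
  case (Suc k)
  have "C_k_on k (partial b f) S" if "b \<in> Basis" for b
    by (rule Suc.IH) (use Suc.prems that C_k_on.simps(2)[of "Suc k"] in blast)
  moreover have "\<forall>x\<in>S. f differentiable (at x)"
    using Suc.prems C_k_on.simps(2)[of "Suc k"] by blast
  ultimately show ?case unfolding C_k_on.simps(2)[of k] by blast
qed

lemma C_k_on_bounded_linear:
  assumes "open S" "bounded_linear L" "C_k_on k f S"
  shows "C_k_on k (\<lambda>x. L (f x)) S"
  using assms(3)
proof (induction k arbitrary: f)
  case 0
  then show ?case using assms(2) by (auto intro: bounded_linear.continuous_on)
next
  case (Suc k)
  have D: "((\<lambda>x. L (f x)) has_derivative (\<lambda>h. L (partial h f x))) (at x)" if "x \<in> S" for x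
    using Suc.prems that by (intro bounded_linear.has_derivative[OF assms(2)] has_derivative_partial) simp
  have partials: "C_k_on k (partial b (\<lambda>x. L (f x))) S" if "b \<in> Basis" for b
  proof (rule C_k_on_cong[OF assms(1)])
    show "C_k_on k (\<lambda>x. L (partial b f x)) S" using Suc.prems that by (intro Suc.IH) simp
    show "L (partial b f x) = partial b (\<lambda>x. L (f x)) x" if "x \<in> S" for x
      by (rule partial_eq[OF D[OF that], symmetric])
  qed
  have diff: "(\<lambda>x. L (f x)) differentiable (at x)" if "x \<in> S" for x
    unfolding differentiable_def by (intro exI) (rule D[OF that])
  show ?case unfolding C_k_on.simps by (intro conjI ballI partials diff)
qed

lemma C_k_on_add:
  assumes "open S" "C_k_on k f S" "C_k_on k g S"
  shows "C_k_on k (\<lambda>x. f x + g x) S"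
  using assms(2,3)
proof (induction k arbitrary: f g)
  case 0
  then show ?case by (auto intro: continuous_intros)
next
  case (Suc k)
  have D: "((\<lambda>x. f x + g x) has_derivative
      (\<lambda>h. partial h f x + partial h g x)) (at x)" if "x \<in> S" for x
    using Suc.prems that by (intro has_derivative_add has_derivative_partial) simp_all
  have partials: "C_k_on k (partial b (\<lambda>x. f x + g x)) S" if "b \<in> Basis" for b
  proof (rule C_k_on_cong[OF assms(1)])
    show "C_k_on k (\<lambda>x. partial b f x + partial b g x) S"
      using Suc.prems that by (intro Suc.IH) simp_all
    show "partial b f x + partial b g x = partial b (\<lambda>x. f x + g x) x" if "x \<in> S" for x
      by (rule partial_eq[OF D[OF that], symmetric])
  qed
  have diff: "(\<lambda>x. f x + g x) differentiable (at x)" if "x \<in> S" for x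
    unfolding differentiable_def by (intro exI) (rule D[OF that])
  show ?case unfolding C_k_on.simps by (intro conjI ballI partials diff)
qed

text \<open>The product rule expresses a partial derivative by two products of the same kind, each
  with one factor that is kept only as a function of class one lower; hence the appeal to
  \<open>C_k_on_SucD\<close>.\<close>

lemma C_k_on_bilinear:
  assumes "open S" "bounded_bilinear pr" "C_k_on k f S" "C_k_on k g S"
  shows "C_k_on k (\<lambda>x. pr (f x) (g x)) S"
  using assms(3,4)
proof (induction k arbitrary: f g)
  case 0
  then show ?case using assms(2) by (auto intro: bounded_bilinear.continuous_on)
next
  case (Suc k)
  have D: "((\<lambda>x. pr (f x) (g x)) has_derivative (\<lambda>h. pr (f x) (partial h g x) +
      pr (partial h f x) (g x))) (at x)" if "x \<in> S" for x
    using Suc.prems that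
    by (intro bounded_bilinear.FDERIV[OF assms(2)] has_derivative_partial) simp_all
  have partials: "C_k_on k (partial b (\<lambda>x. pr (f x) (g x))) S" if "b \<in> Basis" for b
  proof (rule C_k_on_cong[OF assms(1)])
    show "C_k_on k (\<lambda>x. pr (f x) (partial b g x) + pr (partial b f x) (g x)) S"
      using Suc.prems that
      by (intro C_k_on_add[OF assms(1)] Suc.IH C_k_on_SucD[OF Suc.prems(1)] C_k_on_SucD[OF Suc.prems(2)])
        simp_all
    show "pr (f x) (partial b g x) + pr (partial b f x) (g x) = partial b (\<lambda>x. pr (f x) (g x)) x"
      if "x \<in> S" for x
      by (rule partial_eq[OF D[OF that], symmetric])
  qed
  have diff: "(\<lambda>x. pr (f x) (g x)) differentiable (at x)" if "x \<in> S" for x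
    unfolding differentiable_def by (intro exI) (rule D[OF that])
  show ?case unfolding C_k_on.simps by (intro conjI ballI partials diff)
qed

lemma C_k_on_const: "C_k_on k (\<lambda>x. c) S"
proof (induction k arbitrary: c)
  case (Suc k)
  have eq: "partial b (\<lambda>x. c) = (\<lambda>x. 0)" for b :: 'a
    by (rule ext) (rule partial_eq[OF has_derivative_const])
  show ?case
    unfolding C_k_on.simps eq by (intro conjI ballI differentiable_const Suc.IH)
qed simp

lemma C_k_on_linear:
  assumes "bounded_linear L"
  shows "C_k_on k L S"
proof (cases k)
  case 0
  then show ?thesis using assms by (simp add: linear_continuous_on)
next
  case (Suc j)
  have D: "(L has_derivative L) (at x)" for x by (rule bounded_linear_imp_has_derivative[OF assms])
  have eq: "partial b L = (\<lambda>x. L b)" for b by (rule ext) (rule partial_eq[OF D])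
  have "L differentiable (at x)" for x
    unfolding differentiable_def by (intro exI) (rule D)
  then show ?thesis
    unfolding Suc C_k_on.simps eq by (intro conjI ballI C_k_on_const)
qed

lemma C_k_on_sum:
  assumes "open S" "finite A" "\<And>i. i \<in> A \<Longrightarrow> C_k_on k (f i) S"
  shows "C_k_on k (\<lambda>x. \<Sum>i\<in>A. f i x) S"
  using assms(2,3)
proof (induction A)
  case empty
  show ?case unfolding sum.empty by (rule C_k_on_const)
next
  case (insert i A)
  show ?case
    unfolding sum.insert[OF insert.hyps(1,2)]
    by (rule C_k_on_add[OF assms(1) insert.prems insert.IH[OF insert.prems]]) simp_all
qed

section \<open>Residue sums\<close>

text \<open>
  \<open>axis_root x\<close> is the point of the upper half plane that represents the sphere \<open>[x]\<close>, and \<open>quad x s\<close>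
  is \<open>Q\<^bsub>c,s\<^esub>(x)\<close> with \<open>s\<close> read as a complex number. Its expanded form \<open>quad_eq\<close> is smooth in \<open>x\<close> also
  across the real axis, unlike \<open>axis_root\<close>.
\<close>

definition axis_root :: "real \<times> 'b::real_normed_vector \<Rightarrow> complex" where
  "axis_root x = Complex (fst x) (norm (snd x))"

definition quad_roots :: "real \<times> 'b::real_normed_vector \<Rightarrow> complex set" where
  "quad_roots x = {axis_root x, cnj (axis_root x)}"

definition quad :: "real \<times> 'b::real_normed_vector \<Rightarrow> complex \<Rightarrow> complex" where
  "quad x s = (s - axis_root x) * (s - cnj (axis_root x))"

text \<open>
  By the residue theorem this is \<open>1 / (2 \<pi> \<i>)\<close> times the integral of \<open>\<phi> / Q^m\<close> over any cycle that
  winds once around both roots.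
\<close>

definition qres :: "nat \<Rightarrow> (complex \<Rightarrow> complex) \<Rightarrow> real \<times> 'b::real_normed_vector \<Rightarrow> complex" where
  "qres m \<phi> x = (\<Sum>p\<in>quad_roots x. residue (\<lambda>s. \<phi> s / quad x s ^ m) p)"

lemma quad_eq:
  fixes x :: "real \<times> 'b::real_inner"
  shows "quad x s = s\<^sup>2 - of_real (2 * fst x) * s + of_real (x \<bullet> x)"
proof -
  have "quad x s = s\<^sup>2 - (axis_root x + cnj (axis_root x)) * s + axis_root x * cnj (axis_root x)"
    by (simp add: quad_def power2_eq_square algebra_simps)
  also have "axis_root x + cnj (axis_root x) = of_real (2 * fst x)"
    by (simp add: axis_root_def complex_add_cnj)
  also have "axis_root x * cnj (axis_root x) = of_real (x \<bullet> x)"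
    by (simp add: axis_root_def complex_mult_cnj inner_prod_def power2_eq_square dot_square_norm)
  finally show ?thesis .
qed

lemma quad_eq_0_iff: "quad x s = 0 \<longleftrightarrow> s \<in> quad_roots x"
  by (auto simp: quad_def quad_roots_def)

lemma quad_holomorphic [holomorphic_intros]: "quad x holomorphic_on A"
  unfolding quad_def[abs_def] by (intro holomorphic_intros)

lemma finite_quad_roots [simp]: "finite (quad_roots x)"
  by (simp add: quad_roots_def)

lemma over_quad_holomorphic:
  assumes "\<phi> holomorphic_on V"
  shows "(\<lambda>s. \<phi> s / quad x s ^ m) holomorphic_on V - quad_roots x"
  using assms by (auto intro!: holomorphic_intros simp: quad_eq_0_iff intro: holomorphic_on_subset)

lemma over_quad_holomorphic_at:
  assumes "\<phi> holomorphic_on V"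
  shows "(\<lambda>s. \<phi> s / quad x s ^ m) holomorphic_on V - (quad_roots x - {p}) - {p}"
  by (rule holomorphic_on_subset[OF over_quad_holomorphic[OF assms]]) auto

lemma open_minus_quad_roots: "open V \<Longrightarrow> open (V - (quad_roots x - {p}))"
  by (intro open_Diff finite_imp_closed) auto

lemma eventually_not_quad_root: "\<forall>\<^sub>F s in at p. s \<notin> quad_roots x"
proof -
  have "\<forall>\<^sub>F s in at p. s \<notin> quad_roots x - {p}"
    using open_minus_quad_roots[of UNIV x p]
    by (intro eventually_at_in_open'[THEN eventually_mono]) auto
  moreover have "\<forall>\<^sub>F s in at p. s \<noteq> p" by (simp add: eventually_at_filter)
  ultimately show ?thesis by eventually_elim auto
qed

lemma qres_add:
  assumes "open V" "quad_roots x \<subseteq> V" "\<phi> holomorphic_on V" "\<psi> holomorphic_on V"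
  shows "qres m (\<lambda>s. \<phi> s + \<psi> s) x = qres m \<phi> x + qres m \<psi> x"
  unfolding qres_def sum.distrib[symmetric] add_divide_distrib using assms
  by (intro sum.cong refl residue_add[OF open_minus_quad_roots[of V x]]) (auto intro: over_quad_holomorphic_at)

lemma qres_cmult:
  assumes "open V" "quad_roots x \<subseteq> V" "\<phi> holomorphic_on V"
  shows "qres m (\<lambda>s. c * \<phi> s) x = c * qres m \<phi> x"
  unfolding qres_def sum_distrib_left times_divide_eq_right[symmetric] using assms
  by (intro sum.cong refl residue_lmul[OF open_minus_quad_roots[of V x]]) (auto intro: over_quad_holomorphic_at)

text \<open>A residue sees only a punctured neighbourhood of its point, and there Q has no zeros and
  can be cancelled.\<close>

lemma qres_Suc_quad: "qres (Suc m) (\<lambda>s. quad x s * \<phi> s) x = qres m \<phi> x"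
  unfolding qres_def
proof (intro sum.cong refl residue_cong)
  fix p assume "p \<in> quad_roots x"
  show "\<forall>\<^sub>F s in at p. quad x s * \<phi> s / quad x s ^ Suc m = \<phi> s / quad x s ^ m"
    using eventually_not_quad_root[of x p] by eventually_elim (simp add: quad_eq_0_iff)
qed

text \<open>Q = s^2 - 2 x0 s + |x|^2, inserted into a numerator, relates three consecutive moments
  of order m+1 to one residue sum of order m. This relation makes the expressions from the Laplace
  and Dirac operators collapse to a single term.\<close>

lemma qres_quad_expand:
  fixes x :: "real \<times> 'b::real_inner"
  assumes V: "open V" "quad_roots x \<subseteq> V" "\<phi> holomorphic_on V"
  shows "qres (Suc m) (\<lambda>s. s * (s * \<phi> s)) x - of_real (2 * fst x) * qres (Suc m) (\<lambda>s. s * \<phi> s) x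
    + of_real (x \<bullet> x) * qres (Suc m) \<phi> x = qres m \<phi> x"
proof -
  have hol: "(\<lambda>s. s * \<phi> s) holomorphic_on V" "(\<lambda>s. s * (s * \<phi> s)) holomorphic_on V"
    "(\<lambda>s. c * (s * \<phi> s)) holomorphic_on V" "(\<lambda>s. c * \<phi> s) holomorphic_on V" for c
    using V(3) by (auto intro!: holomorphic_intros)
  have "(\<lambda>s. quad x s * \<phi> s) =
      (\<lambda>s. (s * (s * \<phi> s) + (- of_real (2 * fst x)) * (s * \<phi> s)) + of_real (x \<bullet> x) * \<phi> s)"
    by (rule ext) (simp add: quad_eq algebra_simps power2_eq_square)
  then have "qres (Suc m) (\<lambda>s. quad x s * \<phi> s) x =
      qres (Suc m) (\<lambda>s. s * (s * \<phi> s)) x + (- of_real (2 * fst x)) * qres (Suc m) (\<lambda>s. s * \<phi> s) x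
      + of_real (x \<bullet> x) * qres (Suc m) \<phi> x"
    using V hol by (simp only: qres_add[OF V(1,2)] qres_cmult[OF V(1,2)] holomorphic_on_add)
  then show ?thesis by (simp only: qres_Suc_quad) simp
qed

lemma qres_axis_cong: "axis_root x = axis_root y \<Longrightarrow> qres m \<phi> x = qres m \<phi> y"
  by (simp add: qres_def quad_roots_def quad_def)

lemma continuous_axis_root: "continuous_on A axis_root"
  unfolding axis_root_def[abs_def] by (intro continuous_intros)

text \<open>
  The cycle of small circles around the roots at \<open>x0\<close> (a single circle on the real axis) does not depend
  on \<open>x\<close>, which makes differentiation under the integral sign possible.
\<close>

lemma qres_circles:
  fixes x0 :: "real \<times> 'b::real_normed_vector"
  assumes V: "open V" "quad_roots x0 \<subseteq> V"
  obtains \<rho> where "0 < \<rho>" "\<And>c. c \<in> quad_roots x0 \<Longrightarrow> cball c \<rho> \<subseteq> V"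
    "\<And>(x :: real \<times> 'b) c s. dist (axis_root x) (axis_root x0) < \<rho> \<Longrightarrow> c \<in> quad_roots x0 \<Longrightarrow>
       s \<in> sphere c \<rho> \<Longrightarrow> quad x s \<noteq> 0"
    "\<And>(x :: real \<times> 'b) m \<phi>. dist (axis_root x) (axis_root x0) < \<rho> \<Longrightarrow> \<phi> holomorphic_on V \<Longrightarrow>
       (\<Sum>c\<in>quad_roots x0. contour_integral (circlepath c \<rho>) (\<lambda>s. \<phi> s / quad x s ^ m))
         = 2 * pi * \<i> * qres m \<phi> x"
proof -
  let ?z = "axis_root x0"
  have "\<exists>e>0. cball c e \<subseteq> V" if "c \<in> quad_roots x0" for c
    using V that open_contains_cball by blast
  then obtain e1 e2 where e: "e1 > 0" "e2 > 0" "cball ?z e1 \<subseteq> V" "cball (cnj ?z) e2 \<subseteq> V"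
    unfolding quad_roots_def by (metis insertI1 insertI2)
  \<comment> \<open>A third of the distance keeps the closed discs about two distinct roots apart.
    When the roots coincide on the real axis there is only one disc and no such restriction.\<close>
  define \<rho> where "\<rho> = (if ?z = cnj ?z then min e1 e2 else min (min e1 e2) (dist ?z (cnj ?z) / 3))"
  have \<rho>: "0 < \<rho>" using e by (auto simp: \<rho>_def)
  have "\<rho> \<le> e1" "\<rho> \<le> e2" by (auto simp: \<rho>_def)
  then have cb: "cball c \<rho> \<subseteq> V" if "c \<in> quad_roots x0" for c
    using that e by (fastforce simp: quad_roots_def)
  have far: "2 * \<rho> < dist c d" if "c \<in> quad_roots x0" "d \<in> quad_roots x0" "c \<noteq> d" for c d
  proof -
    have "?z \<noteq> cnj ?z" "dist c d = dist ?z (cnj ?z)"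
      using that by (auto simp: quad_roots_def dist_commute)
    moreover from this have "\<rho> \<le> dist ?z (cnj ?z) / 3" "0 < dist ?z (cnj ?z)"
      by (auto simp: \<rho>_def)
    ultimately show ?thesis by linarith
  qed
  have disj: "c = d" if "c \<in> quad_roots x0" "d \<in> quad_roots x0" "w \<in> cball c \<rho>" "w \<in> cball d \<rho>" for c d w
    using far[of c d] that dist_triangle2[of c d w] by (auto simp: dist_commute)
  \<comment> \<open>Conjugation is an isometry, so closeness of the upper root gives closeness of
    both. The roots for a nearby \<open>x\<close> thus stay strictly inside the fixed discs.\<close>
  have near: "\<exists>c\<in>quad_roots x0. dist c p < \<rho>"
    if "dist (axis_root x) ?z < \<rho>" "p \<in> quad_roots x" for p and x :: "real \<times> 'b"
  proof -
    have "dist (cnj (axis_root x)) (cnj ?z) = dist (axis_root x) ?z"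
      by (simp add: dist_norm flip: complex_cnj_diff)
    then show ?thesis using that by (auto simp: quad_roots_def dist_commute)
  qed
  have nz: "quad x s \<noteq> 0"
    if x: "dist (axis_root x) ?z < \<rho>" and c: "c \<in> quad_roots x0" and s: "s \<in> sphere c \<rho>"
    for c s and x :: "real \<times> 'b"
  proof
    assume "quad x s = 0"
    then obtain d where "d \<in> quad_roots x0" "dist d s < \<rho>" using near[OF x] by (auto simp: quad_eq_0_iff)
    then show False using disj[of c d s] c s by auto
  qed
  have int: "(\<Sum>c\<in>quad_roots x0. contour_integral (circlepath c \<rho>) (\<lambda>s. \<phi> s / quad x s ^ m))
      = 2 * pi * \<i> * qres m \<phi> x"
    if x: "dist (axis_root x) ?z < \<rho>" and hol: "\<phi> holomorphic_on V" for m \<phi> and x :: "real \<times> 'b"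
    unfolding qres_def
  proof (rule Residue_theorem_cycle[OF _ V(1) _ _ over_quad_holomorphic[OF hol]])
    have wn: "winding_number (circlepath c \<rho>) w = (if w \<in> cball c \<rho> then 1 else 0)"
      if "w \<notin> sphere c \<rho>" for c w
    proof (cases "w \<in> cball c \<rho>")
      case True
      then show ?thesis using that by (auto simp: dist_norm norm_minus_commute intro!: winding_number_circlepath)
    next
      case False
      then show ?thesis
        using \<rho> by (auto intro!: winding_number_zero_outside[of _ "cball c \<rho>"] simp: valid_path_imp_path)
    qed
    show "quad_roots x \<subseteq> V" using near[OF x] cb by (fastforce simp: subset_iff)
    show "valid_path (circlepath c \<rho>) \<and> path_image (circlepath c \<rho>) \<subseteq> V - quad_roots x \<and>
        pathfinish (circlepath c \<rho>) = pathstart (circlepath c \<rho>)" if "c \<in> quad_roots x0" for c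
      using \<rho> cb[OF that] nz[OF x that] by (auto simp: quad_eq_0_iff subset_iff)
    show "(\<Sum>c\<in>quad_roots x0. winding_number (circlepath c \<rho>) w) = 0" if "w \<notin> V" for w
    proof (intro sum.neutral ballI)
      fix c assume "c \<in> quad_roots x0"
      then have "w \<notin> cball c \<rho>" using cb that by blast
      then show "winding_number (circlepath c \<rho>) w = 0" by (subst wn) auto
    qed
    \<comment> \<open>Every root of Q at \<open>x\<close> lies in exactly one of the disjoint discs.
      If the discs have merged into one, it contains both roots and still winds once about
      each.\<close>
    show "(\<Sum>c\<in>quad_roots x0. winding_number (circlepath c \<rho>) p) = 1" if p: "p \<in> quad_roots x" for p
    proof -
      obtain d where d: "d \<in> quad_roots x0" "dist d p < \<rho>" using near[OF x p] by auto
      have "(\<Sum>c\<in>quad_roots x0. winding_number (circlepath c \<rho>) p) =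
          (\<Sum>c\<in>quad_roots x0. if c = d then 1 else 0)"
      proof (intro sum.cong refl)
        fix c assume c: "c \<in> quad_roots x0"
        have "p \<notin> sphere c \<rho>" using nz[OF x c, of p] p by (auto simp: quad_eq_0_iff)
        moreover have "p \<in> cball c \<rho> \<longleftrightarrow> c = d" using disj[OF c d(1)] d(2) by auto
        ultimately show "winding_number (circlepath c \<rho>) p = (if c = d then 1 else 0)" by (simp add: wn)
      qed
      also have "\<dots> = 1" using d by simp
      finally show ?thesis .
    qed
  qed simp_all
  show thesis by (rule that[OF \<rho> cb nz int])
qed

section \<open>Differentiating residue sums in x\<close>

lemma DERIV_const_over_power:
  assumes "q \<noteq> (0::complex)"
  shows "((\<lambda>q. K / q ^ m) has_field_derivative (- of_nat m * K / q ^ Suc m)) (at q)"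
proof (induction m)
  case (Suc m)
  have "((\<lambda>q. K / q ^ m / q) has_field_derivative
      ((- of_nat m * K / q ^ Suc m) * q - K / q ^ m * 1) / (q * q)) (at q)"
    by (rule DERIV_divide[OF Suc.IH DERIV_ident assms])
  moreover have "((- of_nat m * K / q ^ Suc m) * q - K / q ^ m * 1) / (q * q) =
      - of_nat (Suc m) * K / q ^ Suc (Suc m)"
    using assms by (simp add: field_simps)
  moreover have "(\<lambda>q. K / q ^ m / q) = (\<lambda>q. K / q ^ Suc m)"
    by (simp add: mult.commute)
  ultimately show ?case by metis
qed simp

text \<open>Leibniz rule for a fixed circle: the derivative of Q^(-m) in direction h is -m Q^(-m-1)
  (-2 h0 s + 2 x.h). The factor s is absorbed into the numerator, which gives the term with
  \<open>s * \<phi> s\<close>.\<close>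

lemma contour_over_quad_has_derivative:
  fixes x :: "real \<times> 'b::euclidean_space" and c :: complex and \<rho> :: real
  defines "I \<equiv> \<lambda>m \<phi> y. contour_integral (circlepath c \<rho>) (\<lambda>s. \<phi> s / quad y s ^ m)"
  assumes \<phi>: "continuous_on (sphere c \<rho>) \<phi>" "0 < \<rho>" and N: "open N" "x \<in> N"
    and nz: "\<And>y s. y \<in> N \<Longrightarrow> s \<in> sphere c \<rho> \<Longrightarrow> quad y s \<noteq> 0"
  shows "((\<lambda>y. I m \<phi> y) has_derivative
    (\<lambda>h. of_real (2 * real m * fst h) * I (Suc m) (\<lambda>s. s * \<phi> s) x - of_real (2 * real m * (x \<bullet> h)) * I (Suc m) \<phi> x))
    (at x)"
proof -
  let ?\<gamma> = "circlepath c \<rho>"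
  let ?\<gamma>' = "\<lambda>t. vector_derivative ?\<gamma> (at t)"
  obtain r where r: "0 < r" "ball x r \<subseteq> N" using N open_contains_ball by blast
  define K where "K t = \<phi> (?\<gamma> t) * ?\<gamma>' t" for t
  \<comment> \<open>\<open>A\<close> and \<open>B\<close> are the coefficients of h0 and of the
    inner product with \<open>y\<close> in the derivative of the integrand. \<open>F\<close> packs
    them into a bounded linear operator, because the Leibniz rule asks for joint continuity of the
    derivative in the operator norm.\<close>
  define A where "A y t = of_nat (2 * m) * (?\<gamma> t * K t / quad y (?\<gamma> t) ^ Suc m)" for y :: "real \<times> 'b" and t
  define B where "B y t = of_nat (2 * m) * (K t / quad y (?\<gamma> t) ^ Suc m)" for y :: "real \<times> 'b" and t
  define F where "F y t = (blinfun_scaleR_left (A y t) o\<^sub>L blinfun_inner_right (1, 0))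
    - (blinfun_scaleR_left (B y t) o\<^sub>L blinfun_inner_right y)" for y :: "real \<times> 'b" and t
  have sph: "?\<gamma> t \<in> sphere c \<rho>" if "t \<in> {0..1}" for t
    using that path_image_circlepath[of c \<rho>] \<phi>(2) by (auto simp: path_image_def)
  have contg: "continuous_on {0..1} ?\<gamma>" using valid_path_imp_path[OF valid_path_circlepath] by (simp add: path_def)
  have contg': "continuous_on {0..1} ?\<gamma>'"
    unfolding vector_derivative_circlepath by (intro continuous_intros)
  have contK: "continuous_on {0..1} K"
    unfolding K_def using sph
    by (intro continuous_intros contg' continuous_on_compose2[OF \<phi>(1) contg]) auto
  have contq: "continuous_on (ball x r \<times> {0..1}) (\<lambda>(y, t). quad y (?\<gamma> t))"
    unfolding quad_eq case_prod_unfold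
    by (intro continuous_intros continuous_on_compose2[OF contg]) auto
  have contKK: "continuous_on (ball x r \<times> {0..1}) (\<lambda>p. K (snd p))"
    "continuous_on (ball x r \<times> {0..1}) (\<lambda>p. ?\<gamma> (snd p))"
    by (intro continuous_intros continuous_on_compose2[OF contK] continuous_on_compose2[OF contg]; auto)+
  have nz': "quad y (?\<gamma> t) \<noteq> 0" if "y \<in> ball x r" "t \<in> {0..1}" for y t
    using nz r that sph by blast
  have contA: "continuous_on (ball x r \<times> {0..1}) (\<lambda>p. A (fst p) (snd p))"
    and contB: "continuous_on (ball x r \<times> {0..1}) (\<lambda>p. B (fst p) (snd p))"
    unfolding A_def B_def using contq nz'
    by (auto intro!: continuous_intros contKK simp: case_prod_unfold)
  have contF: "continuous_on (ball x r \<times> cbox 0 1) (\<lambda>(y, t). F y t)"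
    unfolding F_def case_prod_unfold cbox_interval by (intro continuous_intros contA contB)
  have pair: "continuous_on {0..1::real} (\<lambda>t. (x, t))" "(\<lambda>t. (x, t)) ` {0..1} \<subseteq> ball x r \<times> {0..1}"
    using continuous_on_Pair[OF continuous_on_const continuous_on_id, of "{0..1::real}" x] r by auto
  have contAx: "continuous_on {0..1} (A x)" and contBx: "continuous_on {0..1} (B x)"
    using continuous_on_compose2[OF contA pair] continuous_on_compose2[OF contB pair] by simp_all
  have contFx: "continuous_on {0..1} (F x)"
    unfolding F_def by (intro continuous_intros contAx contBx)
  have deriv: "((\<lambda>y. K t / quad y (?\<gamma> t) ^ m) has_derivative blinfun_apply (F y t)) (at y within ball x r)"
    if y: "y \<in> ball x r" and t: "t \<in> cbox 0 1" for y t
  proof -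
    let ?s = "?\<gamma> t"
    have q: "((\<lambda>y. quad y ?s) has_derivative (\<lambda>h. - of_real (2 * fst h) * ?s + of_real (2 * (y \<bullet> h))))
        (at y within ball x r)"
      unfolding quad_eq by (auto intro!: derivative_eq_intros simp: inner_commute)
    have q0: "quad y ?s \<noteq> 0" using nz' y t by simp
    have "((\<lambda>q. K t / q ^ m) has_field_derivative (- of_nat m * K t / quad y ?s ^ Suc m)) (at (quad y ?s))"
      by (rule DERIV_const_over_power[OF q0])
    then have "((\<lambda>y. K t / quad y ?s ^ m) has_derivative
        (\<lambda>h. (- of_nat m * K t / quad y ?s ^ Suc m) * (- of_real (2 * fst h) * ?s + of_real (2 * (y \<bullet> h)))))
        (at y within ball x r)"
      unfolding has_field_derivative_def by (rule has_derivative_compose[OF q])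
    moreover have "(\<lambda>h. (- of_nat m * K t / quad y ?s ^ Suc m) * (- of_real (2 * fst h) * ?s + of_real (2 * (y \<bullet> h))))
        = blinfun_apply (F y t)"
      by (rule ext) (simp add: F_def A_def B_def blinfun.diff_left scaleR_conv_of_real inner_prod_def
          diff_divide_distrib add_divide_distrib algebra_simps)
    ultimately show ?thesis by simp
  qed
  have "((\<lambda>y. integral (cbox 0 1) (\<lambda>t. K t / quad y (?\<gamma> t) ^ m)) has_derivative
      blinfun_apply (integral (cbox 0 1) (F x))) (at x within ball x r)"
  proof (rule leibniz_rule[OF deriv _ contF])
    show "(\<lambda>t. K t / quad y (?\<gamma> t) ^ m) integrable_on cbox 0 1" if "y \<in> ball x r" for y
    proof -
      have "continuous_on {0..1} (\<lambda>t. quad y (?\<gamma> t))"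
        using continuous_on_compose2[OF contq continuous_on_Pair[OF continuous_on_const continuous_on_id]]
        that by (auto simp: image_subset_iff)
      then have "continuous_on {0..1} (\<lambda>t. K t / quad y (?\<gamma> t) ^ m)"
        using nz' that by (intro continuous_intros contK) auto
      then show ?thesis by (simp add: integrable_continuous_real)
    qed
  qed (use r in auto)
  moreover have "I m \<phi> = (\<lambda>y. integral (cbox 0 1) (\<lambda>t. K t / quad y (?\<gamma> t) ^ m))"
    by (simp add: I_def contour_integral_integral K_def)
  moreover have "blinfun_apply (integral (cbox 0 1) (F x)) =
      (\<lambda>h. of_real (2 * real m * fst h) * I (Suc m) (\<lambda>s. s * \<phi> s) x - of_real (2 * real m * (x \<bullet> h)) * I (Suc m) \<phi> x)"
  proof
    fix h :: "real \<times> 'b"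
    have "blinfun_apply (integral (cbox 0 1) (F x)) h = integral {0..1} (\<lambda>t. blinfun_apply (F x t) h)"
      unfolding cbox_interval by (rule blinfun_apply_integral) (rule integrable_continuous_real[OF contFx])
    also have "\<dots> = integral {0..1} (\<lambda>t. of_real (fst h) * A x t - of_real (x \<bullet> h) * B x t)"
      by (simp add: F_def blinfun.diff_left scaleR_conv_of_real inner_prod_def)
    also have "\<dots> = of_real (fst h) * integral {0..1} (A x) - of_real (x \<bullet> h) * integral {0..1} (B x)"
      by (subst integral_diff) (auto intro!: integrable_continuous_real continuous_intros contAx contBx)
    also have "integral {0..1} (A x) = of_nat (2 * m) * I (Suc m) (\<lambda>s. s * \<phi> s) x"
      unfolding A_def integral_mult_right I_def contour_integral_integral K_def by (simp add: mult.assoc)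
    also have "integral {0..1} (B x) = of_nat (2 * m) * I (Suc m) \<phi> x"
      unfolding B_def integral_mult_right I_def contour_integral_integral K_def by simp
    finally show "blinfun_apply (integral (cbox 0 1) (F x)) h =
        of_real (2 * real m * fst h) * I (Suc m) (\<lambda>s. s * \<phi> s) x - of_real (2 * real m * (x \<bullet> h)) * I (Suc m) \<phi> x"
      by simp
  qed
  ultimately have "(I m \<phi> has_derivative
      (\<lambda>h. of_real (2 * real m * fst h) * I (Suc m) (\<lambda>s. s * \<phi> s) x - of_real (2 * real m * (x \<bullet> h)) * I (Suc m) \<phi> x))
      (at x within ball x r)"
    by simp
  then show ?thesis using r by (simp add: at_within_open[of x "ball x r"])
qed

lemma qres_has_derivative:
  fixes x :: "real \<times> 'b::euclidean_space"
  assumes V: "open V" "quad_roots x \<subseteq> V" "\<phi> holomorphic_on V"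
  shows "(qres m \<phi> has_derivative
    (\<lambda>h. of_real (2 * real m * fst h) * qres (Suc m) (\<lambda>s. s * \<phi> s) x - of_real (2 * real m * (x \<bullet> h)) * qres (Suc m) \<phi> x))
    (at x)"
proof -
  obtain \<rho> where \<rho>: "0 < \<rho>" "\<And>c. c \<in> quad_roots x \<Longrightarrow> cball c \<rho> \<subseteq> V"
    and nz: "\<And>(y :: real \<times> 'b) c s. dist (axis_root y) (axis_root x) < \<rho> \<Longrightarrow> c \<in> quad_roots x \<Longrightarrow>
       s \<in> sphere c \<rho> \<Longrightarrow> quad y s \<noteq> 0"
    and int: "\<And>(y :: real \<times> 'b) m \<phi>. dist (axis_root y) (axis_root x) < \<rho> \<Longrightarrow> \<phi> holomorphic_on V \<Longrightarrow>
       (\<Sum>c\<in>quad_roots x. contour_integral (circlepath c \<rho>) (\<lambda>s. \<phi> s / quad y s ^ m))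
         = 2 * pi * \<i> * qres m \<phi> y"
    by (rule qres_circles[OF V(1,2)]) (rule that)
  define N where "N = {y :: real \<times> 'b. dist (axis_root y) (axis_root x) < \<rho>}"
  have N: "open N" "x \<in> N"
    unfolding N_def using \<rho> by (auto intro!: open_Collect_less continuous_intros continuous_axis_root)
  let ?I = "\<lambda>m \<phi> (y :: real \<times> 'b) c. contour_integral (circlepath c \<rho>) (\<lambda>s. \<phi> s / quad y s ^ m)"
  have eq: "qres m \<psi> y = 1 / (2 * pi * \<i>) * (\<Sum>c\<in>quad_roots x. ?I m \<psi> y c)"
    if "y \<in> N" "\<psi> holomorphic_on V" for y m \<psi>
    using int[of y \<psi> m] that by (simp add: N_def)
  have cont: "continuous_on (sphere c \<rho>) \<phi>" if "c \<in> quad_roots x" for c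
    by (rule continuous_on_subset[OF holomorphic_on_imp_continuous_on[OF V(3)]])
      (use \<rho>(2)[OF that] in auto)
  have D: "((\<lambda>y. ?I m \<phi> y c) has_derivative (\<lambda>h. of_real (2 * real m * fst h) * ?I (Suc m) (\<lambda>s. s * \<phi> s) x c
        - of_real (2 * real m * (x \<bullet> h)) * ?I (Suc m) \<phi> x c)) (at x)" if "c \<in> quad_roots x" for c
    by (rule contour_over_quad_has_derivative[OF cont[OF that] \<rho>(1) N]) (use nz that N_def in auto)
  have "((\<lambda>y. 1 / (2 * pi * \<i>) * (\<Sum>c\<in>quad_roots x. ?I m \<phi> y c)) has_derivative
      (\<lambda>h. 1 / (2 * pi * \<i>) * (\<Sum>c\<in>quad_roots x. of_real (2 * real m * fst h) * ?I (Suc m) (\<lambda>s. s * \<phi> s) x c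
        - of_real (2 * real m * (x \<bullet> h)) * ?I (Suc m) \<phi> x c))) (at x)"
    by (intro has_derivative_mult_right has_derivative_sum D)
  also have "(\<lambda>h. 1 / (2 * pi * \<i>) * (\<Sum>c\<in>quad_roots x. of_real (2 * real m * fst h) * ?I (Suc m) (\<lambda>s. s * \<phi> s) x c
        - of_real (2 * real m * (x \<bullet> h)) * ?I (Suc m) \<phi> x c)) =
      (\<lambda>h. of_real (2 * real m * fst h) * qres (Suc m) (\<lambda>s. s * \<phi> s) x - of_real (2 * real m * (x \<bullet> h)) * qres (Suc m) \<phi> x)"
    using V(3) by (intro ext, subst (1 2) eq[OF N(2)])
      (auto intro!: holomorphic_intros simp: sum_subtractf sum_distrib_left right_diff_distrib mult_ac)
  finally show ?thesis
    by (rule has_derivative_transform_within_open[OF _ N]) (use eq V(3) in auto)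
qed

section \<open>Laplace and Dirac operators\<close>

lemma partial_add:
  assumes "f differentiable (at x)" "g differentiable (at x)"
  shows "partial b (\<lambda>x. f x + g x) x = partial b f x + partial b g x"
  by (rule partial_eq[OF has_derivative_add[OF assms[THEN has_derivative_partial]]])

lemma partial_sum:
  assumes "\<And>i. i \<in> A \<Longrightarrow> f i differentiable (at x)"
  shows "partial b (\<lambda>x. \<Sum>i\<in>A. f i x) x = (\<Sum>i\<in>A. partial b (f i) x)"
  by (rule partial_eq[OF has_derivative_sum[OF has_derivative_partial[OF assms]]])

lemma partial_bounded_linear:
  assumes "bounded_linear L" "f differentiable (at x)"
  shows "partial b (\<lambda>x. L (f x)) x = L (partial b f x)"
  by (rule partial_eq[OF bounded_linear.has_derivative[OF assms(1) has_derivative_partial[OF assms(2)]]])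

lemma differentiable_bounded_linear:
  assumes "bounded_linear L" "f differentiable (at x)"
  shows "(\<lambda>x. L (f x)) differentiable (at x)"
  unfolding differentiable_def
  by (intro exI) (rule bounded_linear.has_derivative[OF assms(1) has_derivative_partial[OF assms(2)]])

lemma partial_coordinate_scaleR:
  fixes f :: "'a::real_inner \<Rightarrow> 'b::real_normed_vector"
  assumes "f differentiable (at x)"
  shows "partial b (\<lambda>x. (x \<bullet> c) *\<^sub>R f x) x = (b \<bullet> c) *\<^sub>R f x + (x \<bullet> c) *\<^sub>R partial b f x"
proof -
  have "((\<lambda>x. x \<bullet> c) has_derivative (\<lambda>h. h \<bullet> c)) (at x)"
    by (auto intro!: derivative_eq_intros)
  from has_derivative_scaleR[OF this has_derivative_partial[OF assms]]
  show ?thesis by (simp add: partial_eq add.commute)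
qed

lemma differentiable_coordinate_scaleR:
  fixes f :: "'a::real_inner \<Rightarrow> 'b::real_normed_vector"
  assumes "f differentiable (at x)"
  shows "(\<lambda>x. (x \<bullet> c) *\<^sub>R f x) differentiable (at x)"
proof -
  have "((\<lambda>x. x \<bullet> c) has_derivative (\<lambda>h. h \<bullet> c)) (at x)"
    by (auto intro!: derivative_eq_intros)
  from has_derivative_scaleR[OF this has_derivative_partial[OF assms]]
  show ?thesis unfolding differentiable_def by (intro exI)
qed

lemma C_k_on_differentiable: "C_k_on (Suc k) f S \<Longrightarrow> x \<in> S \<Longrightarrow> f differentiable (at x)"
  by simp

lemma differentiable_partial:
  assumes "C_k_on 2 f S" "b \<in> Basis" "x \<in> S"
  shows "f differentiable (at x)" "partial b f differentiable (at x)"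
  using assms by (auto simp: numeral_2_eq_2)

lemma laplacian_add:
  assumes "open S" "x \<in> S" "C_k_on 2 f S" "C_k_on 2 g S"
  shows "laplacian (\<lambda>x. f x + g x) x = laplacian f x + laplacian g x"
proof -
  have "partial b (partial b (\<lambda>x. f x + g x)) x = partial b (partial b f) x + partial b (partial b g) x"
    if b: "b \<in> Basis" for b
  proof -
    have "partial b (partial b (\<lambda>x. f x + g x)) x = partial b (\<lambda>x. partial b f x + partial b g x) x"
      by (rule partial_cong[OF assms(1,2)]) (intro partial_add differentiable_partial[OF _ b]; use assms in blast)
    also have "\<dots> = partial b (partial b f) x + partial b (partial b g) x"
      by (intro partial_add differentiable_partial[OF _ b]) (use assms in auto)
    finally show ?thesis .
  qed
  then show ?thesis by (simp add: laplacian_def sum.distrib)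
qed

lemma laplacian_bounded_linear:
  assumes "open S" "x \<in> S" "C_k_on 2 f S" "bounded_linear L"
  shows "laplacian (\<lambda>x. L (f x)) x = L (laplacian f x)"
proof -
  have "partial b (partial b (\<lambda>x. L (f x))) x = L (partial b (partial b f) x)"
    if b: "b \<in> Basis" for b
  proof -
    have "partial b (partial b (\<lambda>x. L (f x))) x = partial b (\<lambda>x. L (partial b f x)) x"
      by (rule partial_cong[OF assms(1,2)])
        (rule partial_bounded_linear[OF assms(4) differentiable_partial(1)[OF assms(3) b]])
    also have "\<dots> = L (partial b (partial b f) x)"
      by (rule partial_bounded_linear[OF assms(4) differentiable_partial(2)[OF assms(3) b assms(2)]])
    finally show ?thesis .
  qed
  then show ?thesis by (simp add: laplacian_def linear_sum[OF bounded_linear.linear[OF assms(4)]])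
qed

lemma laplacian_sum:
  fixes f :: "'i \<Rightarrow> 'a::euclidean_space \<Rightarrow> 'b::real_normed_vector"
  assumes "open S" "x \<in> S" "finite A" "\<And>i. i \<in> A \<Longrightarrow> C_k_on 2 (f i) S"
  shows "laplacian (\<lambda>x. \<Sum>i\<in>A. f i x) x = (\<Sum>i\<in>A. laplacian (f i) x)"
  using assms(3,4)
proof (induction A)
  case empty
  have "partial b (\<lambda>x. 0 :: 'b) = (\<lambda>x. 0)" for b :: 'a
    by (rule ext) (rule partial_eq[OF has_derivative_const])
  then show ?case by (simp add: laplacian_def)
next
  case (insert i A)
  have "laplacian (\<lambda>x. f i x + (\<Sum>i\<in>A. f i x)) x = laplacian (f i) x + laplacian (\<lambda>x. \<Sum>i\<in>A. f i x) x"
    using insert by (intro laplacian_add[OF assms(1,2)] C_k_on_sum[OF assms(1)]) auto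
  then show ?case using insert by simp
qed

text \<open>A linear factor has zero Laplacian and constant gradient c, so only the cross term
  survives; by linearity of the derivative it adds up to twice the derivative along c.\<close>

lemma laplacian_coordinate_scaleR:
  fixes f :: "'a::euclidean_space \<Rightarrow> 'b::real_normed_vector"
  assumes "open S" "x \<in> S" "C_k_on 2 f S"
  shows "laplacian (\<lambda>x. (x \<bullet> c) *\<^sub>R f x) x = (x \<bullet> c) *\<^sub>R laplacian f x + 2 *\<^sub>R partial c f x"
proof -
  have "partial b (partial b (\<lambda>x. (x \<bullet> c) *\<^sub>R f x)) x =
      (x \<bullet> c) *\<^sub>R partial b (partial b f) x + 2 *\<^sub>R (b \<bullet> c) *\<^sub>R partial b f x"
    if b: "b \<in> Basis" for b
  proof -
    note d = differentiable_partial[OF assms(3) b]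
    have "partial b (partial b (\<lambda>x. (x \<bullet> c) *\<^sub>R f x)) x =
        partial b (\<lambda>x. (b \<bullet> c) *\<^sub>R f x + (x \<bullet> c) *\<^sub>R partial b f x) x"
      by (rule partial_cong[OF assms(1,2)]) (rule partial_coordinate_scaleR[OF d(1)])
    also have "\<dots> = partial b (\<lambda>x. (b \<bullet> c) *\<^sub>R f x) x + partial b (\<lambda>x. (x \<bullet> c) *\<^sub>R partial b f x) x"
      by (rule partial_add)
        (rule differentiable_bounded_linear[OF bounded_linear_scaleR_right d(1)[OF assms(2)]]
          differentiable_coordinate_scaleR[OF d(2)[OF assms(2)]])+
    also have "partial b (\<lambda>x. (b \<bullet> c) *\<^sub>R f x) x = (b \<bullet> c) *\<^sub>R partial b f x"
      by (rule partial_bounded_linear[OF bounded_linear_scaleR_right d(1)[OF assms(2)]])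
    also have "partial b (\<lambda>x. (x \<bullet> c) *\<^sub>R partial b f x) x =
        (b \<bullet> c) *\<^sub>R partial b f x + (x \<bullet> c) *\<^sub>R partial b (partial b f) x"
      by (rule partial_coordinate_scaleR[OF d(2)[OF assms(2)]])
    finally show ?thesis by (simp only: scaleR_2 add_ac)
  qed
  then have "laplacian (\<lambda>x. (x \<bullet> c) *\<^sub>R f x) x =
      (x \<bullet> c) *\<^sub>R laplacian f x + 2 *\<^sub>R (\<Sum>b\<in>Basis. (b \<bullet> c) *\<^sub>R partial b f x)"
    unfolding laplacian_def by (simp add: sum.distrib scaleR_sum_right)
  also have "(\<Sum>b\<in>Basis. (b \<bullet> c) *\<^sub>R partial b f x) = partial c f x"
  proof -
    have "f differentiable (at x)" using assms by (simp add: numeral_2_eq_2)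
    then have lin: "linear (\<lambda>h. partial h f x)"
      using has_derivative_partial has_derivative_linear by blast
    have "(\<Sum>b\<in>Basis. (b \<bullet> c) *\<^sub>R partial b f x) = partial (\<Sum>b\<in>Basis. (b \<bullet> c) *\<^sub>R b) f x"
      by (simp add: linear_sum[OF lin] linear_scale[OF lin])
    also have "(\<Sum>b\<in>Basis. (b \<bullet> c) *\<^sub>R b) = c"
      using euclidean_representation[of c] by (simp add: inner_commute)
    finally show ?thesis .
  qed
  finally show ?thesis .
qed

section \<open>The Laplacian of residue sums\<close>

context
  fixes V :: "complex set" and W :: "(real \<times> 'b::euclidean_space) set"
  assumes V: "open V" and W: "open W" and roots: "\<And>x. x \<in> W \<Longrightarrow> quad_roots x \<subseteq> V"
begin

lemma qres_differentiable:
  assumes "\<phi> holomorphic_on V" "x \<in> W"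
  shows "qres m \<phi> differentiable (at x)"
  unfolding differentiable_def by (intro exI) (rule qres_has_derivative[OF V roots[OF assms(2)] assms(1)])

lemma partial_qres:
  assumes "\<phi> holomorphic_on V" "x \<in> W"
  shows "partial b (qres m \<phi>) x = (2 * real m * fst b) *\<^sub>R qres (Suc m) (\<lambda>s. s * \<phi> s) x
    - (2 * real m) *\<^sub>R (x \<bullet> b) *\<^sub>R qres (Suc m) \<phi> x"
  by (simp add: partial_eq[OF qres_has_derivative[OF V roots[OF assms(2)] assms(1)]] scaleR_conv_of_real)

lemma holomorphic_shift: "\<phi> holomorphic_on V \<Longrightarrow> (\<lambda>s. s * \<phi> s) holomorphic_on V"
  by (intro holomorphic_intros)

lemma C_k_on_coordinate_scaleR:
  assumes "C_k_on k f W"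
  shows "C_k_on k (\<lambda>x. (x \<bullet> c) *\<^sub>R f x) W"
  by (rule C_k_on_bilinear[OF W bounded_bilinear_scaleR C_k_on_linear[OF bounded_linear_inner_left] assms])

lemma C_k_on_scaleR:
  assumes "C_k_on k f W"
  shows "C_k_on k (\<lambda>x. a *\<^sub>R f x) W"
  by (rule C_k_on_bounded_linear[OF W bounded_linear_scaleR_right assms])

text \<open>A partial derivative of a residue sum is again a combination of residue sums, with m
  raised by one and coefficients that are constant or coordinates. The family is closed under
  differentiation, so the induction on k runs with m and \<phi> arbitrary.\<close>

lemma C_k_on_qres:
  assumes "\<phi> holomorphic_on V"
  shows "C_k_on k (qres m \<phi>) W"
  using assms
proof (induction k arbitrary: m \<phi>)
  case 0
  then show ?case
    using qres_differentiable
    by (auto intro!: continuous_at_imp_continuous_on differentiable_imp_continuous_within)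
next
  case (Suc k)
  have partials: "C_k_on k (partial b (qres m \<phi>)) W" if "b \<in> Basis" for b
  proof (rule C_k_on_cong[OF W])
    show "C_k_on k (\<lambda>x. (2 * real m * fst b) *\<^sub>R qres (Suc m) (\<lambda>s. s * \<phi> s) x
        + (- 2 * real m) *\<^sub>R (x \<bullet> b) *\<^sub>R qres (Suc m) \<phi> x) W"
      by (intro C_k_on_add[OF W] C_k_on_scaleR C_k_on_coordinate_scaleR
          Suc.IH[OF Suc.prems] Suc.IH[OF holomorphic_shift[OF Suc.prems]])
  qed (simp add: partial_qres[OF Suc.prems])
  show ?case
    unfolding C_k_on.simps by (intro conjI ballI partials qres_differentiable[OF Suc.prems])
qed

text \<open>With a = 4m(m+1), second derivatives give moments of order m+2 with weights a, and each
  basis direction contributes -2m R_(m+1). Summing over the orthonormal basis turns the latter into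
  the dimension and the former into a times the expansion of Q, that is, a R_(m+1).\<close>

lemma laplacian_qres:
  assumes \<phi>: "\<phi> holomorphic_on V" and x: "x \<in> W"
  shows "laplacian (qres m \<phi>) x = (4 * real m * (real m + 1) - 2 * real m * DIM(real \<times> 'b)) *\<^sub>R qres (Suc m) \<phi> x"
proof -
  define R2 where "R2 = qres (Suc (Suc m)) (\<lambda>s. s * (s * \<phi> s)) x"
  define R1 where "R1 = qres (Suc (Suc m)) (\<lambda>s. s * \<phi> s) x"
  define R0 where "R0 = qres (Suc (Suc m)) \<phi> x"
  define R where "R = qres (Suc m) \<phi> x"
  note \<phi>1 = holomorphic_shift[OF \<phi>]
  define a where "a = 4 * real m * (real m + 1)"
  have "partial b (partial b (qres m \<phi>)) x =
      (a * (fst b)\<^sup>2) *\<^sub>R R2 - (2 * a * (fst b * (x \<bullet> b))) *\<^sub>R R1 + (a * (x \<bullet> b)\<^sup>2) *\<^sub>R R0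
      - (2 * real m * (b \<bullet> b)) *\<^sub>R R" if b: "b \<in> Basis" for b
  proof -
    have "partial b (partial b (qres m \<phi>)) x = partial b (\<lambda>x. (2 * real m * fst b) *\<^sub>R qres (Suc m) (\<lambda>s. s * \<phi> s) x
        + (- 2 * real m) *\<^sub>R ((x \<bullet> b) *\<^sub>R qres (Suc m) \<phi> x)) x"
      by (rule partial_cong[OF W x]) (simp add: partial_qres[OF \<phi>])
    also have "\<dots> = partial b (\<lambda>x. (2 * real m * fst b) *\<^sub>R qres (Suc m) (\<lambda>s. s * \<phi> s) x) x
        + partial b (\<lambda>x. (- 2 * real m) *\<^sub>R ((x \<bullet> b) *\<^sub>R qres (Suc m) \<phi> x)) x"
      by (rule partial_add; rule differentiable_bounded_linear[OF bounded_linear_scaleR_right])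
        (rule qres_differentiable[OF \<phi>1 x] differentiable_coordinate_scaleR[OF qres_differentiable[OF \<phi> x]])+
    also have "\<dots> = (2 * real m * fst b) *\<^sub>R partial b (qres (Suc m) (\<lambda>s. s * \<phi> s)) x
        + (- 2 * real m) *\<^sub>R ((b \<bullet> b) *\<^sub>R R + (x \<bullet> b) *\<^sub>R partial b (qres (Suc m) \<phi>) x)"
      by (simp only: R_def partial_bounded_linear[OF bounded_linear_scaleR_right] qres_differentiable[OF \<phi>1 x]
          differentiable_coordinate_scaleR[OF qres_differentiable[OF \<phi> x]]
          partial_coordinate_scaleR[OF qres_differentiable[OF \<phi> x]])
    also have "\<dots> = (a * (fst b)\<^sup>2) *\<^sub>R R2 - (2 * a * (fst b * (x \<bullet> b))) *\<^sub>R R1 + (a * (x \<bullet> b)\<^sup>2) *\<^sub>R R0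
      - (2 * real m * (b \<bullet> b)) *\<^sub>R R"
      by (simp add: partial_qres[OF \<phi> x] partial_qres[OF \<phi>1 x] R2_def R1_def R0_def a_def power2_eq_square
          scaleR_conv_of_real algebra_simps)
    finally show ?thesis .
  qed
  then have "laplacian (qres m \<phi>) x = (\<Sum>b\<in>Basis. (a * (fst b)\<^sup>2) *\<^sub>R R2 - (2 * a * (fst b * (x \<bullet> b))) *\<^sub>R R1
      + (a * (x \<bullet> b)\<^sup>2) *\<^sub>R R0 - (2 * real m * (b \<bullet> b)) *\<^sub>R R)"
    unfolding laplacian_def by (intro sum.cong refl) simp
  also have "\<dots> = (a * (\<Sum>b\<in>Basis. (fst (b :: real \<times> 'b))\<^sup>2)) *\<^sub>R R2 - (2 * a * (\<Sum>b\<in>Basis. fst b * (x \<bullet> b))) *\<^sub>R R1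
      + (a * (\<Sum>b\<in>Basis. (x \<bullet> b)\<^sup>2)) *\<^sub>R R0 - (2 * real m * (\<Sum>b\<in>Basis. (b :: real \<times> 'b) \<bullet> b)) *\<^sub>R R"
    by (simp only: sum.distrib sum_subtractf sum_distrib_left scaleR_sum_left)
  also have "(\<Sum>b\<in>Basis. (fst (b :: real \<times> 'b))\<^sup>2) = 1"
    using euclidean_inner[of "(1, 0) :: real \<times> 'b" "(1, 0)"] by (simp add: inner_prod_def power2_eq_square)
  also have "(\<Sum>b\<in>Basis. fst b * (x \<bullet> b)) = fst x"
    using euclidean_inner[of "(1, 0) :: real \<times> 'b" x] by (simp add: inner_prod_def)
  also have "(\<Sum>b\<in>Basis. (x \<bullet> b)\<^sup>2) = x \<bullet> x"
    by (simp add: euclidean_inner[of x x] power2_eq_square)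
  also have "(\<Sum>b\<in>Basis. (b :: real \<times> 'b) \<bullet> b) = DIM(real \<times> 'b)"
    by (simp add: inner_same_Basis)
  \<comment> \<open>The basis sums 1, x0 and |x|^2 are, up to the factor -2 of the middle one, the
    coefficients of Q in s, so the three sums of order m+2 reduce to one of order m+1.\<close>
  also have "(a * 1) *\<^sub>R R2 - (2 * a * fst x) *\<^sub>R R1 + (a * (x \<bullet> x)) *\<^sub>R R0 = a *\<^sub>R R"
    unfolding R_def qres_quad_expand[OF V roots[OF x] \<phi>, of "Suc m", symmetric] R2_def R1_def R0_def
    by (simp add: scaleR_conv_of_real algebra_simps)
  finally show ?thesis by (simp add: a_def R_def scaleR_conv_of_real algebra_simps)
qed

end


text \<open>
  \<open>G i\<close> is left or right multiplication by \<open>gen i\<close>; both families satisfy the anticommutation relations, so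
  the left and the right case are treated together.
\<close>

definition dirac_op :: "('n::finite \<Rightarrow> 'e \<Rightarrow> 'e) \<Rightarrow> (real \<times> (real ^ 'n) \<Rightarrow> 'e::real_normed_vector) \<Rightarrow> real \<times> (real ^ 'n) \<Rightarrow> 'e"
where "dirac_op G f x = partial (1, 0) f x + (\<Sum>i\<in>UNIV. G i (partial (0, axis i 1) f x))"

text \<open>
  For \<open>m = 1\<close> this is the slice hyperholomorphic function \<open>\<alpha> + I \<beta>\<close> (or \<open>\<alpha> + \<beta> I\<close>) with \<open>\<phi> = \<alpha> + \<i> \<beta>\<close>:
  the two residue sums are \<open>\<alpha>\<close> and \<open>\<beta> / \<bar>x\<bar>\<close>, where \<open>x\<close> stands for the vector part.
\<close>

definition axial_fun :: "('n::finite \<Rightarrow> 'e \<Rightarrow> 'e) \<Rightarrow> (complex \<Rightarrow> 'e) \<Rightarrow> nat \<Rightarrow> (complex \<Rightarrow> complex) \<Rightarrow>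
    real \<times> (real ^ 'n) \<Rightarrow> 'e::real_normed_vector" where
  "axial_fun G L m \<phi> x = L (qres m (\<lambda>s. s * \<phi> s) x - fst x *\<^sub>R qres m \<phi> x)
     + (\<Sum>i\<in>UNIV. G i (L ((snd x $ i) *\<^sub>R qres m \<phi> x)))"

text \<open>Coordinates are written as inner products with fixed vectors, the form in which the
  rules for a linear factor apply.\<close>

lemma axial_fun_alt:
  "axial_fun G L m \<phi> = (\<lambda>x. L (qres m (\<lambda>s. s * \<phi> s) x + (- 1) *\<^sub>R ((x \<bullet> (1, 0)) *\<^sub>R qres m \<phi> x))
     + (\<Sum>i\<in>UNIV. G i (L ((x \<bullet> (0, axis i 1)) *\<^sub>R qres m \<phi> x))))"
  by (rule ext) (simp add: axial_fun_def inner_prod_def inner_axis)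

context
  fixes V :: "complex set" and W :: "(real \<times> (real ^ 'n::finite)) set"
    and G :: "'n \<Rightarrow> 'e \<Rightarrow> 'e::real_normed_vector" and L :: "complex \<Rightarrow> 'e"
  assumes V: "open V" and W: "open W" and roots: "\<And>x. x \<in> W \<Longrightarrow> quad_roots x \<subseteq> V"
    and G: "\<And>i. bounded_linear (G i)" and L: "bounded_linear L"
begin

lemma C_k_on_axial_fun:
  assumes "\<phi> holomorphic_on V"
  shows "C_k_on k (axial_fun G L m \<phi>) W"
  unfolding axial_fun_alt
  by (intro C_k_on_add[OF W] C_k_on_sum[OF W] C_k_on_bounded_linear[OF W G]
      C_k_on_bounded_linear[OF W L]
      C_k_on_scaleR[OF V W roots] C_k_on_coordinate_scaleR[OF V W roots] C_k_on_qres[OF V W roots]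
      holomorphic_shift[OF V W roots] assms finite)

text \<open>Both parts of the function acquire the same extra factor from the cross term with a
  coordinate: 2 \<partial>_i R_m = -4m x_i R_(m+1) for the vector part, and -2 \<partial>_0 R_m =
  -4m (R_(m+1)(s \<phi>) - x0 R_(m+1)) for the scalar part. Hence the shift by -4m against the
  constant for R_m.\<close>

lemma laplacian_axial_fun:
  assumes \<phi>: "\<phi> holomorphic_on V" and x: "x \<in> W"
  shows "laplacian (axial_fun G L m \<phi>) x =
    (4 * real m * (real m + 1) - 2 * real m * (CARD('n) + 1) - 4 * real m) *\<^sub>R axial_fun G L (Suc m) \<phi> x"
proof -
  note Ck = C_k_on_add[OF W] C_k_on_sum[OF W] C_k_on_bounded_linear[OF W G]
      C_k_on_bounded_linear[OF W L]
      C_k_on_scaleR[OF V W roots] C_k_on_coordinate_scaleR[OF V W roots] C_k_on_qres[OF V W roots]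
      holomorphic_shift[OF V W roots] \<phi> finite
  note \<phi>1 = holomorphic_shift[OF V W roots \<phi>]
  define k where "k = 4 * real m * (real m + 1) - 2 * real m * (CARD('n) + 1)"
  have lq: "laplacian (qres m \<psi>) x = k *\<^sub>R qres (Suc m) \<psi> x" if "\<psi> holomorphic_on V" for \<psi>
    using laplacian_qres[OF V W roots that x] by (simp add: k_def algebra_simps)
  have lc: "laplacian (\<lambda>x. (x \<bullet> c) *\<^sub>R qres m \<phi> x) x =
      (x \<bullet> c) *\<^sub>R (k *\<^sub>R qres (Suc m) \<phi> x) + 2 *\<^sub>R partial c (qres m \<phi>) x" for c
    by (simp only: laplacian_coordinate_scaleR[OF W x C_k_on_qres[OF V W roots \<phi>]] lq[OF \<phi>])
  have lap_coord: "laplacian (\<lambda>x. (x \<bullet> (0, axis i 1)) *\<^sub>R qres m \<phi> x) x =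
      (k - 4 * real m) *\<^sub>R ((snd x $ i) *\<^sub>R qres (Suc m) \<phi> x)" for i
    by (simp only: lc partial_qres[OF V W roots \<phi> x])
      (simp add: inner_prod_def inner_axis scaleR_conv_of_real algebra_simps)
  have "laplacian (axial_fun G L m \<phi>) x =
      L (laplacian (\<lambda>x. qres m (\<lambda>s. s * \<phi> s) x + (- 1) *\<^sub>R ((x \<bullet> (1, 0)) *\<^sub>R qres m \<phi> x)) x)
      + (\<Sum>i\<in>UNIV. G i (L (laplacian (\<lambda>x. (x \<bullet> (0, axis i 1)) *\<^sub>R qres m \<phi> x) x)))"
  proof -
    have "laplacian (axial_fun G L m \<phi>) x =
      laplacian (\<lambda>x. L (qres m (\<lambda>s. s * \<phi> s) x + (- 1) *\<^sub>R ((x \<bullet> (1, 0)) *\<^sub>R qres m \<phi> x))) x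
      + laplacian (\<lambda>x. \<Sum>i\<in>UNIV. G i (L ((x \<bullet> (0, axis i 1)) *\<^sub>R qres m \<phi> x))) x"
      unfolding axial_fun_alt by (rule laplacian_add[OF W x]; intro Ck)
    also have "laplacian (\<lambda>x. L (qres m (\<lambda>s. s * \<phi> s) x + (- 1) *\<^sub>R ((x \<bullet> (1, 0)) *\<^sub>R qres m \<phi> x))) x =
        L (laplacian (\<lambda>x. qres m (\<lambda>s. s * \<phi> s) x + (- 1) *\<^sub>R ((x \<bullet> (1, 0)) *\<^sub>R qres m \<phi> x)) x)"
      by (rule laplacian_bounded_linear[OF W x _ L]; intro Ck)
    also have "laplacian (\<lambda>x. \<Sum>i\<in>UNIV. G i (L ((x \<bullet> (0, axis i 1)) *\<^sub>R qres m \<phi> x))) x =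
        (\<Sum>i\<in>UNIV. laplacian (\<lambda>x. G i (L ((x \<bullet> (0, axis i 1)) *\<^sub>R qres m \<phi> x))) x)"
      by (rule laplacian_sum[OF W x]; intro Ck)
    also have "\<dots> = (\<Sum>i\<in>UNIV. G i (L (laplacian (\<lambda>x. (x \<bullet> (0, axis i 1)) *\<^sub>R qres m \<phi> x) x)))"
    proof (rule sum.cong[OF refl])
      fix i
      have "laplacian (\<lambda>x. G i (L ((x \<bullet> (0, axis i 1)) *\<^sub>R qres m \<phi> x))) x =
          G i (laplacian (\<lambda>x. L ((x \<bullet> (0, axis i 1)) *\<^sub>R qres m \<phi> x)) x)"
        by (rule laplacian_bounded_linear[OF W x _ G]; intro Ck)
      also have "laplacian (\<lambda>x. L ((x \<bullet> (0, axis i 1)) *\<^sub>R qres m \<phi> x)) x =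
          L (laplacian (\<lambda>x. (x \<bullet> (0, axis i 1)) *\<^sub>R qres m \<phi> x) x)"
        by (rule laplacian_bounded_linear[OF W x _ L]; intro Ck)
      finally show "laplacian (\<lambda>x. G i (L ((x \<bullet> (0, axis i 1)) *\<^sub>R qres m \<phi> x))) x =
          G i (L (laplacian (\<lambda>x. (x \<bullet> (0, axis i 1)) *\<^sub>R qres m \<phi> x) x))" .
    qed
    finally show ?thesis .
  qed
  also have "laplacian (\<lambda>x. qres m (\<lambda>s. s * \<phi> s) x + (- 1) *\<^sub>R ((x \<bullet> (1, 0)) *\<^sub>R qres m \<phi> x)) x =
      laplacian (qres m (\<lambda>s. s * \<phi> s)) x + laplacian (\<lambda>x. (- 1) *\<^sub>R ((x \<bullet> (1, 0)) *\<^sub>R qres m \<phi> x)) x"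
    by (rule laplacian_add[OF W x]; intro Ck)
  also have "laplacian (\<lambda>x. (- 1) *\<^sub>R ((x \<bullet> (1, 0)) *\<^sub>R qres m \<phi> x)) x =
      (- 1) *\<^sub>R laplacian (\<lambda>x. (x \<bullet> (1, 0)) *\<^sub>R qres m \<phi> x) x"
    by (rule laplacian_bounded_linear[OF W x _ bounded_linear_scaleR_right]; intro Ck)
  also have "laplacian (qres m (\<lambda>s. s * \<phi> s)) x + (- 1) *\<^sub>R laplacian (\<lambda>x. (x \<bullet> (1, 0)) *\<^sub>R qres m \<phi> x) x =
      (k - 4 * real m) *\<^sub>R (qres (Suc m) (\<lambda>s. s * \<phi> s) x - fst x *\<^sub>R qres (Suc m) \<phi> x)"
    by (simp only: lc lq[OF \<phi>1] partial_qres[OF V W roots \<phi> x])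
      (simp add: inner_prod_def scaleR_conv_of_real algebra_simps)
  also have "(\<Sum>i\<in>UNIV. G i (L (laplacian (\<lambda>x. (x \<bullet> (0, axis i 1)) *\<^sub>R qres m \<phi> x) x))) =
      (\<Sum>i\<in>UNIV. G i (L ((k - 4 * real m) *\<^sub>R ((snd x $ i) *\<^sub>R qres (Suc m) \<phi> x))))"
    by (simp only: lap_coord)
  finally show ?thesis
    unfolding axial_fun_def k_def[symmetric]
    by (simp only: linear_scale[OF bounded_linear.linear[OF L]] linear_scale[OF bounded_linear.linear[OF G]]
        scaleR_sum_right scaleR_add_right)
qed

text \<open>The vector-valued terms 2m x' g from \<partial>_0 and -2m x' g from the other directions
  cancel. The n products of a generator with itself contribute -n R_m, and x' x' = -|x'|^2 turns the
  rest into moments that the expansion of Q reduces to (2m-1) R_m.\<close>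

lemma dirac_axial_fun:
  assumes \<phi>: "\<phi> holomorphic_on V" and x: "x \<in> W"
    and anti: "\<And>i j y. G i (G j y) + G j (G i y) = (if i = j then - 2 *\<^sub>R y else 0)"
  shows "dirac_op G (axial_fun G L m \<phi>) x = (2 * real m - 1 - CARD('n)) *\<^sub>R L (qres m \<phi> x)"
proof -
  note \<phi>1 = holomorphic_shift[OF V W roots \<phi>]
  note d0 = qres_differentiable[OF V W roots \<phi> x] and d1 = qres_differentiable[OF V W roots \<phi>1 x]
  note linL = bounded_linear.linear[OF L] and linG = bounded_linear.linear[OF G]
  define R where "R = qres m \<phi> x"
  define R' where "R' = qres (Suc m) \<phi> x"
  define S' where "S' = qres (Suc m) (\<lambda>s. s * \<phi> s) x"
  define S'' where "S'' = qres (Suc m) (\<lambda>s. s * (s * \<phi> s)) x"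
  define g where "g = S' - fst x *\<^sub>R R'"
  \<comment> \<open>Multiplication by the vector part of x, on the side prescribed by
    \<open>G\<close>. Its square is the scalar -|x'|^2: after symmetrising the double sum,
    anticommutation leaves only the diagonal.\<close>
  define u where "u y = (\<Sum>i\<in>UNIV. (snd x $ i) *\<^sub>R G i y)" for y
  have uu: "u (u y) = - (snd x \<bullet> snd x) *\<^sub>R y" for y
  proof -
    have uu1: "u (u y) = (\<Sum>k\<in>UNIV. \<Sum>i\<in>UNIV. (snd x $ k * snd x $ i) *\<^sub>R G k (G i y))"
      by (simp add: u_def linear_sum[OF linG] linear_scale[OF linG] scaleR_sum_right)
    also have "\<dots> = (\<Sum>k\<in>UNIV. \<Sum>i\<in>UNIV. (snd x $ k * snd x $ i) *\<^sub>R G i (G k y))"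
      by (subst sum.swap) (simp add: mult.commute)
    finally have "2 *\<^sub>R u (u y) = (\<Sum>k\<in>UNIV. \<Sum>i\<in>UNIV. (snd x $ k * snd x $ i) *\<^sub>R (G k (G i y) + G i (G k y)))"
      using uu1 by (simp add: scaleR_add_right sum.distrib scaleR_2)
    also have "\<dots> = (\<Sum>k\<in>UNIV. \<Sum>i\<in>UNIV. if k = i then (- 2 * (snd x $ k * snd x $ i)) *\<^sub>R y else 0)"
      by (intro sum.cong refl) (simp add: anti)
    also have "\<dots> = (- 2) *\<^sub>R ((snd x \<bullet> snd x) *\<^sub>R y)"
      by (simp add: inner_vec_def scaleR_sum_left scaleR_sum_right)
    finally have "2 *\<^sub>R u (u y) = 2 *\<^sub>R (- (snd x \<bullet> snd x) *\<^sub>R y)" by simp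
    then show ?thesis by (rule scaleR_left_imp_eq[rotated]) simp
  qed
  have ulin: "u (a *\<^sub>R y) = a *\<^sub>R u y" "u (y + z) = u y + u z" for a y z
    by (simp_all add: u_def linear_scale[OF linG] linear_add[OF linG] scaleR_sum_right scaleR_add_right
        sum.distrib mult.commute)
  have part: "partial c (axial_fun G L m \<phi>) x =
      L (partial c (qres m (\<lambda>s. s * \<phi> s)) x - ((c \<bullet> (1, 0)) *\<^sub>R R + fst x *\<^sub>R partial c (qres m \<phi>) x))
      + (\<Sum>i\<in>UNIV. G i (L ((c \<bullet> (0, axis i 1)) *\<^sub>R R + (snd x $ i) *\<^sub>R partial c (qres m \<phi>) x)))" for c
  proof -
    let ?f = "\<lambda>x. qres m (\<lambda>s. s * \<phi> s) x + (- 1) *\<^sub>R ((x \<bullet> (1, 0)) *\<^sub>R qres m \<phi> x)"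
    let ?h = "\<lambda>i x. (x \<bullet> (0, axis i 1)) *\<^sub>R qres m \<phi> x"
    note dh = differentiable_coordinate_scaleR[OF d0]
    have df: "?f differentiable (at x)"
      by (rule differentiable_add[OF d1 differentiable_bounded_linear[OF bounded_linear_scaleR_right dh]])
    have dL: "(\<lambda>x. L (?f x)) differentiable (at x)" "(\<lambda>x. L (?h i x)) differentiable (at x)" for i
      by (rule differentiable_bounded_linear[OF L df] differentiable_bounded_linear[OF L dh])+
    have dG: "(\<lambda>x. G i (L (?h i x))) differentiable (at x)" for i
      by (rule differentiable_bounded_linear[OF G dL(2)])
    have "partial c (axial_fun G L m \<phi>) x =
        partial c (\<lambda>x. L (?f x)) x + partial c (\<lambda>x. \<Sum>i\<in>UNIV. G i (L (?h i x))) x"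
      unfolding axial_fun_alt by (rule partial_add[OF dL(1) differentiable_sum]) (simp_all add: dG)
    also have "partial c (\<lambda>x. \<Sum>i\<in>UNIV. G i (L (?h i x))) x = (\<Sum>i\<in>UNIV. partial c (\<lambda>x. G i (L (?h i x))) x)"
      by (rule partial_sum) (rule dG)
    also have "\<dots> = (\<Sum>i\<in>UNIV. G i (L (partial c (?h i) x)))"
      by (intro sum.cong refl) (simp only: partial_bounded_linear[OF G dL(2)] partial_bounded_linear[OF L dh])
    also have "partial c (\<lambda>x. L (?f x)) x = L (partial c ?f x)"
      by (rule partial_bounded_linear[OF L df])
    also have "partial c ?f x =
        partial c (qres m (\<lambda>s. s * \<phi> s)) x + partial c (\<lambda>x. (- 1) *\<^sub>R ((x \<bullet> (1, 0)) *\<^sub>R qres m \<phi> x)) x"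
      by (rule partial_add[OF d1 differentiable_bounded_linear[OF bounded_linear_scaleR_right dh]])
    also have "partial c (\<lambda>x. (- 1) *\<^sub>R ((x \<bullet> (1, 0)) *\<^sub>R qres m \<phi> x)) x =
        (- 1) *\<^sub>R partial c (\<lambda>x. (x \<bullet> (1, 0)) *\<^sub>R qres m \<phi> x) x"
      by (rule partial_bounded_linear[OF bounded_linear_scaleR_right dh])
    also have "partial c (qres m (\<lambda>s. s * \<phi> s)) x + (- 1) *\<^sub>R partial c (\<lambda>x. (x \<bullet> (1, 0)) *\<^sub>R qres m \<phi> x) x =
        partial c (qres m (\<lambda>s. s * \<phi> s)) x - ((c \<bullet> (1, 0)) *\<^sub>R R + fst x *\<^sub>R partial c (qres m \<phi>) x)"
      by (simp only: partial_coordinate_scaleR[OF d0] R_def[symmetric]) (simp add: inner_prod_def[of x])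
    finally show ?thesis
      by (simp only: partial_coordinate_scaleR[OF d0] R_def[symmetric]) (simp add: inner_prod_def[of x] inner_axis)
  qed
  have p0: "partial (1, 0) (qres m \<phi>) x = (2 * real m) *\<^sub>R g"
    "partial (1, 0) (qres m (\<lambda>s. s * \<phi> s)) x = (2 * real m) *\<^sub>R (S'' - fst x *\<^sub>R S')"
    by (simp_all add: partial_qres[OF V W roots \<phi> x] partial_qres[OF V W roots \<phi>1 x] g_def R'_def S'_def S''_def
        inner_prod_def scaleR_diff_right)
  have pk: "partial (0, axis k 1) (qres m \<phi>) x = (- 2 * real m * snd x $ k) *\<^sub>R R'"
    "partial (0, axis k 1) (qres m (\<lambda>s. s * \<phi> s)) x = (- 2 * real m * snd x $ k) *\<^sub>R S'" for k
    by (simp_all add: partial_qres[OF V W roots \<phi> x] partial_qres[OF V W roots \<phi>1 x] R'_def S'_def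
        inner_prod_def inner_axis)
  have t0: "partial (1, 0) (axial_fun G L m \<phi>) x =
      L ((2 * real m) *\<^sub>R (S'' - fst x *\<^sub>R S' - fst x *\<^sub>R g) - R) + (2 * real m) *\<^sub>R u (L g)"
  proof -
    have "(\<Sum>i\<in>UNIV. G i (L (((1 :: real, 0) \<bullet> (0, axis i 1 :: real ^ 'n)) *\<^sub>R R + (snd x $ i) *\<^sub>R (2 * real m) *\<^sub>R g))) =
        (2 * real m) *\<^sub>R u (L g)"
      by (simp add: u_def inner_prod_def linear_scale[OF linL] linear_scale[OF linG] scaleR_sum_right mult.commute)
    moreover have "(2 * real m) *\<^sub>R (S'' - fst x *\<^sub>R S') - (((1 :: real, 0) \<bullet> (1, 0 :: real ^ 'n)) *\<^sub>R R + fst x *\<^sub>R (2 * real m) *\<^sub>R g)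
        = (2 * real m) *\<^sub>R (S'' - fst x *\<^sub>R S' - fst x *\<^sub>R g) - R"
      by (simp add: inner_prod_def algebra_simps)
    ultimately show ?thesis unfolding part p0 by (simp only:)
  qed
  have tk: "partial (0, axis k 1) (axial_fun G L m \<phi>) x =
      (- 2 * real m * snd x $ k) *\<^sub>R L g + G k (L R) + (- 2 * real m * snd x $ k) *\<^sub>R u (L R')" for k
  proof -
    have "(\<Sum>i\<in>UNIV. G i (L (((0, axis k 1) \<bullet> (0 :: real, axis i 1 :: real ^ 'n)) *\<^sub>R R
          + (snd x $ i) *\<^sub>R (- 2 * real m * snd x $ k) *\<^sub>R R'))) =
        (\<Sum>i\<in>UNIV. (if k = i then G i (L R) else 0) + (- 2 * real m * snd x $ k) *\<^sub>R (snd x $ i) *\<^sub>R G i (L R'))"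
      by (intro sum.cong refl)
        (simp add: inner_prod_def inner_axis_axis linear_scale[OF linL] linear_scale[OF linG] linear_add[OF linL]
          linear_add[OF linG] linear_diff[OF linL] linear_diff[OF linG] mult_ac)
    also have "\<dots> = G k (L R) + (- 2 * real m * snd x $ k) *\<^sub>R u (L R')"
      by (simp only: u_def sum.distrib scaleR_sum_right[symmetric]) simp
    finally have 1: "(\<Sum>i\<in>UNIV. G i (L (((0, axis k 1) \<bullet> (0 :: real, axis i 1 :: real ^ 'n)) *\<^sub>R R
          + (snd x $ i) *\<^sub>R (- 2 * real m * snd x $ k) *\<^sub>R R'))) =
        G k (L R) + (- 2 * real m * snd x $ k) *\<^sub>R u (L R')" .
    have 2: "(- 2 * real m * snd x $ k) *\<^sub>R S' - (((0 :: real, axis k 1) \<bullet> (1, 0 :: real ^ 'n)) *\<^sub>R R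
        + fst x *\<^sub>R (- 2 * real m * snd x $ k) *\<^sub>R R') = (- 2 * real m * snd x $ k) *\<^sub>R g"
      by (simp add: inner_prod_def g_def algebra_simps)
    show ?thesis unfolding part pk 1 2 by (simp only: linear_scale[OF linL] add.assoc)
  qed
  have GG: "G k (G k y) = - y" for k y
  proof -
    have "2 *\<^sub>R G k (G k y) = 2 *\<^sub>R (- y)" using anti[of k k y] by (simp add: scaleR_2)
    then show ?thesis by (rule scaleR_left_imp_eq[rotated]) simp
  qed
  have "(\<Sum>k\<in>UNIV. G k (partial (0, axis k 1) (axial_fun G L m \<phi>) x)) =
      (\<Sum>k\<in>UNIV. (- 2 * real m) *\<^sub>R (snd x $ k) *\<^sub>R G k (L g) + (- L R) + (- 2 * real m) *\<^sub>R (snd x $ k) *\<^sub>R G k (u (L R')))"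
    by (intro sum.cong refl) (simp only: tk linear_add[OF linG] linear_scale[OF linG] GG scaleR_scaleR)
  also have "\<dots> = (- 2 * real m) *\<^sub>R u (L g) - CARD('n) *\<^sub>R L R + (- 2 * real m) *\<^sub>R u (u (L R'))"
    by (simp only: sum.distrib scaleR_sum_right[symmetric] u_def[symmetric]) (simp add: sum_constant_scaleR)
  finally have "dirac_op G (axial_fun G L m \<phi>) x =
      L ((2 * real m) *\<^sub>R (S'' - fst x *\<^sub>R S' - fst x *\<^sub>R g) - R) - CARD('n) *\<^sub>R L R
      + (2 * real m) *\<^sub>R (snd x \<bullet> snd x) *\<^sub>R L R'"
    unfolding dirac_op_def t0 uu by (simp add: scaleR_minus_left)
  \<comment> \<open>Eliminating \<open>S''\<close> by the expansion of Q cancels the terms in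
    \<open>S'\<close>, and |x|^2 - x0^2 = |x'|^2 matches the remaining term in
    \<open>R'\<close>.\<close>
  moreover have "(2 * real m) *\<^sub>R (S'' - fst x *\<^sub>R S' - fst x *\<^sub>R g) - R + (2 * real m) *\<^sub>R (snd x \<bullet> snd x) *\<^sub>R R'
      = (2 * real m - 1) *\<^sub>R R"
  proof -
    have S'': "S'' = R + of_real (2 * fst x) * S' - of_real (x \<bullet> x) * R'"
      using qres_quad_expand[OF V roots[OF x] \<phi>, of m]
      by (simp add: R_def R'_def S'_def S''_def algebra_simps)
    show ?thesis
      unfolding S'' by (simp add: g_def inner_prod_def[of x x] scaleR_conv_of_real algebra_simps)
  qed
  then have "L ((2 * real m) *\<^sub>R (S'' - fst x *\<^sub>R S' - fst x *\<^sub>R g) - R)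
      + (2 * real m) *\<^sub>R (snd x \<bullet> snd x) *\<^sub>R L R' = (2 * real m - 1) *\<^sub>R L R"
    by (simp only: linear_scale[OF linL, symmetric] linear_add[OF linL, symmetric])
  ultimately show ?thesis by (simp add: R_def scaleR_diff_left algebra_simps)
qed

end

section \<open>Slices of the Clifford algebra\<close>

lemma bounded_linear_clifford_mult:
  fixes a :: "'n::{finite,linorder} clifford"
  shows "bounded_linear (\<lambda>y. a * y)" "bounded_linear (\<lambda>y. y * a)"
  by (intro linear_conv_bounded_linear[THEN iffD1] linearI; simp add: algebra_simps)+

text \<open>Composing right multiplications reverses the order of the factors; the second identity
  is the relation for the maps y \<mapsto> y e_i, written out in that order.\<close>

lemma gen_mult_anticommute:
  "gen i * (gen j * y) + gen j * (gen i * y) = (if i = j then - 2 *\<^sub>R y else 0)"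
  "y * gen j * gen i + y * gen i * gen j = (if i = j then - 2 *\<^sub>R y else 0)"
proof -
  have "gen i * (gen j * y) + gen j * (gen i * y) = (gen i * gen j + gen j * gen i) * y"
    by (simp add: algebra_simps)
  then show "gen i * (gen j * y) + gen j * (gen i * y) = (if i = j then - 2 *\<^sub>R y else 0)"
    by (simp only: gen_anticommute) (simp add: scaleR_conv_of_real)
  have "y * gen j * gen i + y * gen i * gen j = y * (gen i * gen j + gen j * gen i)"
    by (simp add: algebra_simps)
  then show "y * gen j * gen i + y * gen i * gen j = (if i = j then - 2 *\<^sub>R y else 0)"
    by (simp only: gen_anticommute) (simp add: scaleR_conv_of_real mult_2 mult_2_right)
qed

lemma clifford_vector_scaleR: "clifford_vector (r *\<^sub>R w) = r *\<^sub>R clifford_vector w"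
  by (simp add: clifford_vector_def scaleR_sum_right)

lemma clifford_vector_square: "clifford_vector w * clifford_vector w = - (w \<bullet> w) *\<^sub>R 1"
proof -
  have *: "clifford_vector w * clifford_vector w = (\<Sum>i\<in>UNIV. \<Sum>j\<in>UNIV. (w $ i * w $ j) *\<^sub>R (gen i * gen j))"
    by (simp add: clifford_vector_def sum_product mult.commute)
  also have "\<dots> = (\<Sum>i\<in>UNIV. \<Sum>j\<in>UNIV. (w $ i * w $ j) *\<^sub>R (gen j * gen i))"
    by (subst sum.swap) (simp add: mult.commute)
  finally have "2 *\<^sub>R (clifford_vector w * clifford_vector w) =
      (\<Sum>i\<in>UNIV. \<Sum>j\<in>UNIV. (w $ i * w $ j) *\<^sub>R (gen i * gen j + gen j * gen i))"
    using * by (simp add: scaleR_add_right sum.distrib scaleR_2)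
  also have "\<dots> = (\<Sum>i\<in>UNIV. \<Sum>j\<in>UNIV. if i = j then (w $ i * w $ j) *\<^sub>R (- 2) else 0)"
    unfolding gen_anticommute by (intro sum.cong refl) simp
  also have "\<dots> = (w \<bullet> w) *\<^sub>R (- 2)"
    by (simp add: inner_vec_def scaleR_sum_left sum_negf)
  also have "(- 2 :: 'a clifford) = - (2 *\<^sub>R 1)" by (simp add: scaleR_conv_of_real)
  also have "(w \<bullet> w) *\<^sub>R - (2 *\<^sub>R 1) = 2 *\<^sub>R (- (w \<bullet> w) *\<^sub>R (1 :: 'a clifford))"
    by (simp add: mult.commute)
  finally show ?thesis by (rule scaleR_left_imp_eq[rotated]) simp
qed

text \<open>The real-linear identification of the complex numbers with \<real> + I \<real>. It is
  multiplicative when I is an imaginary unit, so computations inside a slice are carried out with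
  complex numbers.\<close>

definition slice_embed :: "real ^ 'n::{finite,linorder} \<Rightarrow> complex \<Rightarrow> 'n clifford" where
  "slice_embed I c = Re c *\<^sub>R 1 + Im c *\<^sub>R clifford_vector I"

lemma slice_embed_of_real [simp]: "slice_embed I (of_real r) = r *\<^sub>R 1"
  by (simp add: slice_embed_def)

lemma bounded_linear_slice_embed: "bounded_linear (slice_embed I)"
  unfolding slice_embed_def by (intro linear_conv_bounded_linear[THEN iffD1] linearI) (simp_all add: algebra_simps)

lemma slice_embed_mult:
  assumes "I \<in> imag_units"
  shows "slice_embed I (a * b) = slice_embed I a * slice_embed I b"
proof -
  have "I \<bullet> I = 1" using assms by (simp add: imag_units_def norm_eq_1)
  then show ?thesis
    by (simp add: slice_embed_def clifford_vector_square algebra_simps)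
qed

lemma slice_embed_power:
  assumes "I \<in> imag_units"
  shows "slice_embed I (a ^ k) = slice_embed I a ^ k"
  by (induction k) (simp_all add: slice_embed_mult[OF assms], simp add: slice_embed_def)

lemma paravector_slice_point: "paravector (slice_point I z) = slice_embed I z"
  by (simp add: paravector_def slice_point_def slice_embed_def clifford_vector_scaleR of_real_def)

lemma Q_c_slice_point:
  assumes "I \<in> imag_units"
  shows "Q_c (slice_point I s) x = slice_embed I (quad x s)"
proof -
  note lin = bounded_linear.linear[OF bounded_linear_slice_embed]
  have "of_real (2 * fst x) * s = (2 * fst x) *\<^sub>R s" by (simp add: scaleR_conv_of_real)
  then show ?thesis
    by (simp only: Q_c_def paravector_slice_point quad_eq linear_add[OF lin] linear_diff[OF lin] linear_scale[OF lin]
        slice_embed_power[OF assms] slice_embed_of_real power2_norm_eq_inner of_real_def[where 'a = "'a clifford"])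
qed

text \<open>Two-sided inverses are unique by associativity, so an inverse found inside the slice is
  the inverse in the whole algebra.\<close>

lemma clifford_inverse_slice_embed:
  assumes "I \<in> imag_units" "c \<noteq> 0"
  shows "clifford_inverse (slice_embed I c) = slice_embed I (1 / c)"
  unfolding clifford_inverse_def
proof (rule the_equality)
  have one: "slice_embed I 1 = 1" by (simp add: slice_embed_def)
  show inv: "slice_embed I c * slice_embed I (1 / c) = 1 \<and> slice_embed I (1 / c) * slice_embed I c = 1"
    using assms by (simp add: slice_embed_mult[symmetric] one)
  show "b = slice_embed I (1 / c)" if "slice_embed I c * b = 1 \<and> b * slice_embed I c = 1" for b
    using that inv by (metis mult.assoc mult_1_left mult_1_right)
qed

lemma kernel_H_slice_point:
  fixes I :: "real ^ 'n::{finite,linorder}"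
  assumes "I \<in> imag_units" "quad x s \<noteq> 0"
  shows "kernel_H l (slice_point I s) x =
    sigma ((CARD('n) - 1) div 2) l *\<^sub>R slice_embed I (1 / quad x s ^ l)"
  using assms
  by (simp add: kernel_H_def Q_c_slice_point clifford_inverse_slice_embed slice_embed_power[symmetric] power_one_over)

lemma ds_slice_embed:
  assumes "I \<in> imag_units"
  shows "ds I \<gamma> t = slice_embed I (- \<i> * vector_derivative \<gamma> (at t within {0..1}))"
proof -
  have "- clifford_vector I = slice_embed I (- \<i>)" by (simp add: slice_embed_def)
  then show ?thesis
    by (simp add: ds_def paravector_slice_point slice_embed_mult[OF assms, symmetric] mult.commute)
qed

section \<open>Axially symmetric domains\<close>

lemma imag_units_nonempty: "axis i 1 \<in> imag_units"
  by (simp add: imag_units_def norm_eq_1 inner_axis_axis)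

text \<open>The common shape of all slices of an axially symmetric set. It serves as the domain of
  the stem functions and does not refer to an imaginary unit.\<close>

definition axial_plane :: "'n::finite point set \<Rightarrow> complex set" where
  "axial_plane W = {s. (Re s, Im s) \<in> axial_domain W}"

lemma slice_eq_axial_plane:
  assumes "axially_symmetric W" "I \<in> imag_units"
  shows "slice I W = axial_plane W"
proof (intro equalityI subsetI)
  fix s assume "s \<in> slice I W"
  then have "orbit (slice_point I s) \<subseteq> W"
    using assms(1) by (auto simp: slice_def axially_symmetric_def)
  moreover have "(Re s, Im s *\<^sub>R J) \<in> orbit (slice_point I s)" if J: "J \<in> imag_units" for J
  proof -
    \<comment> \<open>The orbit is described with a nonnegative radius, so a point in the lower half
      plane is reached through the opposite unit -J.\<close>
    have "Im s *\<^sub>R J = norm (Im s *\<^sub>R I) *\<^sub>R (if Im s < 0 then - J else J)"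
      using assms(2) by (simp add: imag_units_def)
    moreover have "(if Im s < 0 then - J else J) \<in> imag_units" using J by (simp add: imag_units_def)
    ultimately show ?thesis unfolding orbit_def slice_point_def by auto
  qed
  ultimately show "s \<in> axial_plane W" by (auto simp: axial_plane_def axial_domain_def)
qed (use assms(2) in \<open>auto simp: axial_plane_def axial_domain_def slice_def slice_point_def\<close>)

lemma continuous_slice_point: "continuous_on A (slice_point I)"
  unfolding slice_point_def by (intro continuous_intros)

lemma open_axial_plane:
  fixes W :: "'n::finite point set"
  assumes "open W" "axially_symmetric W"
  shows "open (axial_plane W)"
proof -
  obtain I :: "real ^ 'n" where I: "I \<in> imag_units" using imag_units_nonempty by blast
  have "slice I W = slice_point I -` W" by (auto simp: slice_def)
  then show ?thesis
    using slice_eq_axial_plane[OF assms(2) I] continuous_open_vimage[OF assms(1), of "slice_point I"]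
      continuous_slice_point[of UNIV I] by (simp add: continuous_on_eq_continuous_at)
qed

lemma cnj_axial_plane:
  assumes "s \<in> axial_plane W"
  shows "cnj s \<in> axial_plane W"
proof -
  have "(Re s, (- Im s) *\<^sub>R J) \<in> W" if "J \<in> imag_units" for J
  proof -
    have "- J \<in> imag_units" using that by (simp add: imag_units_def)
    then have "(Re s, Im s *\<^sub>R (- J)) \<in> W" using assms by (auto simp: axial_plane_def axial_domain_def)
    then show ?thesis by simp
  qed
  then show ?thesis by (simp add: axial_plane_def axial_domain_def)
qed

lemma quad_roots_axial_plane:
  assumes "axially_symmetric W" "x \<in> W"
  shows "quad_roots x \<subseteq> axial_plane W"
proof -
  have "axis_root x \<in> axial_plane W"
    using assms unfolding axially_symmetric_def orbit_def axial_plane_def axial_domain_def axis_root_def by auto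
  then show ?thesis using cnj_axial_plane by (auto simp: quad_roots_def)
qed

lemma closure_slice_subset:
  assumes "I \<in> imag_units"
  shows "closure (slice I U) \<subseteq> slice I (closure U)"
proof (rule closure_minimal)
  have "closed (slice_point I -` closure U)"
    using continuous_closed_vimage[of "closure U" "slice_point I"] continuous_slice_point[of UNIV I]
    by (simp add: continuous_on_eq_continuous_at)
  then show "closed (slice I (closure U))" by (simp add: slice_def vimage_def)
  show "slice I U \<subseteq> slice I (closure U)" using closure_subset by (auto simp: slice_def)
qed

section \<open>Holomorphic components\<close>

definition stem :: "(real \<times> real \<Rightarrow> 'e::real_inner) \<Rightarrow> (real \<times> real \<Rightarrow> 'e) \<Rightarrow> 'e \<Rightarrow> complex \<Rightarrow> complex" where
  "stem \<alpha> \<beta> b s = Complex (\<alpha> (Re s, Im s) \<bullet> b) (\<beta> (Re s, Im s) \<bullet> b)"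

lemma partial_decompose:
  assumes "f differentiable (at p)"
  shows "partial (u, v) f p = u *\<^sub>R partial (1, 0) f p + v *\<^sub>R partial (0, 1) f p"
proof -
  have lin: "linear (\<lambda>h. partial h f p)"
    using has_derivative_linear[OF has_derivative_partial[OF assms]] .
  have "(u, v) = u *\<^sub>R (1, 0) + v *\<^sub>R (0, 1 :: real)" by simp
  then show ?thesis
    using linear_add[OF lin, of "u *\<^sub>R (1, 0)" "v *\<^sub>R (0, 1)"]
    by (simp only: linear_scale[OF lin])
qed

text \<open>The Cauchy-Riemann equations make the real derivative of the b-component multiplication
  by one complex number, whose real and imaginary parts come from the derivatives in the first
  variable.\<close>

lemma stem_holomorphic:
  assumes V: "open (axial_plane W)" and CR: "cauchy_riemann_pair (axial_domain W) \<alpha> \<beta>"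
  shows "stem \<alpha> \<beta> b holomorphic_on axial_plane W"
  unfolding holomorphic_on_open[OF V]
proof (intro ballI)
  fix s assume s: "s \<in> axial_plane W"
  let ?p = "(Re s, Im s)"
  have diff: "\<alpha> differentiable (at ?p)" "\<beta> differentiable (at ?p)"
    and cr: "partial (1, 0) \<alpha> ?p = partial (0, 1) \<beta> ?p" "partial (0, 1) \<alpha> ?p = - partial (1, 0) \<beta> ?p"
    using CR s by (auto simp: cauchy_riemann_pair_def axial_plane_def)
  have comp: "((\<lambda>s. f (Re s, Im s)) has_derivative (\<lambda>h. partial (Re h, Im h) f ?p)) (at s)"
    if "f differentiable (at ?p)" for f :: "real \<times> real \<Rightarrow> 'c::real_normed_vector"
    by (rule has_derivative_compose[where g = f and f = "\<lambda>s. (Re s, Im s)"])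
      (auto intro!: derivative_eq_intros has_derivative_partial[OF that])
  have "((\<lambda>s. of_real (\<alpha> (Re s, Im s) \<bullet> b) + \<i> * of_real (\<beta> (Re s, Im s) \<bullet> b)) has_derivative
      (\<lambda>h. of_real (partial (Re h, Im h) \<alpha> ?p \<bullet> b) + \<i> * of_real (partial (Re h, Im h) \<beta> ?p \<bullet> b))) (at s)"
    by (intro has_derivative_add has_derivative_mult_right has_derivative_of_real has_derivative_inner_left comp diff)
  moreover have "(\<lambda>h. of_real (partial (Re h, Im h) \<alpha> ?p \<bullet> b) + \<i> * of_real (partial (Re h, Im h) \<beta> ?p \<bullet> b)) =
      (*) (Complex (partial (1, 0) \<alpha> ?p \<bullet> b) (partial (1, 0) \<beta> ?p \<bullet> b))"
  proof (rule ext)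
    fix h
    show "of_real (partial (Re h, Im h) \<alpha> ?p \<bullet> b) + \<i> * of_real (partial (Re h, Im h) \<beta> ?p \<bullet> b) =
        Complex (partial (1, 0) \<alpha> ?p \<bullet> b) (partial (1, 0) \<beta> ?p \<bullet> b) * h"
      by (simp add: partial_decompose[OF diff(1), of "Re h" "Im h"] partial_decompose[OF diff(2), of "Re h" "Im h"]
          cr[symmetric] complex_eq_iff inner_add_left)
        (simp add: cr)
  qed
  moreover have "stem \<alpha> \<beta> b = (\<lambda>s. of_real (\<alpha> (Re s, Im s) \<bullet> b) + \<i> * of_real (\<beta> (Re s, Im s) \<bullet> b))"
    by (rule ext) (simp add: stem_def Complex_eq)
  ultimately show "\<exists>f'. (stem \<alpha> \<beta> b has_field_derivative f') (at s)"
    unfolding has_field_derivative_def by metis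
qed

lemma stem_cnj:
  assumes "even_odd_pair (axial_domain W) \<alpha> \<beta>" "s \<in> axial_plane W"
  shows "stem \<alpha> \<beta> b (cnj s) = cnj (stem \<alpha> \<beta> b s)"
  using assms by (auto simp: stem_def even_odd_pair_def axial_plane_def complex_eq_iff)

section \<open>Recovering a stem function from residue sums of order one\<close>

lemma sum_residue_over_linear:
  assumes "open V" "\<phi> holomorphic_on V" "finite A" "A \<subseteq> V" "z \<in> A"
  shows "(\<Sum>p\<in>A. residue (\<lambda>s. \<phi> s / (s - z)) p) = \<phi> z"
proof -
  have "residue (\<lambda>s. \<phi> s / (s - z)) p = (if p = z then \<phi> z else 0)" if "p \<in> A" for p
  proof (cases "p = z")
    case True
    then show ?thesis using residue_simple[OF assms(1) _ assms(2)] that assms(4) by auto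
  next
    case False
    have "(\<lambda>s. \<phi> s / (s - z)) holomorphic_on V - {z}"
      using assms(2) by (auto intro!: holomorphic_intros intro: holomorphic_on_subset)
    then have "residue (\<lambda>s. \<phi> s / (s - z)) p = 0"
      using False that assms by (intro residue_holo[of "V - {z}"]) auto
    with False show ?thesis by simp
  qed
  then have "(\<Sum>p\<in>A. residue (\<lambda>s. \<phi> s / (s - z)) p) = (\<Sum>p\<in>A. if p = z then \<phi> z else 0)"
    by (intro sum.cong refl)
  then show ?thesis using assms by simp
qed

text \<open>For a root z the numerator s - cnj z cancels one factor of Q and leaves \<phi>(s)/(s -
  z), whose only possible pole is simple with residue \<phi>(z). The argument also covers a double
  root on the real axis.\<close>

lemma qres_1_root:
  assumes V: "open V" "quad_roots x \<subseteq> V" "\<phi> holomorphic_on V" and z: "z \<in> quad_roots x"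
  shows "qres 1 (\<lambda>s. s * \<phi> s) x - cnj z * qres 1 \<phi> x = \<phi> z"
proof -
  have hol: "(\<lambda>s. s * \<phi> s) holomorphic_on V" "(\<lambda>s. - cnj z * \<phi> s) holomorphic_on V"
    by (intro holomorphic_intros V(3))+
  have "qres 1 (\<lambda>s. s * \<phi> s) x - cnj z * qres 1 \<phi> x = qres 1 (\<lambda>s. s * \<phi> s + (- cnj z) * \<phi> s) x"
    unfolding qres_add[OF V(1,2) hol] qres_cmult[OF V] by simp
  also have "\<dots> = (\<Sum>p\<in>quad_roots x. residue (\<lambda>s. \<phi> s / (s - z)) p)"
    unfolding qres_def
  proof (intro sum.cong refl residue_cong)
    fix p
    have quad: "quad x s = (s - z) * (s - cnj z)" for s
      using z by (auto simp: quad_def quad_roots_def)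
    show "\<forall>\<^sub>F s in at p. (s * \<phi> s + - cnj z * \<phi> s) / quad x s ^ 1 = \<phi> s / (s - z)"
      using eventually_not_quad_root[of x p]
    proof eventually_elim
      case (elim s)
      then have "s \<noteq> z" "s \<noteq> cnj z" using z by (auto simp: quad_roots_def)
      then show ?case by (simp add: quad divide_simps) (simp add: algebra_simps)
    qed
  qed
  also have "\<dots> = \<phi> z" by (rule sum_residue_over_linear[OF V(1,3) _ V(2) z]) simp
  finally show ?thesis .
qed

text \<open>Average and difference of the identities for z and cnj z. The second formula is not
  divided by |x'|, so that it holds on the real axis too.\<close>

lemma qres_1:
  assumes V: "open V" "quad_roots x \<subseteq> V" "\<phi> holomorphic_on V"
  shows "qres 1 (\<lambda>s. s * \<phi> s) x - fst x *\<^sub>R qres 1 \<phi> x = (\<phi> (axis_root x) + \<phi> (cnj (axis_root x))) / 2"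
    and "2 * \<i> * of_real (norm (snd x)) * qres 1 \<phi> x = \<phi> (axis_root x) - \<phi> (cnj (axis_root x))"
proof -
  let ?z = "axis_root x"
  have z: "qres 1 (\<lambda>s. s * \<phi> s) x - cnj ?z * qres 1 \<phi> x = \<phi> ?z"
    and z': "qres 1 (\<lambda>s. s * \<phi> s) x - ?z * qres 1 \<phi> x = \<phi> (cnj ?z)"
    using qres_1_root[OF V, of ?z] qres_1_root[OF V, of "cnj ?z"] by (simp_all add: quad_roots_def)
  have r: "?z = of_real (fst x) + \<i> * of_real (norm (snd x))" by (simp add: axis_root_def Complex_eq)
  show "qres 1 (\<lambda>s. s * \<phi> s) x - fst x *\<^sub>R qres 1 \<phi> x = (\<phi> ?z + \<phi> (cnj ?z)) / 2"
    unfolding z[symmetric] z'[symmetric] by (simp add: r scaleR_conv_of_real algebra_simps)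
  show "2 * \<i> * of_real (norm (snd x)) * qres 1 \<phi> x = \<phi> ?z - \<phi> (cnj ?z)"
    unfolding z[symmetric] z'[symmetric] by (simp add: r algebra_simps)
qed

section \<open>Boundary integrals\<close>

text \<open>The roots lie in the open set \<open>S\<close>, hence off the curves and with total
  winding number 1. A point outside \<open>V\<close> is outside the closure of \<open>S\<close> and
  has total winding number 0. These are the hypotheses of the residue theorem for cycles.\<close>

lemma boundary_integral:
  assumes bd: "positively_oriented_boundary S \<Gamma>" and S: "open S" "closure S \<subseteq> V" and V: "open V"
    and \<phi>: "\<phi> holomorphic_on V" and x: "quad_roots x \<subseteq> S"
  shows "\<gamma> \<in> \<Gamma> \<Longrightarrow> (\<lambda>s. \<phi> s / quad x s ^ m) contour_integrable_on \<gamma>"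
    and "\<gamma> \<in> \<Gamma> \<Longrightarrow> t \<in> {0..1} \<Longrightarrow> \<gamma> t \<in> V - quad_roots x"
    and "(\<Sum>\<gamma>\<in>\<Gamma>. contour_integral \<gamma> (\<lambda>s. \<phi> s / quad x s ^ m)) = 2 * pi * \<i> * qres m \<phi> x"
proof -
  have sub: "path_image \<gamma> \<subseteq> V - quad_roots x" if "\<gamma> \<in> \<Gamma>" for \<gamma>
  proof -
    have "path_image \<gamma> \<subseteq> frontier S" using bd that by (auto simp: positively_oriented_boundary_def)
    moreover have "frontier S \<subseteq> closure S - S" using S(1) by (auto simp: frontier_def interior_open)
    ultimately show ?thesis using S(2) x by blast
  qed
  have path: "valid_path \<gamma>" "pathfinish \<gamma> = pathstart \<gamma>" if "\<gamma> \<in> \<Gamma>" for \<gamma>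
    using bd that by (auto simp: positively_oriented_boundary_def)
  have SV: "S \<subseteq> V" using S(2) closure_subset by blast
  show "(\<lambda>s. \<phi> s / quad x s ^ m) contour_integrable_on \<gamma>" if "\<gamma> \<in> \<Gamma>"
    by (rule contour_integrable_holomorphic_simple[OF over_quad_holomorphic[OF \<phi>] _ path(1)[OF that] sub[OF that]])
      (intro open_Diff V finite_imp_closed finite_quad_roots)
  show "\<gamma> t \<in> V - quad_roots x" if "\<gamma> \<in> \<Gamma>" "t \<in> {0..1}"
    using sub[OF that(1)] that(2) by (simp add: path_image_def image_subset_iff)
  show "(\<Sum>\<gamma>\<in>\<Gamma>. contour_integral \<gamma> (\<lambda>s. \<phi> s / quad x s ^ m)) = 2 * pi * \<i> * qres m \<phi> x"
    unfolding qres_def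
  proof (rule Residue_theorem_cycle[OF _ V _ _ over_quad_holomorphic[OF \<phi>], where g = "\<lambda>\<gamma>. \<gamma>"])
    show "(\<Sum>\<gamma>\<in>\<Gamma>. winding_number \<gamma> w) = 0" if "w \<notin> V" for w
      using bd S(2) that by (auto simp: positively_oriented_boundary_def)
    show "(\<Sum>\<gamma>\<in>\<Gamma>. winding_number \<gamma> p) = 1" if "p \<in> quad_roots x" for p
      using bd x that by (auto simp: positively_oriented_boundary_def)
  qed (use bd sub path x SV in \<open>auto simp: positively_oriented_boundary_def\<close>)
qed

text \<open>Each \<open>J b\<close> is real-linear and commutes with integration, which reduces a
  Clifford-valued integral to complex contour integrals; the intended maps embed a complex number in
  the slice and multiply it by the blade b on one side. The factor -\<i> represents ds(-I) and
  cancels the \<i> of 2 \<pi> \<i>.\<close>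

lemma slice_integral:
  fixes J :: "'e \<Rightarrow> complex \<Rightarrow> 'e::euclidean_space"
  assumes bd: "positively_oriented_boundary S \<Gamma>" and S: "open S" "closure S \<subseteq> V" and V: "open V"
    and \<phi>: "\<And>b. b \<in> B \<Longrightarrow> \<phi> b holomorphic_on V" and x: "quad_roots x \<subseteq> S"
    and B: "finite B" and J: "\<And>b. bounded_linear (J b)"
    and F: "\<And>\<gamma> t. \<gamma> \<in> \<Gamma> \<Longrightarrow> t \<in> {0..1} \<Longrightarrow> F \<gamma> t = c *\<^sub>R (\<Sum>b\<in>B. J b
      (- \<i> * (\<phi> b (\<gamma> t) / quad x (\<gamma> t) ^ l * vector_derivative \<gamma> (at t within {0..1}))))"
  shows "\<gamma> \<in> \<Gamma> \<Longrightarrow> F \<gamma> integrable_on {0..1}"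
    and "(\<Sum>\<gamma>\<in>\<Gamma>. integral {0..1} (F \<gamma>)) = (2 * pi) *\<^sub>R c *\<^sub>R (\<Sum>b\<in>B. J b (qres l (\<phi> b) x))"
proof -
  let ?CI = "\<lambda>\<gamma> b. contour_integral \<gamma> (\<lambda>s. \<phi> b s / quad x s ^ l)"
  note lin = bounded_linear.linear[OF J]
  have int: "(F \<gamma> has_integral c *\<^sub>R (\<Sum>b\<in>B. J b (- \<i> * ?CI \<gamma> b))) {0..1}" if \<gamma>: "\<gamma> \<in> \<Gamma>" for \<gamma>
  proof (rule has_integral_eq)
    have "((\<lambda>t. J b (- \<i> * (\<phi> b (\<gamma> t) / quad x (\<gamma> t) ^ l * vector_derivative \<gamma> (at t within {0..1}))))
        has_integral J b (- \<i> * ?CI \<gamma> b)) {0..1}" if b: "b \<in> B" for b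
    proof -
      have lin: "bounded_linear (\<lambda>z. J b (- \<i> * z))"
        by (rule bounded_linear_compose[OF J bounded_linear_mult_right])
      have "((\<lambda>t. \<phi> b (\<gamma> t) / quad x (\<gamma> t) ^ l * vector_derivative \<gamma> (at t within {0..1}))
          has_integral ?CI \<gamma> b) {0..1}"
        using has_contour_integral_integral[OF boundary_integral(1)[OF bd S V \<phi>[OF b] x \<gamma>, of l]]
        by (simp add: has_contour_integral_def)
      then show ?thesis using has_integral_linear[OF _ lin] by (simp only: o_def)
    qed
    then show "((\<lambda>t. c *\<^sub>R (\<Sum>b\<in>B. J b
        (- \<i> * (\<phi> b (\<gamma> t) / quad x (\<gamma> t) ^ l * vector_derivative \<gamma> (at t within {0..1})))))
        has_integral c *\<^sub>R (\<Sum>b\<in>B. J b (- \<i> * ?CI \<gamma> b))) {0..1}"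
      by (intro has_integral_cmul has_integral_sum B)
  qed (simp add: F[OF \<gamma>])
  show "F \<gamma> integrable_on {0..1}" if "\<gamma> \<in> \<Gamma>" using int[OF that] by blast
  have "(\<Sum>\<gamma>\<in>\<Gamma>. integral {0..1} (F \<gamma>)) = (\<Sum>\<gamma>\<in>\<Gamma>. c *\<^sub>R (\<Sum>b\<in>B. J b (- \<i> * ?CI \<gamma> b)))"
    using int by (intro sum.cong refl integral_unique)
  also have "\<dots> = c *\<^sub>R (\<Sum>b\<in>B. \<Sum>\<gamma>\<in>\<Gamma>. J b (- \<i> * ?CI \<gamma> b))"
    unfolding scaleR_sum_right[symmetric] by (subst sum.swap) (rule refl)
  also have "(\<Sum>b\<in>B. \<Sum>\<gamma>\<in>\<Gamma>. J b (- \<i> * ?CI \<gamma> b)) = (\<Sum>b\<in>B. (2 * pi) *\<^sub>R J b (qres l (\<phi> b) x))"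
  proof (rule sum.cong[OF refl])
    fix b assume b: "b \<in> B"
    have rot: "- \<i> * (c * \<i> * q) = c * q" for c q :: complex
      by (simp add: complex_eq_iff)
    have res: "(\<Sum>\<gamma>\<in>\<Gamma>. ?CI \<gamma> b) = 2 * pi * \<i> * qres l (\<phi> b) x"
      by (rule boundary_integral(3)[OF bd S V \<phi>[OF b] x])
    have "(\<Sum>\<gamma>\<in>\<Gamma>. J b (- \<i> * ?CI \<gamma> b)) = J b (- \<i> * (\<Sum>\<gamma>\<in>\<Gamma>. ?CI \<gamma> b))"
      unfolding sum_distrib_left linear_sum[OF lin] ..
    also have "- \<i> * (\<Sum>\<gamma>\<in>\<Gamma>. ?CI \<gamma> b) = (2 * pi) *\<^sub>R qres l (\<phi> b) x"
      unfolding res scaleR_conv_of_real by (rule rot)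
    finally show "(\<Sum>\<gamma>\<in>\<Gamma>. J b (- \<i> * ?CI \<gamma> b)) = (2 * pi) *\<^sub>R J b (qres l (\<phi> b) x)"
      by (simp only: linear_scale[OF lin])
  qed
  finally show "(\<Sum>\<gamma>\<in>\<Gamma>. integral {0..1} (F \<gamma>)) = (2 * pi) *\<^sub>R c *\<^sub>R (\<Sum>b\<in>B. J b (qres l (\<phi> b) x))"
    by (simp add: scaleR_sum_right[symmetric] mult.commute)
qed

section \<open>Iterated Laplacians\<close>

lemma laplacian_funpow_qres:
  fixes W :: "(real \<times> 'b::euclidean_space) set"
  assumes V: "open V" and W: "open W" and roots: "\<And>x. x \<in> W \<Longrightarrow> quad_roots x \<subseteq> V"
    and \<phi>: "\<phi> holomorphic_on V" and L: "bounded_linear L" and x: "x \<in> W"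
  shows "(laplacian ^^ j) (\<lambda>x. L (qres m \<phi> x)) x =
    (\<Prod>i<j. 4 * real (m + i) * (real (m + i) + 1) - 2 * real (m + i) * DIM(real \<times> 'b)) *\<^sub>R L (qres (m + j) \<phi> x)"
  using x
proof (induction j arbitrary: x)
  case (Suc j)
  let ?c = "\<Prod>i<j. 4 * real (m + i) * (real (m + i) + 1) - 2 * real (m + i) * DIM(real \<times> 'b)"
  have cL: "bounded_linear (\<lambda>z. ?c *\<^sub>R L z)"
    by (rule bounded_linear_compose[OF bounded_linear_scaleR_right L])
  have "(laplacian ^^ Suc j) (\<lambda>x. L (qres m \<phi> x)) x = laplacian (\<lambda>x. ?c *\<^sub>R L (qres (m + j) \<phi> x)) x"
    using laplacian_cong[OF W Suc.prems Suc.IH] by simp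
  also have "\<dots> = ?c *\<^sub>R L (laplacian (qres (m + j) \<phi>) x)"
    by (rule laplacian_bounded_linear[OF W Suc.prems C_k_on_qres[OF V W roots \<phi>] cL])
  also have "laplacian (qres (m + j) \<phi>) x = (4 * real (m + j) * (real (m + j) + 1)
      - 2 * real (m + j) * DIM(real \<times> 'b)) *\<^sub>R qres (m + Suc j) \<phi> x"
    by (simp only: laplacian_qres[OF V W roots \<phi> Suc.prems] add_Suc_right)
  finally show ?case
    by (simp only: linear_scale[OF bounded_linear.linear[OF L]] scaleR_scaleR prod.lessThan_Suc)
qed simp

lemma laplacian_funpow_axial_fun:
  fixes W :: "(real \<times> (real ^ 'n::finite)) set" and G :: "'n \<Rightarrow> 'e \<Rightarrow> 'e::real_normed_vector"
  assumes V: "open V" and W: "open W" and roots: "\<And>x. x \<in> W \<Longrightarrow> quad_roots x \<subseteq> V"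
    and G: "\<And>i. bounded_linear (G i)" and L: "\<And>b. bounded_linear (L b)"
    and \<phi>: "\<And>b. b \<in> B \<Longrightarrow> \<phi> b holomorphic_on V" and B: "finite B" and x: "x \<in> W"
  shows "(laplacian ^^ j) (\<lambda>x. \<Sum>b\<in>B. axial_fun G (L b) m (\<phi> b) x) x =
    (\<Prod>i<j. 4 * real (m + i) * (real (m + i) + 1) - 2 * real (m + i) * (CARD('n) + 1) - 4 * real (m + i)) *\<^sub>R
      (\<Sum>b\<in>B. axial_fun G (L b) (m + j) (\<phi> b) x)"
  using x
proof (induction j arbitrary: x)
  case (Suc j)
  let ?c = "\<Prod>i<j. 4 * real (m + i) * (real (m + i) + 1) - 2 * real (m + i) * (CARD('n) + 1) - 4 * real (m + i)"
  let ?d = "4 * real (m + j) * (real (m + j) + 1) - 2 * real (m + j) * (CARD('n) + 1) - 4 * real (m + j)"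
  have Ck: "C_k_on 2 (axial_fun G (L b) (m + j) (\<phi> b)) W" if "b \<in> B" for b
    by (rule C_k_on_axial_fun[OF V W roots G L \<phi>[OF that]])
  have "(laplacian ^^ Suc j) (\<lambda>x. \<Sum>b\<in>B. axial_fun G (L b) m (\<phi> b) x) x =
      laplacian (\<lambda>x. ?c *\<^sub>R (\<Sum>b\<in>B. axial_fun G (L b) (m + j) (\<phi> b) x)) x"
    using laplacian_cong[OF W Suc.prems Suc.IH] by simp
  also have "\<dots> = ?c *\<^sub>R laplacian (\<lambda>x. \<Sum>b\<in>B. axial_fun G (L b) (m + j) (\<phi> b) x) x"
    by (rule laplacian_bounded_linear[OF W Suc.prems C_k_on_sum[OF W B Ck] bounded_linear_scaleR_right])
  also have "laplacian (\<lambda>x. \<Sum>b\<in>B. axial_fun G (L b) (m + j) (\<phi> b) x) x =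
      (\<Sum>b\<in>B. laplacian (axial_fun G (L b) (m + j) (\<phi> b)) x)"
    by (rule laplacian_sum[OF W Suc.prems B Ck])
  also have "\<dots> = ?d *\<^sub>R (\<Sum>b\<in>B. axial_fun G (L b) (m + Suc j) (\<phi> b) x)"
    unfolding scaleR_sum_right add_Suc_right
    by (intro sum.cong refl laplacian_axial_fun[OF V W roots G L \<phi> Suc.prems])
  finally show ?case
    by (simp only: scaleR_scaleR prod.lessThan_Suc)
qed simp

lemma dirac_op_cong:
  assumes "open S" "x \<in> S" "\<And>y. y \<in> S \<Longrightarrow> f y = g y"
  shows "dirac_op G f x = dirac_op G g x"
  unfolding dirac_op_def by (simp only: partial_cong[OF assms])

lemma dirac_op_scaleR_sum:
  assumes G: "\<And>i. bounded_linear (G i)" and f: "\<And>b. b \<in> B \<Longrightarrow> f b differentiable (at x)"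
  shows "dirac_op G (\<lambda>x. c *\<^sub>R (\<Sum>b\<in>B. f b x)) x = c *\<^sub>R (\<Sum>b\<in>B. dirac_op G (f b) x)"
proof -
  note lin = bounded_linear.linear[OF G]
  have "partial v (\<lambda>x. c *\<^sub>R (\<Sum>b\<in>B. f b x)) x = c *\<^sub>R (\<Sum>b\<in>B. partial v (f b) x)" for v
    by (rule partial_eq[OF has_derivative_scaleR_right[OF has_derivative_sum[OF has_derivative_partial[OF f]]]])
  then show ?thesis
    by (simp only: dirac_op_def linear_scale[OF lin] linear_sum[OF lin] scaleR_sum_right[symmetric] sum.distrib
        scaleR_add_right sum.swap[of _ B])
qed

text \<open>The l-1 Laplacians contribute 4m(m-h-1) for m = 1, ..., l-1 and the Dirac operator
  contributes 2(l-h-1). Together they are 2^(2l-1) (l-1)! times (-h)(1-h)...(l-1-h), which is the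
  Pochhammer symbol.\<close>

lemma sigma_eq_prod:
  assumes "1 \<le> l" "l \<le> h"
  shows "(\<Prod>i<l - 1. 4 * real (1 + i) * (real (1 + i) + 1) - 2 * real (1 + i) * (real (2 * h + 1) + 1) - 4 * real (1 + i))
    * (2 * real l - 1 - real (2 * h + 1)) = sigma h l"
  using assms
proof (induction l rule: dec_induct)
  case base
  then obtain k where "h = Suc k" by (cases h) auto
  then show ?case by (simp add: sigma_def field_simps)
next
  case (step l)
  obtain j where l: "l = Suc j" using step.hyps by (cases l) auto
  obtain k where h: "h = Suc (l + k)" using step.prems by (auto simp: Suc_le_eq less_iff_Suc_add)
  let ?P = "\<Prod>i<j. 4 * real (1 + i) * (real (1 + i) + 1) - 2 * real (1 + i) * (real (2 * h + 1) + 1) - 4 * real (1 + i)"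
  have IH: "?P * (2 * real l - 1 - real (2 * h + 1)) = sigma h l" using step by (simp add: l)
  have sigma: "sigma h (Suc l) = sigma h l * (- 4 * real l * real (h - l))"
  proof -
    have "2 ^ Suc (Suc (Suc (2 * j))) * fact (Suc j) * ((- 1) ^ Suc (Suc j) * F / fact k) =
        2 ^ Suc (2 * j) * fact j * ((- 1) ^ Suc j * F / fact (Suc k)) * (- 4 * real (Suc j) * real (Suc k))" for F :: real
      by (simp add: field_simps del: of_nat_Suc)
    moreover have "h - l = Suc k" "h - Suc l = k" by (simp_all add: h)
    ultimately show ?thesis by (simp add: sigma_def l)
  qed
  \<comment> \<open>The Laplace factor added in passing from l to l+1 is 2l times the old Dirac
    factor. The induction hypothesis thus absorbs it, and only the new Dirac factor remains.\<close>
  have factor: "4 * real (1 + j) * (real (1 + j) + 1) - 2 * real (1 + j) * (real (2 * h + 1) + 1) - 4 * real (1 + j)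
      = 2 * real l * (2 * real l - 1 - real (2 * h + 1))"
    by (simp add: l algebra_simps)
  have last: "2 * real (Suc l) - 1 - real (2 * h + 1) = - 2 * real (h - l)"
    by (simp add: h)
  have "p * (2 * a * x) * (- 2 * d) = p * x * (- 4 * a * d)" for p a x d :: real by simp
  then have "?P * (2 * real l * (2 * real l - 1 - real (2 * h + 1))) * (- 2 * real (h - l)) = sigma h (Suc l)"
    unfolding sigma IH[symmetric] .
  moreover have "Suc l - 1 = Suc j" by (simp add: l)
  ultimately show ?case by (simp only: last prod.lessThan_Suc factor)
qed

section \<open>Reality of the residues\<close>

text \<open>Off the real axis 2 \<i> |x'| R_1 is the difference of \<phi>(z) and its conjugate,
  hence purely imaginary, so R_1 is real. Points on the axis are limits of such points, and R_1 is
  continuous.\<close>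

lemma Im_qres_1:
  fixes W :: "(real \<times> (real ^ 'n::finite)) set"
  assumes V: "open V" and W: "open W" and roots: "\<And>x. x \<in> W \<Longrightarrow> quad_roots x \<subseteq> V"
    and \<phi>: "\<phi> holomorphic_on V" and cnj: "\<And>s. s \<in> V \<Longrightarrow> \<phi> (cnj s) = cnj (\<phi> s)" and x: "x \<in> W"
  shows "Im (qres 1 \<phi> x) = 0"
proof -
  have off_axis: "Im (qres 1 \<phi> y) = 0" if y: "y \<in> W" "snd y \<noteq> 0" for y
  proof -
    have "axis_root y \<in> V" using roots[OF y(1)] by (simp add: quad_roots_def)
    then have "2 * \<i> * of_real (norm (snd y)) * qres 1 \<phi> y = \<phi> (axis_root y) - cnj (\<phi> (axis_root y))"
      using qres_1(2)[OF V roots[OF y(1)] \<phi>] cnj by simp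
    then have "Re (2 * \<i> * of_real (norm (snd y)) * qres 1 \<phi> y) = 0" by simp
    then show ?thesis using y(2) by simp
  qed
  show ?thesis
  proof (cases "snd x = 0")
    case True
    \<comment> \<open>Any coordinate direction in the vector part leads off the real axis.\<close>
    obtain i :: 'n where True by simp
    let ?y = "\<lambda>t::real. x + t *\<^sub>R (0, axis i 1)"
    have y: "?y \<midarrow>0\<rightarrow> x" by (auto intro!: tendsto_eq_intros simp: zero_prod_def)
    have "isCont (\<lambda>y. Im (qres 1 \<phi> y)) x"
      by (intro isCont_Im differentiable_imp_continuous_within qres_differentiable[OF V W roots \<phi> x])
    then have "(\<lambda>t. Im (qres 1 \<phi> (?y t))) \<midarrow>0\<rightarrow> Im (qres 1 \<phi> x)"
      by (rule isCont_tendsto_compose[OF _ y])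
    moreover have "\<forall>\<^sub>F t in at 0. Im (qres 1 \<phi> (?y t)) = 0"
    proof -
      have "\<forall>\<^sub>F t in at 0. ?y t \<in> W" by (rule topological_tendstoD[OF y W x])
      moreover have "\<forall>\<^sub>F t::real in at 0. t \<noteq> 0" by (simp add: eventually_at_filter)
      ultimately show ?thesis
      proof eventually_elim
        case (elim t)
        show ?case by (rule off_axis) (use elim in \<open>simp_all add: True axis_eq_0_iff\<close>)
      qed
    qed
    then have "(\<lambda>t. Im (qres 1 \<phi> (?y t))) \<midarrow>0\<rightarrow> 0" by (rule tendsto_eventually)
    ultimately show ?thesis using tendsto_unique[of "at (0::real)"] by (metis at_neq_bot)
  qed (rule off_axis[OF x])
qed

text \<open>Reality is inherited from R_1: taking imaginary parts commutes with the Laplacian, and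
  l-1 Laplacians turn R_1 into R_l up to the product of 4m(m-h) over m = 1, ..., l-1. No factor
  vanishes, because m \<le> l-1 < h.\<close>

lemma Im_qres:
  fixes W :: "(real \<times> (real ^ 'n::finite)) set"
  assumes V: "open V" and W: "open W" and roots: "\<And>x. x \<in> W \<Longrightarrow> quad_roots x \<subseteq> V"
    and \<phi>: "\<phi> holomorphic_on V" and cnj: "\<And>s. s \<in> V \<Longrightarrow> \<phi> (cnj s) = cnj (\<phi> s)" and x: "x \<in> W"
    and n: "CARD('n) = 2 * h + 1" and l: "1 \<le> l" "l \<le> h"
  shows "Im (qres l \<phi> x) = 0"
proof -
  let ?k = "\<lambda>i. 4 * real (1 + i) * (real (1 + i) + 1) - 2 * real (1 + i) * DIM(real \<times> (real ^ 'n))"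
  have "(\<Prod>i<l - 1. ?k i) *\<^sub>R Im (qres (1 + (l - 1)) \<phi> x) = (laplacian ^^ (l - 1)) (\<lambda>x. Im (qres 1 \<phi> x)) x"
    by (rule laplacian_funpow_qres[OF V W roots \<phi> bounded_linear_Im x, symmetric])
  \<comment> \<open>The zero function is written as the residue sum of \<phi> = 0, so that the same
    formula evaluates its iterated Laplacian.\<close>
  also have "\<dots> = (laplacian ^^ (l - 1)) (\<lambda>x. Im (qres 1 (\<lambda>s. 0) x)) x"
  proof (rule laplacian_funpow_cong[OF W x])
    show "Im (qres 1 \<phi> y) = Im (qres 1 (\<lambda>s. 0) y)" if "y \<in> W" for y
      using Im_qres_1[OF V W roots \<phi> cnj that] by (simp add: qres_def residue_const)
  qed
  also have "\<dots> = (\<Prod>i<l - 1. ?k i) *\<^sub>R Im (qres (1 + (l - 1)) (\<lambda>s. 0) x)"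
    by (rule laplacian_funpow_qres[OF V W roots holomorphic_on_const bounded_linear_Im x])
  also have "\<dots> = 0" by (simp add: qres_def residue_const)
  finally have "(\<Prod>i<l - 1. ?k i) * Im (qres l \<phi> x) = 0" using l by simp
  moreover have "?k i \<noteq> 0" if "i < l - 1" for i
  proof -
    have "?k i = 4 * real (1 + i) * (real (1 + i) - real h)" by (simp add: n algebra_simps)
    moreover have "real (1 + i) - real h < 0" using that l by linarith
    ultimately show ?thesis by (simp add: less_imp_neq)
  qed
  ultimately show ?thesis by (auto simp: prod_zero_iff)
qed

section \<open>The Fueter-type image\<close>

lemma dirac_laplacian_image:
  fixes W :: "'n::{finite,linorder} point set" and G :: "'n \<Rightarrow> 'n clifford \<Rightarrow> 'n clifford"
  assumes V: "open V" and W: "open W" and roots: "\<And>x. x \<in> W \<Longrightarrow> quad_roots x \<subseteq> V"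
    and G: "\<And>i. bounded_linear (G i)"
    and anti: "\<And>i j y. G i (G j y) + G j (G i y) = (if i = j then - 2 *\<^sub>R y else 0)"
    and \<phi>: "\<And>b. b \<in> B \<Longrightarrow> \<phi> b holomorphic_on V" and B: "finite B"
    and f: "\<And>x. x \<in> W \<Longrightarrow> f x = (\<Sum>b\<in>B. axial_fun G (\<lambda>c. Re c *\<^sub>R b) 1 (\<phi> b) x)"
    and n: "CARD('n) = 2 * h + 1" and l: "1 \<le> l" "l \<le> h" and x: "x \<in> W"
  shows "dirac_op G ((laplacian ^^ (l - 1)) f) x = sigma h l *\<^sub>R (\<Sum>b\<in>B. Re (qres l (\<phi> b) x) *\<^sub>R b)"
proof -
  have L: "bounded_linear (\<lambda>c. Re c *\<^sub>R b)" for b :: "'n clifford"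
    by (intro bounded_linear_intros bounded_linear_Re)
  let ?P = "\<Prod>i<l - 1. 4 * real (1 + i) * (real (1 + i) + 1) - 2 * real (1 + i) * (CARD('n) + 1) - 4 * real (1 + i)"
  have "dirac_op G ((laplacian ^^ (l - 1)) f) x =
      dirac_op G (\<lambda>x. ?P *\<^sub>R (\<Sum>b\<in>B. axial_fun G (\<lambda>c. Re c *\<^sub>R b) l (\<phi> b) x)) x"
  proof (rule dirac_op_cong[OF W x])
    fix y assume y: "y \<in> W"
    have "(laplacian ^^ (l - 1)) f y =
        (laplacian ^^ (l - 1)) (\<lambda>x. \<Sum>b\<in>B. axial_fun G (\<lambda>c. Re c *\<^sub>R b) 1 (\<phi> b) x) y"
      by (rule laplacian_funpow_cong[OF W y f])
    also have "\<dots> = ?P *\<^sub>R (\<Sum>b\<in>B. axial_fun G (\<lambda>c. Re c *\<^sub>R b) (1 + (l - 1)) (\<phi> b) y)"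
      by (rule laplacian_funpow_axial_fun[OF V W roots G L \<phi> B y])
    finally show "(laplacian ^^ (l - 1)) f y = ?P *\<^sub>R (\<Sum>b\<in>B. axial_fun G (\<lambda>c. Re c *\<^sub>R b) l (\<phi> b) y)"
      using l by simp
  qed
  also have "\<dots> = ?P *\<^sub>R (\<Sum>b\<in>B. dirac_op G (axial_fun G (\<lambda>c. Re c *\<^sub>R b) l (\<phi> b)) x)"
    by (rule dirac_op_scaleR_sum[OF G C_k_on_differentiable[OF C_k_on_axial_fun[OF V W roots G L \<phi>] x]])
  also have "(\<Sum>b\<in>B. dirac_op G (axial_fun G (\<lambda>c. Re c *\<^sub>R b) l (\<phi> b)) x) =
      (2 * real l - 1 - CARD('n)) *\<^sub>R (\<Sum>b\<in>B. Re (qres l (\<phi> b) x) *\<^sub>R b)"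
    unfolding scaleR_sum_right
    by (intro sum.cong refl dirac_axial_fun[OF V W roots G L \<phi> x anti])
  finally show ?thesis
    unfolding n scaleR_scaleR using sigma_eq_prod[OF l] by simp
qed

text \<open>After h-l Laplacians the residue sums have order h, and the next factor 4h(h-h) is zero.
  The vector part of the axial form is zero, since residue sums depend on x only through x0 and
  |x'|.\<close>

lemma residue_sum_polyharmonic:
  fixes W :: "'n::{finite,linorder} point set" and g :: "'n point \<Rightarrow> 'n clifford"
  assumes V: "open V" and W: "open W" and roots: "\<And>x. x \<in> W \<Longrightarrow> quad_roots x \<subseteq> V"
    and \<phi>: "\<And>b. b \<in> B \<Longrightarrow> \<phi> b holomorphic_on V" and B: "finite B"
    and g: "\<And>x. x \<in> W \<Longrightarrow> g x = c *\<^sub>R (\<Sum>b\<in>B. Re (qres l (\<phi> b) x) *\<^sub>R b)"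
    and n: "CARD('n) = 2 * h + 1" and l: "l \<le> h"
  shows "C_k_on j g W"
    and "x \<in> W \<Longrightarrow> (laplacian ^^ (h - l + 1)) g x = 0"
    and "\<exists>A. even_odd_pair P A (\<lambda>p. 0 :: 'n clifford) \<and> (\<forall>x\<in>W. g x = A (fst x, norm (snd x)))"
proof -
  have L: "bounded_linear (\<lambda>z. c *\<^sub>R Re z *\<^sub>R b)" for b :: "'n clifford"
    by (intro bounded_linear_intros bounded_linear_Re)
  have g': "g x = (\<Sum>b\<in>B. c *\<^sub>R Re (qres l (\<phi> b) x) *\<^sub>R b)" if "x \<in> W" for x
    using g[OF that] by (simp only: scaleR_sum_right)
  have Ck: "C_k_on j (\<lambda>x. c *\<^sub>R Re (qres l (\<phi> b) x) *\<^sub>R b) W" if "b \<in> B" for b j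
    by (rule C_k_on_bounded_linear[OF W L C_k_on_qres[OF V W roots \<phi>[OF that]]])
  show "C_k_on j g W"
    by (rule C_k_on_cong[OF W _ C_k_on_sum[OF W B Ck]]) (simp_all only: g')
  show "(laplacian ^^ (h - l + 1)) g x = 0" if x: "x \<in> W"
  proof -
    have "(laplacian ^^ k) g y = (\<Sum>b\<in>B. (laplacian ^^ k) (\<lambda>x. c *\<^sub>R Re (qres l (\<phi> b) x) *\<^sub>R b) y)"
      if "y \<in> W" for k y
      using that
    proof (induction k arbitrary: y)
      case (Suc k)
      have Ck': "C_k_on 2 ((laplacian ^^ k) (\<lambda>x. c *\<^sub>R Re (qres l (\<phi> b) x) *\<^sub>R b)) W" if "b \<in> B" for b
      proof (rule C_k_on_cong[OF W])
        let ?k = "\<lambda>i. 4 * real (l + i) * (real (l + i) + 1) - 2 * real (l + i) * DIM('n point)"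
        show "C_k_on 2 (\<lambda>x. (\<Prod>i<k. ?k i) *\<^sub>R c *\<^sub>R Re (qres (l + k) (\<phi> b) x) *\<^sub>R b) W"
          by (rule C_k_on_bounded_linear[OF W bounded_linear_scaleR_right
              C_k_on_bounded_linear[OF W L C_k_on_qres[OF V W roots \<phi>[OF that]]]])
        show "(\<Prod>i<k. ?k i) *\<^sub>R c *\<^sub>R Re (qres (l + k) (\<phi> b) x) *\<^sub>R b =
            (laplacian ^^ k) (\<lambda>x. c *\<^sub>R Re (qres l (\<phi> b) x) *\<^sub>R b) x" if "x \<in> W" for x
          by (rule laplacian_funpow_qres[OF V W roots \<phi>[OF \<open>b \<in> B\<close>] L that, symmetric])
      qed
      have "(laplacian ^^ Suc k) g y =
          laplacian (\<lambda>y. \<Sum>b\<in>B. (laplacian ^^ k) (\<lambda>x. c *\<^sub>R Re (qres l (\<phi> b) x) *\<^sub>R b) y) y"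
        using laplacian_cong[OF W Suc.prems Suc.IH] by simp
      also have "\<dots> = (\<Sum>b\<in>B. laplacian ((laplacian ^^ k) (\<lambda>x. c *\<^sub>R Re (qres l (\<phi> b) x) *\<^sub>R b)) y)"
        by (rule laplacian_sum[OF W Suc.prems B Ck'])
      finally show ?case by simp
    qed (simp add: g')
    note funpow = this
    have zero: "(laplacian ^^ (h - l + 1)) (\<lambda>x. c *\<^sub>R Re (qres l (\<phi> b) x) *\<^sub>R b) x = 0" if b: "b \<in> B" for b
    proof -
      \<comment> \<open>The factor with index h-l belongs to m = h, where 4m(m+1) - 2m(2h+2)
        vanishes.\<close>
      have "(\<Prod>i<h - l + 1. 4 * real (l + i) * (real (l + i) + 1) - 2 * real (l + i) * DIM('n point)) = 0"
        using l by (intro prod_zero bexI[of _ "h - l"]) (simp_all add: n algebra_simps)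
      then show ?thesis by (simp only: laplacian_funpow_qres[OF V W roots \<phi>[OF b] L x] scaleR_zero_left)
    qed
    show ?thesis unfolding funpow[OF x] by (rule sum.neutral) (intro ballI zero)
  qed
  obtain I :: "real ^ 'n::{finite,linorder}" where "I \<in> imag_units"
    using imag_units_nonempty by blast
  then have I: "norm I = 1" by (simp add: imag_units_def)
  \<comment> \<open>All points of an orbit give the same residue sums, so one fixed unit I serves to
    define the scalar part; evenness holds because v I and -v I have the same norm.\<close>
  let ?A = "\<lambda>(u, v). c *\<^sub>R (\<Sum>b\<in>B. Re (qres l (\<phi> b) (u, v *\<^sub>R I)) *\<^sub>R b)"
  have "qres l (\<phi> b) (u, (- v) *\<^sub>R I) = qres l (\<phi> b) (u, v *\<^sub>R I)" for b u v
    by (rule qres_axis_cong) (simp add: axis_root_def)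
  then have "even_odd_pair P ?A (\<lambda>p. 0)" by (auto simp: even_odd_pair_def)
  moreover have "qres l (\<phi> b) (fst x, norm (snd x) *\<^sub>R I) = qres l (\<phi> b) x" for b and x :: "'n point"
    by (rule qres_axis_cong) (simp add: axis_root_def I)
  then have "\<forall>x\<in>W. g x = ?A (fst x, norm (snd x))" using g by simp
  ultimately show "\<exists>A. even_odd_pair P A (\<lambda>p. 0 :: 'n clifford) \<and> (\<forall>x\<in>W. g x = A (fst x, norm (snd x)))"
    by blast
qed

lemma slice_function_axial_fun:
  fixes W :: "'n::{finite,linorder} point set" and G :: "'n \<Rightarrow> 'n clifford \<Rightarrow> 'n clifford"
  assumes W: "open W" "axially_symmetric W" and eo: "even_odd_pair (axial_domain W) \<alpha> \<beta>"
    and CR: "cauchy_riemann_pair (axial_domain W) \<alpha> \<beta>" and G: "\<And>i. bounded_linear (G i)"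
    and f: "\<And>u v I. (u, v) \<in> axial_domain W \<Longrightarrow> I \<in> imag_units \<Longrightarrow>
      f (u, v *\<^sub>R I) = \<alpha> (u, v) + (\<Sum>i\<in>UNIV. (I $ i) *\<^sub>R G i (\<beta> (u, v)))"
    and x: "x \<in> W"
  shows "f x = (\<Sum>b\<in>Basis. axial_fun G (\<lambda>c. Re c *\<^sub>R b) 1 (stem \<alpha> \<beta> b) x)"
proof -
  note lin = bounded_linear.linear[OF G]
  note V = open_axial_plane[OF W]
  note roots = quad_roots_axial_plane[OF W(2) x]
  define r where "r = norm (snd x)"
  let ?z = "axis_root x" and ?p = "(fst x, r)"
  have z: "?z \<in> axial_plane W" using roots by (simp add: quad_roots_def)
  then have p: "?p \<in> axial_domain W" by (simp add: axial_plane_def axis_root_def r_def)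
  \<comment> \<open>On the real axis r = 0 and any unit will do.\<close>
  obtain I where I: "I \<in> imag_units" "snd x = r *\<^sub>R I"
  proof (cases "r = 0")
    case True
    then show thesis using that[OF imag_units_nonempty] by (simp add: r_def)
  next
    case False
    show thesis by (rule that[of "snd x /\<^sub>R r"]) (use False in \<open>simp_all add: imag_units_def r_def\<close>)
  qed
  have term_b: "axial_fun G (\<lambda>c. Re c *\<^sub>R b) 1 (stem \<alpha> \<beta> b) x =
      (\<alpha> ?p \<bullet> b) *\<^sub>R b + (\<Sum>i\<in>UNIV. (I $ i) *\<^sub>R G i ((\<beta> ?p \<bullet> b) *\<^sub>R b))" for b
  proof -
    let ?q = "qres 1 (stem \<alpha> \<beta> b) x"
    note q = qres_1[OF V roots stem_holomorphic[OF V CR, of b], unfolded stem_cnj[OF eo z]]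
    have st: "stem \<alpha> \<beta> b ?z = Complex (\<alpha> ?p \<bullet> b) (\<beta> ?p \<bullet> b)"
      by (simp add: stem_def axis_root_def r_def)
    have re: "Re (qres 1 (\<lambda>s. s * stem \<alpha> \<beta> b s) x - fst x *\<^sub>R ?q) = \<alpha> ?p \<bullet> b"
      unfolding q(1) st by simp
    have "Im (2 * \<i> * of_real r * ?q) = Im (stem \<alpha> \<beta> b ?z - cnj (stem \<alpha> \<beta> b ?z))"
      unfolding r_def q(2) ..
    \<comment> \<open>Kept undivided by r: on the real axis the identity says that the b-component
      of \<beta> vanishes, in accordance with oddness.\<close>
    then have im: "r * Re ?q = \<beta> ?p \<bullet> b" by (simp add: st)
    have "Re ((snd x $ i) *\<^sub>R ?q) = (I $ i) * (\<beta> ?p \<bullet> b)" for i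
      unfolding I(2) im[symmetric] by simp
    then show ?thesis
      unfolding axial_fun_def re by (simp only: linear_scale[OF lin] scaleR_scaleR)
  qed
  have "f x = \<alpha> ?p + (\<Sum>i\<in>UNIV. (I $ i) *\<^sub>R G i (\<beta> ?p))"
    using f[OF p I(1)] I(2) by (metis prod.collapse)
  also have "\<alpha> ?p = (\<Sum>b\<in>Basis. (\<alpha> ?p \<bullet> b) *\<^sub>R b)" by (simp add: euclidean_representation)
  also have "(\<Sum>i\<in>UNIV. (I $ i) *\<^sub>R G i (\<beta> ?p)) =
      (\<Sum>b\<in>Basis. \<Sum>i\<in>UNIV. (I $ i) *\<^sub>R G i ((\<beta> ?p \<bullet> b) *\<^sub>R b))"
  proof -
    have "G i (\<beta> ?p) = (\<Sum>b\<in>Basis. G i ((\<beta> ?p \<bullet> b) *\<^sub>R b))" for i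
      unfolding linear_sum[OF lin, symmetric] euclidean_representation ..
    then show ?thesis by (subst sum.swap) (simp only: scaleR_sum_right)
  qed
  finally show ?thesis unfolding term_b sum.distrib .
qed

section \<open>The integral formulas\<close>

text \<open>By \<open>J_real\<close> the map \<open>J b\<close> sends a real number r to r b, with
  no trace of the slice. Reality of the residue sums is therefore what removes the imaginary unit
  from the value of the integral.\<close>

lemma residue_sum_eq_integral:
  fixes J :: "'e \<Rightarrow> complex \<Rightarrow> 'e::euclidean_space"
  assumes bd: "positively_oriented_boundary S \<Gamma>" and S: "open S" "closure S \<subseteq> V" and V: "open V"
    and \<phi>: "\<And>b. b \<in> B \<Longrightarrow> \<phi> b holomorphic_on V" and x: "quad_roots x \<subseteq> S"
    and B: "finite B" and J: "\<And>b. bounded_linear (J b)"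
    and F: "\<And>\<gamma> t. \<gamma> \<in> \<Gamma> \<Longrightarrow> t \<in> {0..1} \<Longrightarrow> F \<gamma> t = c *\<^sub>R (\<Sum>b\<in>B. J b
      (- \<i> * (\<phi> b (\<gamma> t) / quad x (\<gamma> t) ^ l * vector_derivative \<gamma> (at t within {0..1}))))"
    and J_real: "\<And>b r. J b (of_real r) = r *\<^sub>R b" and real: "\<And>b. b \<in> B \<Longrightarrow> Im (qres l (\<phi> b) x) = 0"
  shows "c *\<^sub>R (\<Sum>b\<in>B. Re (qres l (\<phi> b) x) *\<^sub>R b) = (1 / (2 * pi)) *\<^sub>R (\<Sum>\<gamma>\<in>\<Gamma>. integral {0..1} (F \<gamma>))"
proof -
  have "(\<Sum>b\<in>B. J b (qres l (\<phi> b) x)) = (\<Sum>b\<in>B. Re (qres l (\<phi> b) x) *\<^sub>R b)"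
  proof (rule sum.cong[OF refl])
    fix b assume "b \<in> B"
    then have "qres l (\<phi> b) x = of_real (Re (qres l (\<phi> b) x))" by (simp add: complex_eq_iff real)
    then show "J b (qres l (\<phi> b) x) = Re (qres l (\<phi> b) x) *\<^sub>R b" using J_real by metis
  qed
  moreover have "(\<Sum>\<gamma>\<in>\<Gamma>. integral {0..1} (F \<gamma>)) = (2 * pi) *\<^sub>R c *\<^sub>R (\<Sum>b\<in>B. J b (qres l (\<phi> b) x))"
    by (rule slice_integral(2)[OF bd S V \<phi> x B J F])
  ultimately show ?thesis by simp
qed

lemma sum_slice_embed_stem:
  shows "(\<Sum>b\<in>Basis. slice_embed I (stem \<alpha> \<beta> b s) * b) = \<alpha> (Re s, Im s) + clifford_vector I * \<beta> (Re s, Im s)"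
    and "(\<Sum>b\<in>Basis. b * slice_embed I (stem \<alpha> \<beta> b s)) = \<alpha> (Re s, Im s) + \<beta> (Re s, Im s) * clifford_vector I"
proof -
  have "(\<Sum>b\<in>Basis. slice_embed I (stem \<alpha> \<beta> b s) * b) = (\<Sum>b\<in>Basis. (\<alpha> (Re s, Im s) \<bullet> b) *\<^sub>R b)
      + clifford_vector I * (\<Sum>b\<in>Basis. (\<beta> (Re s, Im s) \<bullet> b) *\<^sub>R b)"
    by (simp add: slice_embed_def stem_def distrib_right sum.distrib sum_distrib_left)
  then show "(\<Sum>b\<in>Basis. slice_embed I (stem \<alpha> \<beta> b s) * b) = \<alpha> (Re s, Im s) + clifford_vector I * \<beta> (Re s, Im s)"
    by (simp only: euclidean_representation)
  have "(\<Sum>b\<in>Basis. b * slice_embed I (stem \<alpha> \<beta> b s)) = (\<Sum>b\<in>Basis. (\<alpha> (Re s, Im s) \<bullet> b) *\<^sub>R b)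
      + (\<Sum>b\<in>Basis. (\<beta> (Re s, Im s) \<bullet> b) *\<^sub>R b) * clifford_vector I"
    by (simp add: slice_embed_def stem_def distrib_left sum.distrib sum_distrib_right)
  then show "(\<Sum>b\<in>Basis. b * slice_embed I (stem \<alpha> \<beta> b s)) = \<alpha> (Re s, Im s) + \<beta> (Re s, Im s) * clifford_vector I"
    by (simp only: euclidean_representation)
qed

lemma left_stem_decomposition:
  fixes W :: "'n::{finite,linorder} point set"
  assumes "left_slice_hyperholomorphic f W"
  obtains \<phi> where "\<And>b. \<phi> b holomorphic_on axial_plane W"
    "\<And>b s. s \<in> axial_plane W \<Longrightarrow> \<phi> b (cnj s) = cnj (\<phi> b s)"
    "\<And>x. x \<in> W \<Longrightarrow> f x = (\<Sum>b\<in>Basis. axial_fun (\<lambda>i y. gen i * y) (\<lambda>c. Re c *\<^sub>R b) 1 (\<phi> b) x)"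
    "\<And>s I. s \<in> axial_plane W \<Longrightarrow> I \<in> imag_units \<Longrightarrow>
      f (slice_point I s) = (\<Sum>b\<in>Basis. slice_embed I (\<phi> b s) * b)"
proof -
  from assms obtain \<alpha> \<beta> where W: "open W" "axially_symmetric W"
    and eo: "even_odd_pair (axial_domain W) \<alpha> \<beta>" and CR: "cauchy_riemann_pair (axial_domain W) \<alpha> \<beta>"
    and f: "\<And>u v I. (u, v) \<in> axial_domain W \<Longrightarrow> I \<in> imag_units \<Longrightarrow>
      f (u, v *\<^sub>R I) = \<alpha> (u, v) + clifford_vector I * \<beta> (u, v)"
    unfolding left_slice_hyperholomorphic_def by blast
  show thesis
  proof (rule that[of "stem \<alpha> \<beta>"])
    show "stem \<alpha> \<beta> b holomorphic_on axial_plane W" for b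
      by (rule stem_holomorphic[OF open_axial_plane[OF W] CR])
    show "stem \<alpha> \<beta> b (cnj s) = cnj (stem \<alpha> \<beta> b s)" if "s \<in> axial_plane W" for b s
      by (rule stem_cnj[OF eo that])
    show "f x = (\<Sum>b\<in>Basis. axial_fun (\<lambda>i y. gen i * y) (\<lambda>c. Re c *\<^sub>R b) 1 (stem \<alpha> \<beta> b) x)" if "x \<in> W" for x
      by (rule slice_function_axial_fun[OF W eo CR bounded_linear_clifford_mult(1) _ that])
        (simp add: f clifford_vector_def sum_distrib_right)
    show "f (slice_point I s) = (\<Sum>b\<in>Basis. slice_embed I (stem \<alpha> \<beta> b s) * b)"
      if "s \<in> axial_plane W" "I \<in> imag_units" for s I
      using that by (simp add: sum_slice_embed_stem slice_point_def axial_plane_def f)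
  qed
qed

lemma right_stem_decomposition:
  fixes W :: "'n::{finite,linorder} point set"
  assumes "right_slice_hyperholomorphic f W"
  obtains \<phi> where "\<And>b. \<phi> b holomorphic_on axial_plane W"
    "\<And>b s. s \<in> axial_plane W \<Longrightarrow> \<phi> b (cnj s) = cnj (\<phi> b s)"
    "\<And>x. x \<in> W \<Longrightarrow> f x = (\<Sum>b\<in>Basis. axial_fun (\<lambda>i y. y * gen i) (\<lambda>c. Re c *\<^sub>R b) 1 (\<phi> b) x)"
    "\<And>s I. s \<in> axial_plane W \<Longrightarrow> I \<in> imag_units \<Longrightarrow>
      f (slice_point I s) = (\<Sum>b\<in>Basis. b * slice_embed I (\<phi> b s))"
proof -
  from assms obtain \<alpha> \<beta> where W: "open W" "axially_symmetric W"
    and eo: "even_odd_pair (axial_domain W) \<alpha> \<beta>" and CR: "cauchy_riemann_pair (axial_domain W) \<alpha> \<beta>"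
    and f: "\<And>u v I. (u, v) \<in> axial_domain W \<Longrightarrow> I \<in> imag_units \<Longrightarrow>
      f (u, v *\<^sub>R I) = \<alpha> (u, v) + \<beta> (u, v) * clifford_vector I"
    unfolding right_slice_hyperholomorphic_def by blast
  show thesis
  proof (rule that[of "stem \<alpha> \<beta>"])
    show "stem \<alpha> \<beta> b holomorphic_on axial_plane W" for b
      by (rule stem_holomorphic[OF open_axial_plane[OF W] CR])
    show "stem \<alpha> \<beta> b (cnj s) = cnj (stem \<alpha> \<beta> b s)" if "s \<in> axial_plane W" for b s
      by (rule stem_cnj[OF eo that])
    show "f x = (\<Sum>b\<in>Basis. axial_fun (\<lambda>i y. y * gen i) (\<lambda>c. Re c *\<^sub>R b) 1 (stem \<alpha> \<beta> b) x)" if "x \<in> W" for x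
      by (rule slice_function_axial_fun[OF W eo CR bounded_linear_clifford_mult(2) _ that])
        (simp add: f clifford_vector_def sum_distrib_left)
    show "f (slice_point I s) = (\<Sum>b\<in>Basis. b * slice_embed I (stem \<alpha> \<beta> b s))"
      if "s \<in> axial_plane W" "I \<in> imag_units" for s I
      using that by (simp add: sum_slice_embed_stem slice_point_def axial_plane_def f)
  qed
qed

lemma slice_domain:
  assumes W: "axially_symmetric W" and U: "open U" "axially_symmetric U" "closure U \<subseteq> W" and I: "I \<in> imag_units"
  shows "open (slice I U)" "closure (slice I U) \<subseteq> axial_plane W" "x \<in> U \<Longrightarrow> quad_roots x \<subseteq> slice I U"
proof -
  show "open (slice I U)" using open_axial_plane[OF U(1,2)] by (simp add: slice_eq_axial_plane[OF U(2) I])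
  have "slice I (closure U) \<subseteq> slice I W" using U(3) by (auto simp: slice_def)
  then show "closure (slice I U) \<subseteq> axial_plane W"
    using closure_slice_subset[OF I, of U] slice_eq_axial_plane[OF W I] by blast
  show "quad_roots x \<subseteq> slice I U" if "x \<in> U"
    using quad_roots_axial_plane[OF U(2) that] by (simp add: slice_eq_axial_plane[OF U(2) I])
qed

lemma dirac_eq_dirac_op:
  "dirac_left = dirac_op (\<lambda>i y. gen i * y)" "dirac_right = dirac_op (\<lambda>i y. y * gen i)"
  by (simp_all add: fun_eq_iff dirac_left_def dirac_right_def dirac_op_def)

lemma left_formula:
  fixes W :: "'n::{finite,linorder} point set"
  assumes f: "left_slice_hyperholomorphic f W" and n: "CARD('n) = 2 * h + 1" and l: "1 \<le> l" "l \<le> h"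
  shows "left_axially_polyharmonic (h - l + 1) (dirac_left ((laplacian ^^ (l - 1)) f)) W"
    and "open U \<Longrightarrow> axially_symmetric U \<Longrightarrow> closure U \<subseteq> W \<Longrightarrow> I \<in> imag_units \<Longrightarrow>
      positively_oriented_boundary (slice I U) \<Gamma> \<Longrightarrow> x \<in> U \<Longrightarrow>
      (\<forall>\<gamma>\<in>\<Gamma>. left_integrand l I f x \<gamma> integrable_on {0..1}) \<and>
      dirac_left ((laplacian ^^ (l - 1)) f) x = (1 / (2 * pi)) *\<^sub>R left_integral l I \<Gamma> f x"
proof -
  let ?V = "axial_plane W"
  have W: "open W" "axially_symmetric W" using f by (auto simp: left_slice_hyperholomorphic_def)
  note V = open_axial_plane[OF W] and roots = quad_roots_axial_plane[OF W(2)]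
  obtain \<phi> where hol: "\<And>b. \<phi> b holomorphic_on ?V"
    and cnj: "\<And>b s. s \<in> ?V \<Longrightarrow> \<phi> b (cnj s) = cnj (\<phi> b s)"
    and fx: "\<And>x. x \<in> W \<Longrightarrow> f x = (\<Sum>b\<in>Basis. axial_fun (\<lambda>i y. gen i * y) (\<lambda>c. Re c *\<^sub>R b) 1 (\<phi> b) x)"
    and fs: "\<And>s I. s \<in> ?V \<Longrightarrow> I \<in> imag_units \<Longrightarrow> f (slice_point I s) = (\<Sum>b\<in>Basis. slice_embed I (\<phi> b s) * b)"
    by (rule left_stem_decomposition[OF f]) (rule that)
  have image: "dirac_left ((laplacian ^^ (l - 1)) f) x = sigma h l *\<^sub>R (\<Sum>b\<in>Basis. Re (qres l (\<phi> b) x) *\<^sub>R b)"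
    if "x \<in> W" for x
    unfolding dirac_eq_dirac_op
    by (rule dirac_laplacian_image[OF V W(1) roots bounded_linear_clifford_mult(1) gen_mult_anticommute(1)
          hol finite_Basis fx n l that])
  note poly = residue_sum_polyharmonic[OF V W(1) roots hol finite_Basis image n l(2)]
  obtain A where A: "even_odd_pair (axial_domain W) A (\<lambda>p. 0 :: 'n clifford)"
    "\<forall>x\<in>W. dirac_left ((laplacian ^^ (l - 1)) f) x = A (fst x, norm (snd x))"
    using poly(3)[of "axial_domain W"] by blast
  then show "left_axially_polyharmonic (h - l + 1) (dirac_left ((laplacian ^^ (l - 1)) f)) W"
    unfolding left_axially_polyharmonic_def
    by (intro conjI exI[of _ A] exI[of _ "\<lambda>p. 0"] W poly(1) ballI poly(2)) simp_all
  assume U: "open U" "axially_symmetric U" "closure U \<subseteq> W" and I: "I \<in> imag_units"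
    and bd: "positively_oriented_boundary (slice I U) \<Gamma>" and x: "x \<in> U"
  note S = slice_domain[OF W(2) U I]
  have xW: "x \<in> W" using U(3) x closure_subset by blast
  have J: "bounded_linear (\<lambda>c. slice_embed I c * b)" for b
    by (rule bounded_linear_compose[OF bounded_linear_clifford_mult(2) bounded_linear_slice_embed])
  \<comment> \<open>Kernel, density and stem function all take values in the commutative slice and
    merge into one complex number; only the blade b stays outside, on the right.\<close>
  have F: "left_integrand l I f x \<gamma> t = sigma h l *\<^sub>R (\<Sum>b\<in>Basis. slice_embed I
      (- \<i> * (\<phi> b (\<gamma> t) / quad x (\<gamma> t) ^ l * vector_derivative \<gamma> (at t within {0..1}))) * b)"
    if "\<gamma> \<in> \<Gamma>" "t \<in> {0..1}" for \<gamma> t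
  proof -
    let ?d = "vector_derivative \<gamma> (at t within {0..1})"
    have arg: "1 / q * (- \<i> * d) * p = - \<i> * (p / q * d)" for p q d :: complex
      by (simp add: divide_inverse mult_ac)
    have \<gamma>: "\<gamma> t \<in> ?V" "quad x (\<gamma> t) \<noteq> 0"
      using boundary_integral(2)[OF bd S(1,2) V hol S(3)[OF x] that] by (auto simp: quad_eq_0_iff)
    have "left_integrand l I f x \<gamma> t = (sigma h l *\<^sub>R slice_embed I (1 / quad x (\<gamma> t) ^ l)) *
        slice_embed I (- \<i> * ?d) * (\<Sum>b\<in>Basis. slice_embed I (\<phi> b (\<gamma> t)) * b)"
      by (simp add: left_integrand_def kernel_H_slice_point[OF I \<gamma>(2)] ds_slice_embed[OF I] fs[OF \<gamma>(1) I] n)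
    also have "\<dots> = sigma h l *\<^sub>R (\<Sum>b\<in>Basis. slice_embed I (1 / quad x (\<gamma> t) ^ l * (- \<i> * ?d) * \<phi> b (\<gamma> t)) * b)"
      by (simp only: slice_embed_mult[OF I] sum_distrib_left mult.assoc mult_scaleR_left scaleR_sum_right)
    finally show ?thesis unfolding arg .
  qed
  have "left_integrand l I f x \<gamma> integrable_on {0..1}" if "\<gamma> \<in> \<Gamma>" for \<gamma>
    by (rule slice_integral(1)[OF bd S(1,2) V hol S(3)[OF x] finite_Basis J F that])
  moreover have "dirac_left ((laplacian ^^ (l - 1)) f) x = (1 / (2 * pi)) *\<^sub>R left_integral l I \<Gamma> f x"
    unfolding image[OF xW] left_integral_def
    by (rule residue_sum_eq_integral[OF bd S(1,2) V hol S(3)[OF x] finite_Basis J F])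
      (simp_all add: Im_qres[OF V W(1) roots hol cnj xW n l])
  ultimately show "(\<forall>\<gamma>\<in>\<Gamma>. left_integrand l I f x \<gamma> integrable_on {0..1}) \<and>
      dirac_left ((laplacian ^^ (l - 1)) f) x = (1 / (2 * pi)) *\<^sub>R left_integral l I \<Gamma> f x"
    by blast
qed

lemma right_formula:
  fixes W :: "'n::{finite,linorder} point set"
  assumes f: "right_slice_hyperholomorphic f W" and n: "CARD('n) = 2 * h + 1" and l: "1 \<le> l" "l \<le> h"
  shows "right_axially_polyharmonic (h - l + 1) (dirac_right ((laplacian ^^ (l - 1)) f)) W"
    and "open U \<Longrightarrow> axially_symmetric U \<Longrightarrow> closure U \<subseteq> W \<Longrightarrow> I \<in> imag_units \<Longrightarrow>
      positively_oriented_boundary (slice I U) \<Gamma> \<Longrightarrow> x \<in> U \<Longrightarrow>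
      (\<forall>\<gamma>\<in>\<Gamma>. right_integrand l I f x \<gamma> integrable_on {0..1}) \<and>
      dirac_right ((laplacian ^^ (l - 1)) f) x = (1 / (2 * pi)) *\<^sub>R right_integral l I \<Gamma> f x"
proof -
  let ?V = "axial_plane W"
  have W: "open W" "axially_symmetric W" using f by (auto simp: right_slice_hyperholomorphic_def)
  note V = open_axial_plane[OF W] and roots = quad_roots_axial_plane[OF W(2)]
  obtain \<phi> where hol: "\<And>b. \<phi> b holomorphic_on ?V"
    and cnj: "\<And>b s. s \<in> ?V \<Longrightarrow> \<phi> b (cnj s) = cnj (\<phi> b s)"
    and fx: "\<And>x. x \<in> W \<Longrightarrow> f x = (\<Sum>b\<in>Basis. axial_fun (\<lambda>i y. y * gen i) (\<lambda>c. Re c *\<^sub>R b) 1 (\<phi> b) x)"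
    and fs: "\<And>s I. s \<in> ?V \<Longrightarrow> I \<in> imag_units \<Longrightarrow> f (slice_point I s) = (\<Sum>b\<in>Basis. b * slice_embed I (\<phi> b s))"
    by (rule right_stem_decomposition[OF f]) (rule that)
  have image: "dirac_right ((laplacian ^^ (l - 1)) f) x = sigma h l *\<^sub>R (\<Sum>b\<in>Basis. Re (qres l (\<phi> b) x) *\<^sub>R b)"
    if "x \<in> W" for x
    unfolding dirac_eq_dirac_op
    by (rule dirac_laplacian_image[OF V W(1) roots bounded_linear_clifford_mult(2) gen_mult_anticommute(2)
          hol finite_Basis fx n l that])
  note poly = residue_sum_polyharmonic[OF V W(1) roots hol finite_Basis image n l(2)]
  obtain A where A: "even_odd_pair (axial_domain W) A (\<lambda>p. 0 :: 'n clifford)"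
    "\<forall>x\<in>W. dirac_right ((laplacian ^^ (l - 1)) f) x = A (fst x, norm (snd x))"
    using poly(3)[of "axial_domain W"] by blast
  then show "right_axially_polyharmonic (h - l + 1) (dirac_right ((laplacian ^^ (l - 1)) f)) W"
    unfolding right_axially_polyharmonic_def
    by (intro conjI exI[of _ A] exI[of _ "\<lambda>p. 0"] W poly(1) ballI poly(2)) simp_all
  assume U: "open U" "axially_symmetric U" "closure U \<subseteq> W" and I: "I \<in> imag_units"
    and bd: "positively_oriented_boundary (slice I U) \<Gamma>" and x: "x \<in> U"
  note S = slice_domain[OF W(2) U I]
  have xW: "x \<in> W" using U(3) x closure_subset by blast
  have J: "bounded_linear (\<lambda>c. b * slice_embed I c)" for b
    by (rule bounded_linear_compose[OF bounded_linear_clifford_mult(1) bounded_linear_slice_embed])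
  \<comment> \<open>Mirror image of the left case: the slice-valued factors merge and the blade
    stays on the left.\<close>
  have F: "right_integrand l I f x \<gamma> t = sigma h l *\<^sub>R (\<Sum>b\<in>Basis. b * slice_embed I
      (- \<i> * (\<phi> b (\<gamma> t) / quad x (\<gamma> t) ^ l * vector_derivative \<gamma> (at t within {0..1}))))"
    if "\<gamma> \<in> \<Gamma>" "t \<in> {0..1}" for \<gamma> t
  proof -
    let ?d = "vector_derivative \<gamma> (at t within {0..1})"
    have arg: "p * (- \<i> * d) * (1 / q) = - \<i> * (p / q * d)" for p q d :: complex
      by (simp add: divide_inverse mult_ac)
    have \<gamma>: "\<gamma> t \<in> ?V" "quad x (\<gamma> t) \<noteq> 0"
      using boundary_integral(2)[OF bd S(1,2) V hol S(3)[OF x] that] by (auto simp: quad_eq_0_iff)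
    have "right_integrand l I f x \<gamma> t = (\<Sum>b\<in>Basis. b * slice_embed I (\<phi> b (\<gamma> t))) *
        slice_embed I (- \<i> * ?d) * (sigma h l *\<^sub>R slice_embed I (1 / quad x (\<gamma> t) ^ l))"
      by (simp add: right_integrand_def kernel_H_slice_point[OF I \<gamma>(2)] ds_slice_embed[OF I] fs[OF \<gamma>(1) I] n)
    also have "\<dots> = sigma h l *\<^sub>R (\<Sum>b\<in>Basis. b * slice_embed I (\<phi> b (\<gamma> t) * (- \<i> * ?d) * (1 / quad x (\<gamma> t) ^ l)))"
      by (simp only: slice_embed_mult[OF I] sum_distrib_right mult.assoc mult_scaleR_right scaleR_sum_right)
    finally show ?thesis unfolding arg .
  qed
  have "right_integrand l I f x \<gamma> integrable_on {0..1}" if "\<gamma> \<in> \<Gamma>" for \<gamma>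
    by (rule slice_integral(1)[OF bd S(1,2) V hol S(3)[OF x] finite_Basis J F that])
  moreover have "dirac_right ((laplacian ^^ (l - 1)) f) x = (1 / (2 * pi)) *\<^sub>R right_integral l I \<Gamma> f x"
    unfolding image[OF xW] right_integral_def
    by (rule residue_sum_eq_integral[OF bd S(1,2) V hol S(3)[OF x] finite_Basis J F])
      (simp_all add: Im_qres[OF V W(1) roots hol cnj xW n l])
  ultimately show "(\<forall>\<gamma>\<in>\<Gamma>. right_integrand l I f x \<gamma> integrable_on {0..1}) \<and>
      dirac_right ((laplacian ^^ (l - 1)) f) x = (1 / (2 * pi)) *\<^sub>R right_integral l I \<Gamma> f x"
    by blast
qed

text \<open>The independence claims follow from the representation itself. Up to 1/(2 \<pi>) each
  integral is the value of D \<Delta>^(l-1) f at x, in which neither the domain, the unit nor the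
  curves occur; and two functions with the same image have the same value there.\<close>

theorem theorem4p33:
  fixes U :: "'n::{finite,linorder} point set" and l h :: nat
  assumes "odd CARD('n)" and "h = (CARD('n) - 1) div 2" and "1 \<le> l" and "l \<le> h"
    and "bounded_slice_cauchy_domain U"
  shows "(\<forall>f W. left_slice_hyperholomorphic f W \<and> closure U \<subseteq> W \<longrightarrow>
       left_axially_polyharmonic (h - l + 1) (dirac_left ((laplacian ^^ (l - 1)) f)) W \<and>
       (\<forall>I\<in>imag_units. \<forall>\<Gamma>. positively_oriented_boundary (slice I U) \<Gamma> \<longrightarrow>
         (\<forall>x\<in>U. (\<forall>\<gamma>\<in>\<Gamma>. left_integrand l I f x \<gamma> integrable_on {0..1}) \<and>
            dirac_left ((laplacian ^^ (l - 1)) f) x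
              = (1 / (2 * pi)) *\<^sub>R left_integral l I \<Gamma> f x)) \<and>
       (\<forall>U' I I' \<Gamma> \<Gamma>' x.
         bounded_slice_cauchy_domain U' \<and> closure U' \<subseteq> W \<and>
         I \<in> imag_units \<and> I' \<in> imag_units \<and>
         positively_oriented_boundary (slice I U) \<Gamma> \<and>
         positively_oriented_boundary (slice I' U') \<Gamma>' \<and> x \<in> U \<inter> U' \<longrightarrow>
         left_integral l I \<Gamma> f x = left_integral l I' \<Gamma>' f x) \<and>
       (\<forall>g W' I \<Gamma> x.
         left_slice_hyperholomorphic g W' \<and> closure U \<subseteq> W' \<and>
         (\<forall>y\<in>U. dirac_left ((laplacian ^^ (l - 1)) g) y = dirac_left ((laplacian ^^ (l - 1)) f) y) \<and>
         I \<in> imag_units \<and> positively_oriented_boundary (slice I U) \<Gamma> \<and> x \<in> U \<longrightarrow>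
         left_integral l I \<Gamma> g x = left_integral l I \<Gamma> f x)) \<and>
     (\<forall>f W. right_slice_hyperholomorphic f W \<and> closure U \<subseteq> W \<longrightarrow>
       right_axially_polyharmonic (h - l + 1) (dirac_right ((laplacian ^^ (l - 1)) f)) W \<and>
       (\<forall>I\<in>imag_units. \<forall>\<Gamma>. positively_oriented_boundary (slice I U) \<Gamma> \<longrightarrow>
         (\<forall>x\<in>U. (\<forall>\<gamma>\<in>\<Gamma>. right_integrand l I f x \<gamma> integrable_on {0..1}) \<and>
            dirac_right ((laplacian ^^ (l - 1)) f) x
              = (1 / (2 * pi)) *\<^sub>R right_integral l I \<Gamma> f x)) \<and>
       (\<forall>U' I I' \<Gamma> \<Gamma>' x.
         bounded_slice_cauchy_domain U' \<and> closure U' \<subseteq> W \<and>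
         I \<in> imag_units \<and> I' \<in> imag_units \<and>
         positively_oriented_boundary (slice I U) \<Gamma> \<and>
         positively_oriented_boundary (slice I' U') \<Gamma>' \<and> x \<in> U \<inter> U' \<longrightarrow>
         right_integral l I \<Gamma> f x = right_integral l I' \<Gamma>' f x) \<and>
       (\<forall>g W' I \<Gamma> x.
         right_slice_hyperholomorphic g W' \<and> closure U \<subseteq> W' \<and>
         (\<forall>y\<in>U. dirac_right ((laplacian ^^ (l - 1)) g) y = dirac_right ((laplacian ^^ (l - 1)) f) y) \<and>
         I \<in> imag_units \<and> positively_oriented_boundary (slice I U) \<Gamma> \<and> x \<in> U \<longrightarrow>
         right_integral l I \<Gamma> g x = right_integral l I \<Gamma> f x))"
proof -
  have n: "CARD('n) = 2 * h + 1" using assms(1,2) by (auto elim: oddE)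
  have dom: "open X" "axially_symmetric X" if "bounded_slice_cauchy_domain X" for X :: "'n point set"
    using that by (auto simp: bounded_slice_cauchy_domain_def)
  have left: "(1 / (2 * pi)) *\<^sub>R left_integral l I \<Gamma> f x = dirac_left ((laplacian ^^ (l - 1)) f) x"
    if "left_slice_hyperholomorphic f W" "bounded_slice_cauchy_domain X" "closure X \<subseteq> W" "I \<in> imag_units"
      "positively_oriented_boundary (slice I X) \<Gamma>" "x \<in> X" for f :: "'n point \<Rightarrow> 'n clifford" and W X I \<Gamma> x
    by (rule left_formula(2)[OF that(1) n assms(3,4) dom[OF that(2)] that(3-6), THEN conjunct2, symmetric])
  have right: "(1 / (2 * pi)) *\<^sub>R right_integral l I \<Gamma> f x = dirac_right ((laplacian ^^ (l - 1)) f) x"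
    if "right_slice_hyperholomorphic f W" "bounded_slice_cauchy_domain X" "closure X \<subseteq> W" "I \<in> imag_units"
      "positively_oriented_boundary (slice I X) \<Gamma>" "x \<in> X" for f :: "'n point \<Rightarrow> 'n clifford" and W X I \<Gamma> x
    by (rule right_formula(2)[OF that(1) n assms(3,4) dom[OF that(2)] that(3-6), THEN conjunct2, symmetric])
  have cancel: "a = b" if "(1 / (2 * pi)) *\<^sub>R a = (1 / (2 * pi)) *\<^sub>R b" for a b :: "'n clifford"
    using that by simp
  show ?thesis
  proof (intro conjI allI impI; elim conjE; (intro ballI allI impI)?; (elim conjE)?)
    fix f W assume fW: "left_slice_hyperholomorphic f W" "closure U \<subseteq> W"
    show "left_axially_polyharmonic (h - l + 1) (dirac_left ((laplacian ^^ (l - 1)) f)) W"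
      by (rule left_formula(1)[OF fW(1) n assms(3,4)])
    show "(\<forall>\<gamma>\<in>\<Gamma>. left_integrand l I f x \<gamma> integrable_on {0..1}) \<and>
        dirac_left ((laplacian ^^ (l - 1)) f) x = (1 / (2 * pi)) *\<^sub>R left_integral l I \<Gamma> f x"
      if "I \<in> imag_units" "positively_oriented_boundary (slice I U) \<Gamma>" "x \<in> U" for I \<Gamma> x
      by (rule left_formula(2)[OF fW(1) n assms(3,4) dom[OF assms(5)] fW(2) that])
    show "left_integral l I \<Gamma> f x = left_integral l I' \<Gamma>' f x"
      if "bounded_slice_cauchy_domain U'" "closure U' \<subseteq> W" "I \<in> imag_units" "I' \<in> imag_units"
        "positively_oriented_boundary (slice I U) \<Gamma>" "positively_oriented_boundary (slice I' U') \<Gamma>'"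
        "x \<in> U \<inter> U'" for U' I I' \<Gamma> \<Gamma>' x
    proof (rule cancel)
      have x: "x \<in> U" "x \<in> U'" using that(7) by auto
      show "(1 / (2 * pi)) *\<^sub>R left_integral l I \<Gamma> f x = (1 / (2 * pi)) *\<^sub>R left_integral l I' \<Gamma>' f x"
        unfolding left[OF fW(1) assms(5) fW(2) that(3,5) x(1)] left[OF fW(1) that(1,2,4,6) x(2)] ..
    qed
    show "left_integral l I \<Gamma> g x = left_integral l I \<Gamma> f x"
      if "left_slice_hyperholomorphic g W'" "closure U \<subseteq> W'"
        "\<forall>y\<in>U. dirac_left ((laplacian ^^ (l - 1)) g) y = dirac_left ((laplacian ^^ (l - 1)) f) y"
        "I \<in> imag_units" "positively_oriented_boundary (slice I U) \<Gamma>" "x \<in> U" for g W' I \<Gamma> x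
    proof (rule cancel)
      show "(1 / (2 * pi)) *\<^sub>R left_integral l I \<Gamma> g x = (1 / (2 * pi)) *\<^sub>R left_integral l I \<Gamma> f x"
        unfolding left[OF fW(1) assms(5) fW(2) that(4,5,6)] left[OF that(1) assms(5) that(2,4,5,6)]
        using that(3,6) by blast
    qed
  next
    fix f W assume fW: "right_slice_hyperholomorphic f W" "closure U \<subseteq> W"
    show "right_axially_polyharmonic (h - l + 1) (dirac_right ((laplacian ^^ (l - 1)) f)) W"
      by (rule right_formula(1)[OF fW(1) n assms(3,4)])
    show "(\<forall>\<gamma>\<in>\<Gamma>. right_integrand l I f x \<gamma> integrable_on {0..1}) \<and>
        dirac_right ((laplacian ^^ (l - 1)) f) x = (1 / (2 * pi)) *\<^sub>R right_integral l I \<Gamma> f x"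
      if "I \<in> imag_units" "positively_oriented_boundary (slice I U) \<Gamma>" "x \<in> U" for I \<Gamma> x
      by (rule right_formula(2)[OF fW(1) n assms(3,4) dom[OF assms(5)] fW(2) that])
    show "right_integral l I \<Gamma> f x = right_integral l I' \<Gamma>' f x"
      if "bounded_slice_cauchy_domain U'" "closure U' \<subseteq> W" "I \<in> imag_units" "I' \<in> imag_units"
        "positively_oriented_boundary (slice I U) \<Gamma>" "positively_oriented_boundary (slice I' U') \<Gamma>'"
        "x \<in> U \<inter> U'" for U' I I' \<Gamma> \<Gamma>' x
    proof (rule cancel)
      have x: "x \<in> U" "x \<in> U'" using that(7) by auto
      show "(1 / (2 * pi)) *\<^sub>R right_integral l I \<Gamma> f x = (1 / (2 * pi)) *\<^sub>R right_integral l I' \<Gamma>' f x"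
        unfolding right[OF fW(1) assms(5) fW(2) that(3,5) x(1)] right[OF fW(1) that(1,2,4,6) x(2)] ..
    qed
    show "right_integral l I \<Gamma> g x = right_integral l I \<Gamma> f x"
      if "right_slice_hyperholomorphic g W'" "closure U \<subseteq> W'"
        "\<forall>y\<in>U. dirac_right ((laplacian ^^ (l - 1)) g) y = dirac_right ((laplacian ^^ (l - 1)) f) y"
        "I \<in> imag_units" "positively_oriented_boundary (slice I U) \<Gamma>" "x \<in> U" for g W' I \<Gamma> x
    proof (rule cancel)
      show "(1 / (2 * pi)) *\<^sub>R right_integral l I \<Gamma> g x = (1 / (2 * pi)) *\<^sub>R right_integral l I \<Gamma> f x"
        unfolding right[OF fW(1) assms(5) fW(2) that(4,5,6)] right[OF that(1) assms(5) that(2,4,5,6)]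
        using that(3,6) by blast
    qed
  qed
qed

end
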